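(* Let $V_+,V_-\in\mathbb{C}$ be such that $\mathrm{Im}\,V_+\ne\mathrm{Im}\,V_-$, let $\alpha\in\mathbb{C}\setminus\{0\}$, let $V(x)=V_+$ for $x\ge0$ and $V(x)=V_-$ for $x<0$, and let $\mathcal{L}_\alpha$ be the operator on $L^2(\mathbb{R})$ given by $$\mathrm{Dom}(\mathcal{L}_\alpha)=\{u\in H^1(\mathbb{R})\cap H^2(\mathbb{R}\setminus\{0\}):u'(0^+)-u'(0^-)=\alpha u(0)\},\qquad \mathcal{L}_\alpha u=-u''+V(x)u.$$ Let $z\in\mathbb{C}$ be such that $\mathrm{Im}\,z\in|(\mathrm{Im}\,V_+,\mathrm{Im}\,V_-)|$. Then $$\|(\mathcal{L}_\alpha-z)^{-1}\|=\frac{|\mathrm{Im}\,V_+-\mathrm{Im}\,V_-|\,\sqrt{\mathrm{Re}\,z}}{|\alpha|\,|\mathrm{Im}\,V_+-\mathrm{Im}\,z|\,|\mathrm{Im}\,V_--\mathrm{Im}\,z|}\left(1+\mathcal{O}\left(\frac{1}{|\mathrm{Re}\,z|^{1/2}}\right)\right)$$ as $\mathrm{Re}\,z\to+\infty$, uniformly for all $\mathrm{Im}\,z\in|(\mathrm{Im}\,V_+,\mathrm{Im}\,V_-)|$.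
   Context: For real $a\ne b$, $|(a,b)|$ denotes the open interval with endpoints $a$ and $b$. The norm is the operator norm on $L^2(\mathbb{R})$. The asymptotic statement means: there are constants $M,C>0$ depending only on $V_+,V_-,\alpha$ such that for all $z$ with $\mathrm{Re}\,z\ge M$ and $\mathrm{Im}\,z\in|(\mathrm{Im}\,V_+,\mathrm{Im}\,V_-)|$, $z$ lies in the resolvent set of $\mathcal{L}_\alpha$ and the left side divided by the explicit leading factor on the right differs from $1$ by at most $C/|\mathrm{Re}\,z|^{1/2}$ in absolute value. *)

theory Defs
  imports "HOL-Analysis.Analysis"
begin

section \<open>The Hilbert space of square-integrable functions on the real line\<close>

definition square_integrable :: "(real \<Rightarrow> complex) \<Rightarrow> bool" where
  "square_integrable f \<longleftrightarrow>
     f \<in> borel_measurable lborel \<and> integrable lborel (\<lambda>x. (cmod (f x))\<^sup>2)"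

definition l2_rel :: "(real \<Rightarrow> complex) \<Rightarrow> (real \<Rightarrow> complex) \<Rightarrow> bool" where
  "l2_rel f g \<longleftrightarrow> square_integrable f \<and> square_integrable g \<and> (AE x in lborel. f x = g x)"

quotient_type l2 = "real \<Rightarrow> complex" / partial: l2_rel
proof (rule part_equivpI)
  show "\<exists>f. l2_rel f f"
    by (rule exI[of _ "\<lambda>_. 0"]) (simp add: l2_rel_def square_integrable_def)
  show "symp l2_rel"
    by (auto simp: symp_def l2_rel_def elim: AE_mp)
  show "transp l2_rel"
    unfolding transp_def l2_rel_def by (auto elim: AE_mp)
qed

lemma square_integrable_zero: "square_integrable (\<lambda>_. 0)"
  by (simp add: square_integrable_def)

lemma square_integrable_add:
  assumes "square_integrable f" "square_integrable g"
  shows "square_integrable (\<lambda>x. f x + g x)"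
proof -
  have [measurable]: "f \<in> borel_measurable lborel" "g \<in> borel_measurable lborel"
    and i: "integrable lborel (\<lambda>x. (cmod (f x))\<^sup>2)" "integrable lborel (\<lambda>x. (cmod (g x))\<^sup>2)"
    using assms by (auto simp: square_integrable_def)
  have "integrable lborel (\<lambda>x. (cmod (f x + g x))\<^sup>2)"
  proof (rule Bochner_Integration.integrable_bound)
    show "integrable lborel (\<lambda>x. 2 * (cmod (f x))\<^sup>2 + 2 * (cmod (g x))\<^sup>2)"
      using i by simp
    show "AE x in lborel. norm ((cmod (f x + g x))\<^sup>2) \<le>
        norm (2 * (cmod (f x))\<^sup>2 + 2 * (cmod (g x))\<^sup>2)"
    proof (rule AE_I2)
      fix x
      have "(cmod (f x + g x))\<^sup>2 \<le> (cmod (f x) + cmod (g x))\<^sup>2"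
        by (intro power_mono norm_triangle_ineq norm_ge_zero)
      also have "\<dots> \<le> 2 * (cmod (f x))\<^sup>2 + 2 * (cmod (g x))\<^sup>2"
        using sum_squares_bound[of "cmod (f x)" "cmod (g x)"] by (simp add: power2_sum)
      finally show "norm ((cmod (f x + g x))\<^sup>2) \<le> norm (2 * (cmod (f x))\<^sup>2 + 2 * (cmod (g x))\<^sup>2)"
        by simp
    qed
  qed measurable
  then show ?thesis by (simp add: square_integrable_def)
qed

lemma square_integrable_bounded_mult:
  assumes "square_integrable f" "m \<in> borel_measurable lborel" "\<And>x. cmod (m x) \<le> B"
  shows "square_integrable (\<lambda>x. m x * f x)"
proof -
  have [measurable]: "f \<in> borel_measurable lborel" "m \<in> borel_measurable lborel"
    and i: "integrable lborel (\<lambda>x. (cmod (f x))\<^sup>2)"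
    using assms by (auto simp: square_integrable_def)
  have "integrable lborel (\<lambda>x. (cmod (m x * f x))\<^sup>2)"
  proof (rule Bochner_Integration.integrable_bound)
    show "integrable lborel (\<lambda>x. B\<^sup>2 * (cmod (f x))\<^sup>2)"
      using i by simp
    show "AE x in lborel. norm ((cmod (m x * f x))\<^sup>2) \<le> norm (B\<^sup>2 * (cmod (f x))\<^sup>2)"
      using assms(3)
      by (intro AE_I2) (auto simp: norm_mult power_mult_distrib intro!: mult_right_mono power_mono)
  qed measurable
  then show ?thesis by (simp add: square_integrable_def)
qed

lemma square_integrable_cmult: "square_integrable f \<Longrightarrow> square_integrable (\<lambda>x. c * f x)"
  by (rule square_integrable_bounded_mult[of f "\<lambda>_. c" "cmod c"]) auto

definition l2_norm :: "(real \<Rightarrow> complex) \<Rightarrow> real" where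
  "l2_norm f = sqrt (LINT x|lborel. (cmod (f x))\<^sup>2)"

lemma l2_norm_power2: "(l2_norm f)\<^sup>2 = (LINT x|lborel. (cmod (f x))\<^sup>2)"
  by (simp add: l2_norm_def)

lemma l2_norm_nonneg: "0 \<le> l2_norm f"
  by (simp add: l2_norm_def)

lemma l2_norm_triangle:
  assumes f: "square_integrable f" and g: "square_integrable g"
  shows "l2_norm (\<lambda>x. f x + g x) \<le> l2_norm f + l2_norm g"
proof (rule field_le_epsilon)
  fix e :: real assume e: "0 < e"
  define a b where "a = l2_norm f + e / 2" and "b = l2_norm g + e / 2"
  have a: "a > 0" "l2_norm f \<le> a" and b: "b > 0" "l2_norm g \<le> b"
    using e l2_norm_nonneg[of f] l2_norm_nonneg[of g] by (auto simp: a_def b_def)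
  have i: "integrable lborel (\<lambda>x. (cmod (f x))\<^sup>2)" "integrable lborel (\<lambda>x. (cmod (g x))\<^sup>2)"
    "integrable lborel (\<lambda>x. (cmod (f x + g x))\<^sup>2)"
    using f g square_integrable_add[OF f g] by (auto simp: square_integrable_def)
  have pw: "(cmod (f x + g x))\<^sup>2 \<le> (a + b) * ((cmod (f x))\<^sup>2 / a + (cmod (g x))\<^sup>2 / b)" for x
  proof -
    let ?s = "cmod (f x)" and ?t = "cmod (g x)"
    have "(cmod (f x + g x))\<^sup>2 \<le> (?s + ?t)\<^sup>2"
      by (intro power_mono norm_triangle_ineq norm_ge_zero)
    also have "\<dots> \<le> (?s + ?t)\<^sup>2 + (b * ?s - a * ?t)\<^sup>2 / (a * b)"
      using a b by simp
    also have "\<dots> = (a + b) * (?s\<^sup>2 / a + ?t\<^sup>2 / b)"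
      using a b by (simp add: field_simps power2_eq_square)
    finally show ?thesis .
  qed
  have "(l2_norm (\<lambda>x. f x + g x))\<^sup>2
      \<le> (LINT x|lborel. (a + b) * ((cmod (f x))\<^sup>2 / a + (cmod (g x))\<^sup>2 / b))"
    unfolding l2_norm_power2 using i pw by (intro integral_mono) auto
  also have "\<dots> = (a + b) * ((l2_norm f)\<^sup>2 / a + (l2_norm g)\<^sup>2 / b)"
    unfolding l2_norm_power2 using i by simp
  also have "\<dots> \<le> (a + b) * (a\<^sup>2 / a + b\<^sup>2 / b)"
    using a b l2_norm_nonneg by (intro mult_left_mono add_mono divide_right_mono power_mono) auto
  also have "\<dots> = (a + b)\<^sup>2"
    using a b by (simp add: power2_eq_square)
  finally have "l2_norm (\<lambda>x. f x + g x) \<le> a + b"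
    by (rule power2_le_imp_le) (use a b in simp)
  then show "l2_norm (\<lambda>x. f x + g x) \<le> l2_norm f + l2_norm g + e"
    by (simp add: a_def b_def)
qed

lemma l2_norm_eq_0_iff:
  assumes "square_integrable f"
  shows "l2_norm f = 0 \<longleftrightarrow> (AE x in lborel. f x = 0)"
proof -
  have "l2_norm f = 0 \<longleftrightarrow> (AE x in lborel. (cmod (f x))\<^sup>2 = 0)"
    using assms unfolding l2_norm_def square_integrable_def real_sqrt_eq_0_iff
    by (subst integral_nonneg_eq_0_iff_AE) auto
  then show ?thesis by simp
qed

lemma l2_norm_cmult: "l2_norm (\<lambda>x. c * f x) = cmod c * l2_norm f"
  by (simp add: l2_norm_def norm_mult power_mult_distrib real_sqrt_mult)

lemma l2_norm_cong_AE:
  assumes "l2_rel f g"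
  shows "l2_norm f = l2_norm g"
proof -
  have [measurable]: "f \<in> borel_measurable lborel" "g \<in> borel_measurable lborel"
    and ae: "AE x in lborel. f x = g x"
    using assms by (auto simp: l2_rel_def square_integrable_def)
  have "(LINT x|lborel. (cmod (f x))\<^sup>2) = (LINT x|lborel. (cmod (g x))\<^sup>2)"
    by (rule integral_cong_AE) (use ae in auto)
  then show ?thesis by (simp add: l2_norm_def)
qed

instantiation l2 :: real_normed_vector
begin

lift_definition zero_l2 :: l2 is "\<lambda>_. 0"
  by (simp add: l2_rel_def square_integrable_zero)

lift_definition plus_l2 :: "l2 \<Rightarrow> l2 \<Rightarrow> l2" is "\<lambda>f g x. f x + g x"
  by (auto simp: l2_rel_def square_integrable_add elim: AE_mp)

lift_definition uminus_l2 :: "l2 \<Rightarrow> l2" is "\<lambda>f x. - f x"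
  by (auto simp: l2_rel_def square_integrable_def elim: AE_mp)

definition minus_l2 :: "l2 \<Rightarrow> l2 \<Rightarrow> l2" where
  "minus_l2 u v = u + - v"

lift_definition scaleR_l2 :: "real \<Rightarrow> l2 \<Rightarrow> l2" is "\<lambda>r f x. complex_of_real r * f x"
  by (auto simp: l2_rel_def intro!: square_integrable_cmult elim: AE_mp)

lift_definition norm_l2 :: "l2 \<Rightarrow> real" is l2_norm
  by (rule l2_norm_cong_AE)

definition dist_l2 :: "l2 \<Rightarrow> l2 \<Rightarrow> real" where
  "dist_l2 u v = norm (u - v)"

definition sgn_l2 :: "l2 \<Rightarrow> l2" where
  "sgn_l2 u = inverse (norm u) *\<^sub>R u"

definition uniformity_l2 :: "(l2 \<times> l2) filter" where
  "uniformity_l2 = (INF e\<in>{0<..}. principal {(u, v). dist u v < e})"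

definition open_l2 :: "l2 set \<Rightarrow> bool" where
  "open_l2 S \<longleftrightarrow> (\<forall>u\<in>S. \<forall>\<^sub>F (u', v) in uniformity. u' = u \<longrightarrow> v \<in> S)"

instance
proof
  fix a b c :: l2 and r s :: real
  show "a + b + c = a + (b + c)"
    by transfer (auto simp: l2_rel_def add.assoc intro!: square_integrable_add)
  show "a + b = b + a"
    by transfer (auto simp: l2_rel_def add.commute intro!: square_integrable_add)
  show "0 + a = a"
    by transfer (auto simp: l2_rel_def)
  show "- a + a = 0"
    by transfer (auto simp: l2_rel_def square_integrable_zero)
  show "a - b = a + - b"
    by (simp add: minus_l2_def)
  show "r *\<^sub>R (a + b) = r *\<^sub>R a + r *\<^sub>R b"
    by transfer (auto simp: l2_rel_def ring_distribs
        intro!: square_integrable_add square_integrable_cmult)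
  show "(r + s) *\<^sub>R a = r *\<^sub>R a + s *\<^sub>R a"
    by transfer (auto simp: l2_rel_def ring_distribs
        intro!: square_integrable_add square_integrable_cmult)
  show "r *\<^sub>R s *\<^sub>R a = (r * s) *\<^sub>R a"
    by transfer (auto simp: l2_rel_def mult.assoc intro!: square_integrable_cmult)
  show "1 *\<^sub>R a = a"
    by transfer (auto simp: l2_rel_def)
  show "dist a b = norm (a - b)"
    by (fact dist_l2_def)
  show "sgn a = inverse (norm a) *\<^sub>R a"
    by (fact sgn_l2_def)
  show "(uniformity :: (l2 \<times> l2) filter) = (INF e\<in>{0<..}. principal {(u, v). dist u v < e})"
    by (fact uniformity_l2_def)
  show "open S \<longleftrightarrow> (\<forall>u\<in>S. \<forall>\<^sub>F (u', v) in uniformity. u' = u \<longrightarrow> v \<in> S)" for S :: "l2 set"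
    by (fact open_l2_def)
  show "norm a = 0 \<longleftrightarrow> a = 0"
    by transfer (auto simp: l2_rel_def l2_norm_eq_0_iff square_integrable_zero)
  show "norm (a + b) \<le> norm a + norm b"
    by transfer (auto simp: l2_rel_def intro!: l2_norm_triangle)
  show "norm (r *\<^sub>R a) = \<bar>r\<bar> * norm a"
    by transfer (simp add: l2_norm_cmult)
qed

end

lift_definition scaleC_l2 :: "complex \<Rightarrow> l2 \<Rightarrow> l2"  (infixr "*\<^sub>C" 75) is "\<lambda>c f x. c * f x"
  by (auto simp: l2_rel_def intro!: square_integrable_cmult elim: AE_mp)

section \<open>Weak derivatives and Sobolev spaces\<close>

definition test_functions :: "real set \<Rightarrow> (real \<Rightarrow> real) set" where
  "test_functions \<Omega> = {\<phi>. (\<forall>n. (deriv ^^ n) \<phi> differentiable_on UNIV) \<and>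
     compact (closure {x. \<phi> x \<noteq> 0}) \<and> closure {x. \<phi> x \<noteq> 0} \<subseteq> \<Omega>}"

text \<open>
  Below, \<open>\<Omega>\<close> is always an open set with Lebesgue-null complement (namely the real line, or the
  real line without the origin), so that the square-integrable functions on \<open>\<Omega>\<close> are the elements
  of \<^typ>\<open>l2\<close>. Real-valued test functions suffice, the defining identity being complex-linear in
  the test function.
\<close>

definition has_weak_derivative :: "nat \<Rightarrow> real set \<Rightarrow> l2 \<Rightarrow> l2 \<Rightarrow> bool" where
  "has_weak_derivative k \<Omega> u v \<longleftrightarrow> (\<forall>\<phi>\<in>test_functions \<Omega>.
     (LINT x|lborel. rep_l2 u x * of_real ((deriv ^^ k) \<phi> x)) =
     (-1) ^ k * (LINT x|lborel. rep_l2 v x * of_real (\<phi> x)))"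

definition weak_derivative :: "nat \<Rightarrow> real set \<Rightarrow> l2 \<Rightarrow> l2" where
  "weak_derivative k \<Omega> u = (THE v. has_weak_derivative k \<Omega> u v)"

definition sobolev :: "nat \<Rightarrow> real set \<Rightarrow> l2 set" where
  "sobolev k \<Omega> = {u. \<forall>j\<le>k. \<exists>v. has_weak_derivative j \<Omega> u v}"

text \<open>
  Pointwise and one-sided boundary values of a class of functions, taken for the representative
  that is continuous on the whole line, respectively on the open half-line to the right or left
  of the point.
\<close>

definition point_value :: "l2 \<Rightarrow> real \<Rightarrow> complex" where
  "point_value u a = (THE c. \<exists>g. continuous_on UNIV g \<and>
     (AE x in lborel. g x = rep_l2 u x) \<and> g a = c)"

definition right_value :: "l2 \<Rightarrow> real \<Rightarrow> complex" where
  "right_value u a = (THE c. \<exists>g. continuous_on {a<..} g \<and>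
     (AE x in lborel. a < x \<longrightarrow> g x = rep_l2 u x) \<and> (g \<longlongrightarrow> c) (at_right a))"

definition left_value :: "l2 \<Rightarrow> real \<Rightarrow> complex" where
  "left_value u a = (THE c. \<exists>g. continuous_on {..<a} g \<and>
     (AE x in lborel. x < a \<longrightarrow> g x = rep_l2 u x) \<and> (g \<longlongrightarrow> c) (at_left a))"

section \<open>Resolvents of unbounded operators\<close>

text \<open>
  An unbounded operator is given by its domain \<open>D\<close> and a map \<open>T\<close>, of which only the values on \<open>D\<close>
  are relevant. The operators to which this is applied are complex-linear, hence so is the inverse
  of \<open>T - z\<close>, and the real-linear notion \<^const>\<open>bounded_linear\<close> amounts to boundedness of the inverse.
  The norm \<^const>\<open>onorm\<close> does not depend on the scalar field.
\<close>

definition resolvent :: "l2 set \<Rightarrow> (l2 \<Rightarrow> l2) \<Rightarrow> complex \<Rightarrow> l2 \<Rightarrow> l2" where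
  "resolvent D T z = inv_into D (\<lambda>u. T u - z *\<^sub>C u)"

definition resolvent_set :: "l2 set \<Rightarrow> (l2 \<Rightarrow> l2) \<Rightarrow> complex set" where
  "resolvent_set D T = {z. bij_betw (\<lambda>u. T u - z *\<^sub>C u) D UNIV \<and> bounded_linear (resolvent D T z)}"

section \<open>The Schroedinger operator with a step potential and a point interaction\<close>

definition step_potential :: "complex \<Rightarrow> complex \<Rightarrow> real \<Rightarrow> complex" where
  "step_potential Vp Vm x = (if x \<ge> 0 then Vp else Vm)"

lemma square_integrable_step_potential:
  assumes "square_integrable f"
  shows "square_integrable (\<lambda>x. step_potential Vp Vm x * f x)"
proof (rule square_integrable_bounded_mult[OF assms])
  show "step_potential Vp Vm \<in> borel_measurable lborel"
    unfolding step_potential_def by measurable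
  show "cmod (step_potential Vp Vm x) \<le> max (cmod Vp) (cmod Vm)" for x
    by (simp add: step_potential_def)
qed

lift_definition mult_step_potential :: "complex \<Rightarrow> complex \<Rightarrow> l2 \<Rightarrow> l2"
  is "\<lambda>Vp Vm f x. step_potential Vp Vm x * f x"
  by (auto simp: l2_rel_def intro!: square_integrable_step_potential elim: AE_mp)

definition dom_L :: "complex \<Rightarrow> l2 set" where
  "dom_L \<alpha> = {u \<in> sobolev 1 UNIV \<inter> sobolev 2 (UNIV - {0}).
     right_value (weak_derivative 1 (UNIV - {0}) u) 0 - left_value (weak_derivative 1 (UNIV - {0}) u) 0
       = \<alpha> * point_value u 0}"

definition op_L :: "complex \<Rightarrow> complex \<Rightarrow> l2 \<Rightarrow> l2" where
  "op_L Vp Vm u = - weak_derivative 2 (UNIV - {0}) u + mult_step_potential Vp Vm u"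

end

theory Submission
  imports Defs "HOL-Computational_Algebra.Polynomial"
begin

text \<open>
  Let \<open>kp\<close> and \<open>km\<close> be the square roots of \<open>Vp - z\<close> and \<open>Vm - z\<close> with positive real part, let \<open>psi\<close> be the
  continuous function given by \<open>exp (- kp x)\<close> for \<open>x \<ge> 0\<close> and by \<open>exp (km x)\<close> for \<open>x \<le> 0\<close>, and put
  \<open>w = \<alpha> + kp + km\<close>. On each half-line a solution of \<open>- u'' + (V - z) u = f\<close> is the solution with Dirichlet
  condition at the origin plus the multiple \<open>u(0) psi\<close>. Inserting this into the jump condition gives
  \<open>u(0) = (\<integral>psi f) / w\<close>. So the resolvent is the integral operator with kernel
  \<open>D(x, y) + psi(x) psi(y) / w\<close>, where \<open>D\<close> combines the two half-line Dirichlet Green functions.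

  The rank-one part dominates. Its norm is exactly \<open>\<parallel>psi\<parallel>\<^sup>2 / |w|\<close>, and
  \<open>\<parallel>psi\<parallel>\<^sup>2 = 1 / (2 Re kp) + 1 / (2 Re km) = |Im kp| / |Im Vp - Im z| + |Im km| / |Im Vm - Im z|\<close>. As \<open>Re z\<close>
  tends to infinity, \<open>|Im kp|\<close> and \<open>|Im km|\<close> are asymptotic to the square root of \<open>Re z\<close>, and because \<open>Im z\<close>
  lies strictly between \<open>Im Vp\<close> and \<open>Im Vm\<close> these imaginary parts have opposite signs and cancel in
  \<open>kp + km\<close>; thus \<open>w\<close> tends to \<open>\<alpha>\<close>. This is the stated leading factor. The Dirichlet part is bounded by
  Schur's test by a constant times the reciprocal of the distance of \<open>Im z\<close> to \<open>{Im Vp, Im Vm}\<close>, which is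
  smaller than the leading factor by the order of \<open>(Re z) powr (-1/2)\<close>, uniformly in \<open>Im z\<close>
  (\<open>onorm_res_bound\<close>, \<open>csqrt_boundary_layer\<close>, \<open>resolvent_asymptotics_bound\<close>).

  That the integral operator really is the resolvent has two halves. It maps into the domain and is a
  right inverse (\<open>res_in_dom\<close>, \<open>op_res\<close>): by Fubini's theorem its weak derivatives are found by
  integrating the kernel by parts for a fixed second variable, and the boundary values at the origin
  follow by dominated convergence. It is a left inverse (\<open>res_op\<close>): a homogeneous square-integrable weak
  solution is classical by the lemma of du Bois-Reymond, hence a multiple of \<open>psi\<close>, and the jump condition
  excludes nonzero multiples because \<open>w \<noteq> 0\<close>.
\<close>

section \<open>Smooth functions and bump functions\<close>

definition smooth :: "(real \<Rightarrow> real) \<Rightarrow> bool" where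
  "smooth f \<longleftrightarrow> (\<forall>n. (deriv ^^ n) f differentiable_on UNIV)"

text \<open>
  To be smooth it suffices to belong to some family of functions that is closed under
  differentiation. All closure properties below are obtained by exhibiting such a family.
\<close>

lemma smooth_coinduct:
  assumes "f \<in> S" and step: "\<And>g. g \<in> S \<Longrightarrow> \<exists>g'\<in>S. \<forall>x. (g has_real_derivative g' x) (at x)"
  shows "smooth f"
proof -
  have "(deriv ^^ n) f \<in> S" for n
  proof (induction n)
    case (Suc n)
    then obtain g' where g': "g' \<in> S" "\<And>x. ((deriv ^^ n) f has_real_derivative g' x) (at x)"
      using step by blast
    then have "deriv ((deriv ^^ n) f) = g'" by (auto intro: DERIV_imp_deriv)
    then show ?case using g' by simp
  qed (use assms in simp)
  then have "(deriv ^^ n) f differentiable_on UNIV" for n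
    using step by (metis (no_types, lifting) differentiable_on_def differentiable_at_withinI real_differentiable_def)
  then show ?thesis by (simp add: smooth_def)
qed

lemma smooth_DERIV:
  assumes "smooth f" shows "(f has_real_derivative deriv f x) (at x)"
proof -
  have "(deriv ^^ 0) f differentiable_on UNIV" using assms unfolding smooth_def by blast
  then have "f differentiable at x" by (simp add: differentiable_on_def)
  then show ?thesis using DERIV_deriv_iff_real_differentiable by blast
qed

lemma smooth_deriv: assumes "smooth f" shows "smooth (deriv f)"
  unfolding smooth_def
proof
  fix n
  have "(deriv ^^ Suc n) f differentiable_on UNIV" using assms unfolding smooth_def by blast
  then show "(deriv ^^ n) (deriv f) differentiable_on UNIV" by (simp add: funpow_swap1)
qed

lemma smooth_continuous_on: "smooth f \<Longrightarrow> continuous_on A f"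
  by (meson DERIV_isCont continuous_at_imp_continuous_on smooth_DERIV)

lemma smooth_const: "smooth (\<lambda>_. c)"
  by (rule smooth_coinduct[of _ "range (\<lambda>c _. c)"]) (auto intro!: bexI[of _ "\<lambda>_. 0"] derivative_eq_intros)

lemma smooth_add: assumes "smooth f" "smooth g" shows "smooth (\<lambda>x. f x + g x)"
proof (rule smooth_coinduct[of _ "{\<lambda>x. f x + g x |f g. smooth f \<and> smooth g}"])
  fix h assume "h \<in> {\<lambda>x. f x + g x |f g. smooth f \<and> smooth g}"
  then obtain f g where h: "h = (\<lambda>x. f x + g x)" "smooth f" "smooth g" by blast
  show "\<exists>g'\<in>{\<lambda>x. f x + g x |f g. smooth f \<and> smooth g}. \<forall>x. (h has_real_derivative g' x) (at x)"
  proof (intro bexI[of _ "\<lambda>x. deriv f x + deriv g x"] allI)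
    show "(h has_real_derivative deriv f x + deriv g x) (at x)" for x
      using h by (auto intro!: derivative_eq_intros smooth_DERIV)
  qed (use h smooth_deriv in blast)
qed (use assms in blast)

text \<open>
  Products alone are not closed under differentiation; finite sums of products are.
\<close>

inductive_set product_sums :: "(real \<Rightarrow> real) set" where
  prod: "smooth f \<Longrightarrow> smooth g \<Longrightarrow> (\<lambda>x. f x * g x) \<in> product_sums"
| sum: "f \<in> product_sums \<Longrightarrow> g \<in> product_sums \<Longrightarrow> (\<lambda>x. f x + g x) \<in> product_sums"

lemma smooth_mult: assumes "smooth f" "smooth g" shows "smooth (\<lambda>x. f x * g x)"
proof (rule smooth_coinduct[of _ product_sums])
  fix h assume "h \<in> product_sums"
  then show "\<exists>g'\<in>product_sums. \<forall>x. (h has_real_derivative g' x) (at x)"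
  proof induction
    case (prod f g)
    then show ?case
      by (intro bexI[of _ "\<lambda>x. deriv f x * g x + f x * deriv g x"])
        (auto intro!: derivative_eq_intros smooth_DERIV product_sums.intros smooth_deriv)
  next
    case (sum f g)
    then obtain f' g' where "f' \<in> product_sums" "g' \<in> product_sums"
      "\<forall>x. (f has_real_derivative f' x) (at x)" "\<forall>x. (g has_real_derivative g' x) (at x)" by blast
    then show ?case
      by (intro bexI[of _ "\<lambda>x. f' x + g' x"])
        (auto intro!: derivative_eq_intros product_sums.intros)
  qed
qed (use assms in \<open>auto intro: product_sums.intros\<close>)

lemma smooth_exp: assumes "smooth f" shows "smooth (\<lambda>x. exp (f x))"
proof (rule smooth_coinduct[of _ "{\<lambda>x. g x * exp (f x) |g. smooth g}"])
  show "(\<lambda>x. exp (f x)) \<in> {\<lambda>x. g x * exp (f x) |g. smooth g}"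
    using smooth_const[of 1] by force
  fix h assume "h \<in> {\<lambda>x. g x * exp (f x) |g. smooth g}"
  then obtain g where h: "h = (\<lambda>x. g x * exp (f x))" "smooth g" by blast
  have "smooth (\<lambda>x. deriv g x + g x * deriv f x)"
    using assms h by (intro smooth_add smooth_mult smooth_deriv)
  then show "\<exists>g'\<in>{\<lambda>x. g x * exp (f x) |g. smooth g}. \<forall>x. (h has_real_derivative g' x) (at x)"
  proof (intro bexI[of _ "\<lambda>x. (deriv g x + g x * deriv f x) * exp (f x)"] allI)
    show "(h has_real_derivative (deriv g x + g x * deriv f x) * exp (f x)) (at x)" for x
      using h assms by (auto intro!: derivative_eq_intros smooth_DERIV simp: algebra_simps)
    show "(\<lambda>x. (deriv g x + g x * deriv f x) * exp (f x)) \<in> {\<lambda>x. g x * exp (f x) |g. smooth g}"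
      using \<open>smooth (\<lambda>x. deriv g x + g x * deriv f x)\<close>
      by (intro CollectI exI[of _ "\<lambda>x. deriv g x + g x * deriv f x"]) simp
  qed
qed

lemma smooth_affine: assumes "smooth f" shows "smooth (\<lambda>x. f (a * x + b))"
proof (rule smooth_coinduct[of _ "{\<lambda>x. f (a * x + b) |f. smooth f}"])
  fix h assume "h \<in> {\<lambda>x. f (a * x + b) |f. smooth f}"
  then obtain f where h: "h = (\<lambda>x. f (a * x + b))" "smooth f" by blast
  have "smooth (\<lambda>x. a * deriv f x)"
    using h by (intro smooth_mult smooth_const smooth_deriv)
  then show "\<exists>g'\<in>{\<lambda>x. f (a * x + b) |f. smooth f}. \<forall>x. (h has_real_derivative g' x) (at x)"
  proof (intro bexI[of _ "\<lambda>x. a * deriv f (a * x + b)"] allI)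
    show "(h has_real_derivative a * deriv f (a * x + b)) (at x)" for x
      unfolding h by (rule DERIV_chain2[OF smooth_DERIV[OF h(2)], THEN DERIV_cong])
        (auto intro!: derivative_eq_intros)
    show "(\<lambda>x. a * deriv f (a * x + b)) \<in> {\<lambda>x. f (a * x + b) |f. smooth f}"
      using \<open>smooth (\<lambda>x. a * deriv f x)\<close>
      by (intro CollectI exI[of _ "\<lambda>x. a * deriv f x"]) simp
  qed
qed (use assms in blast)

lemma smooth_antideriv:
  assumes "smooth f" "\<And>x. (F has_real_derivative f x) (at x)" shows "smooth F"
proof (rule smooth_coinduct[of _ "insert F (Collect smooth)"])
  fix g assume "g \<in> insert F (Collect smooth)"
  then show "\<exists>g'\<in>insert F (Collect smooth). \<forall>x. (g has_real_derivative g' x) (at x)"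
    using assms smooth_DERIV smooth_deriv by blast
qed simp

text \<open>
  The functions \<open>p (1/x) exp (-1/x)\<close>, extended by zero to \<open>x \<le> 0\<close>, with \<open>p\<close> a polynomial. Together they
  form a family closed under differentiation that contains the flat function \<open>exp (-1/x)\<close>.
\<close>

definition flat :: "real poly \<Rightarrow> real \<Rightarrow> real" where
  "flat p x = (if x > 0 then poly p (1 / x) * exp (- (1 / x)) else 0)"

lemma poly_mult_exp_tendsto_0: "((\<lambda>t. poly p t * exp (- t)) \<longlongrightarrow> (0::real)) at_top"
proof -
  have "((\<lambda>t. \<Sum>i\<le>degree p. coeff p i * (t ^ i / exp t)) \<longlongrightarrow> (\<Sum>i\<le>degree p. coeff p i * 0)) at_top"
    by (intro tendsto_sum tendsto_mult tendsto_const tendsto_power_div_exp_0)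
  moreover have "(\<lambda>t. \<Sum>i\<le>degree p. coeff p i * (t ^ i / exp t)) = (\<lambda>t. poly p t * exp (- t))"
    by (simp add: poly_altdef sum_distrib_right exp_minus divide_inverse mult.assoc)
  ultimately show ?thesis by simp
qed

text \<open>
  For \<open>x > 0\<close> the chain rule produces the factor \<open>1/x\<^sup>2\<close> and the coefficient \<open>p - p'\<close>, whence the
  polynomial \<open>X\<^sup>2 (p - p')\<close>. The difference quotient at \<open>0\<close> is a function of the same kind, with
  \<open>X p\<close> in place of \<open>p\<close>, and so tends to zero.
\<close>

lemma flat_DERIV:
  "(flat p has_real_derivative flat ([:0, 0, 1:] * (p - pderiv p)) x) (at x)"
proof (cases x "0::real" rule: linorder_cases)
  case less
  have "((\<lambda>_. 0) has_real_derivative 0) (at x)" by simp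
  then have "(flat p has_real_derivative 0) (at x)"
    by (rule has_field_derivative_transform_within_open[of _ _ _ "{..<0}"]) (use less in \<open>auto simp: flat_def\<close>)
  then show ?thesis using less by (simp add: flat_def)
next
  case greater
  have "((\<lambda>x. poly p (1 / x) * exp (- (1 / x))) has_real_derivative
      flat ([:0, 0, 1:] * (p - pderiv p)) x) (at x)"
    using greater
    by (auto intro!: derivative_eq_intros DERIV_chain2[OF poly_DERIV]
        simp: flat_def field_simps power2_eq_square)
  then show ?thesis
    by (rule has_field_derivative_transform_within_open[of _ _ _ "{0<..}"]) (use greater in \<open>auto simp: flat_def\<close>)
next
  case equal
  have "((\<lambda>h. poly (pCons 0 p) (inverse h) * exp (- inverse h)) \<longlongrightarrow> 0) (at_right 0)"
    by (rule filterlim_compose[OF poly_mult_exp_tendsto_0 filterlim_inverse_at_top_right])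
  then have r: "((\<lambda>h. flat p h / h) \<longlongrightarrow> 0) (at_right 0)"
    by (rule Lim_transform_eventually)
      (auto simp: flat_def eventually_at_right_less eventually_at_filter field_simps)
  have l: "((\<lambda>h. flat p h / h) \<longlongrightarrow> 0) (at_left 0)"
    by (rule Lim_transform_eventually[OF tendsto_const])
      (auto simp: flat_def eventually_at_filter)
  have "((\<lambda>h. flat p h / h) \<longlongrightarrow> 0) (at 0)"
    using l r filterlim_split_at by blast
  then show ?thesis
    using equal by (simp add: DERIV_def) (simp add: flat_def)
qed

lemma smooth_flat: "smooth (flat p)"
  by (rule smooth_coinduct[of _ "range flat"]) (auto intro: flat_DERIV)

definition bump :: "real \<Rightarrow> real \<Rightarrow> real \<Rightarrow> real" where
  "bump a b x = flat 1 (x - a) * flat 1 (b - x)"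

lemma smooth_bump: "smooth (bump a b)"
  using smooth_mult[OF smooth_affine[OF smooth_flat, of 1 1 "-a"] smooth_affine[OF smooth_flat, of 1 "-1" b]]
  by (simp add: bump_def[abs_def])

lemma bump_pos_iff: "bump a b x > 0 \<longleftrightarrow> a < x \<and> x < b"
  by (auto simp: bump_def flat_def)

lemma bump_nonneg: "bump a b x \<ge> 0"
  by (auto simp: bump_def flat_def)

lemma test_functions_iff:
  "\<phi> \<in> test_functions \<Omega> \<longleftrightarrow> smooth \<phi> \<and>
     compact (closure {x. \<phi> x \<noteq> 0}) \<and> closure {x. \<phi> x \<noteq> 0} \<subseteq> \<Omega>"
  by (simp add: test_functions_def smooth_def)

lemma test_functions_mono: "\<Omega> \<subseteq> \<Omega>' \<Longrightarrow> test_functions \<Omega> \<subseteq> test_functions \<Omega>'"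
  by (auto simp: test_functions_def)

lemma test_functionsI:
  assumes "smooth \<phi>" "{c..d} \<subseteq> \<Omega>" "\<And>x. x \<notin> {c..d} \<Longrightarrow> \<phi> x = 0"
  shows "\<phi> \<in> test_functions \<Omega>"
proof -
  have "{x. \<phi> x \<noteq> 0} \<subseteq> {c..d}"
    using assms(3) by blast
  then have sub: "closure {x. \<phi> x \<noteq> 0} \<subseteq> {c..d}"
    by (simp add: closure_minimal)
  then have "compact (closure {x. \<phi> x \<noteq> 0})"
    using bounded_closed_interval bounded_subset compact_eq_bounded_closed by blast
  then show ?thesis
    using assms sub by (auto simp: test_functions_iff)
qed

section \<open>Test functions and the lemma of du Bois-Reymond\<close>

definition locally_integrable :: "(real \<Rightarrow> complex) \<Rightarrow> bool" where
  "locally_integrable w \<longleftrightarrow> (\<forall>a b. set_integrable lborel {a..b} w)"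

abbreviation pairing :: "(real \<Rightarrow> complex) \<Rightarrow> (real \<Rightarrow> real) \<Rightarrow> complex" where
  "pairing u \<phi> \<equiv> LINT x|lborel. u x * complex_of_real (\<phi> x)"

lemma locally_integrable_diff:
  "locally_integrable u \<Longrightarrow> locally_integrable v \<Longrightarrow> locally_integrable (\<lambda>x. u x - v x)"
  by (simp add: locally_integrable_def)

lemma locally_integrable_continuous: "continuous_on UNIV w \<Longrightarrow> locally_integrable w"
  unfolding locally_integrable_def
  by (meson borel_integrable_atLeastAtMost' continuous_on_subset subset_UNIV)

lemma locally_integrable_mult_compact_support:
  assumes w: "locally_integrable w" and \<phi>: "continuous_on UNIV \<phi>" "\<And>x. x \<notin> {a..b} \<Longrightarrow> \<phi> x = 0"
  shows "integrable lborel (\<lambda>x. w x * \<phi> x)"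
proof -
  have "bounded (\<phi> ` {a..b})"
    by (meson \<phi>(1) compact_Icc compact_continuous_image compact_imp_bounded continuous_on_subset subset_UNIV)
  then obtain B where B: "\<And>x. x \<in> {a..b} \<Longrightarrow> cmod (\<phi> x) \<le> B"
    unfolding bounded_iff by blast
  have [measurable]: "\<phi> \<in> borel_measurable borel"
    using \<phi>(1) by (rule borel_measurable_continuous_onI)
  have i: "integrable lborel (\<lambda>x. indicator {a..b} x *\<^sub>R w x)"
    using w by (simp add: locally_integrable_def set_integrable_def)
  then have "integrable lborel (\<lambda>x. (indicator {a..b} x *\<^sub>R w x) * \<phi> x)"
  proof (rule Bochner_Integration.integrable_bound[OF integrable_mult_right[of B, OF integrable_norm]])
    have [measurable]: "(\<lambda>x. indicator {a..b} x *\<^sub>R w x) \<in> borel_measurable borel"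
      using i borel_measurable_integrable by fastforce
    show "(\<lambda>x. (indicator {a..b} x *\<^sub>R w x) * \<phi> x) \<in> borel_measurable lborel" by measurable
    show "AE x in lborel. norm (indicator {a..b} x *\<^sub>R w x * \<phi> x) \<le> norm (B * norm (indicator {a..b} x *\<^sub>R w x))"
    proof (intro AE_I2)
      fix x
      show "norm (indicator {a..b} x *\<^sub>R w x * \<phi> x) \<le> norm (B * norm (indicator {a..b} x *\<^sub>R w x))"
      proof (cases "x \<in> {a..b}")
        case True
        then have "cmod (\<phi> x) \<le> \<bar>B\<bar>" using B by fastforce
        from mult_left_mono[OF this, of "cmod (w x)"] show ?thesis
          using True by (simp add: norm_mult abs_mult mult.commute)
      qed auto
    qed
  qed
  then show ?thesis
  proof (rule Bochner_Integration.integrable_cong[THEN iffD1, rotated -1])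
    show "indicator {a..b} x *\<^sub>R w x * \<phi> x = w x * \<phi> x" for x
      using \<phi>(2)[of x] by (cases "x \<in> {a..b}") simp_all
  qed simp
qed

lemma test_function_supportE:
  assumes "\<phi> \<in> test_functions \<Omega>" "is_interval \<Omega>" "\<Omega> \<noteq> {}"
  obtains c d where "c \<le> d" "{c..d} \<subseteq> \<Omega>" "\<And>x. x \<notin> {c..d} \<Longrightarrow> \<phi> x = 0"
proof (cases "closure {x. \<phi> x \<noteq> 0} = {}")
  case True
  obtain c where "c \<in> \<Omega>" using assms by auto
  with True show ?thesis by (intro that[of c c]) auto
next
  case False
  let ?K = "closure {x. \<phi> x \<noteq> 0}"
  have K: "compact ?K" "?K \<subseteq> \<Omega>" using assms by (auto simp: test_functions_iff)
  obtain c d where cd: "c \<in> ?K" "d \<in> ?K" "\<forall>x\<in>?K. c \<le> x" "\<forall>x\<in>?K. x \<le> d"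
    using compact_attains_sup[OF K(1) False] compact_attains_inf[OF K(1) False] by blast
  show ?thesis
  proof (rule that[of c d])
    show "{c..d} \<subseteq> \<Omega>"
    proof
      fix x assume "x \<in> {c..d}"
      then show "x \<in> \<Omega>"
        using mem_is_interval_1_I[OF assms(2), of c d x] cd K(2) by auto
    qed
    show "\<phi> x = 0" if "x \<notin> {c..d}" for x
    proof (rule ccontr)
      assume "\<phi> x \<noteq> 0" 
      then have "x \<in> ?K" using closure_subset[of "{x. \<phi> x \<noteq> 0}"] by auto
      then have "c \<le> x" "x \<le> d" using cd by blast+
      with that show False by simp
    qed
  qed (use cd in auto)
qed

lemma test_function_deriv:
  assumes "\<phi> \<in> test_functions \<Omega>"
  shows "deriv \<phi> \<in> test_functions \<Omega>"
proof -
  have s: "smooth \<phi>" and c: "compact (closure {x. \<phi> x \<noteq> 0})" "closure {x. \<phi> x \<noteq> 0} \<subseteq> \<Omega>"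
    using assms by (auto simp: test_functions_iff)
  have "{x. deriv \<phi> x \<noteq> 0} \<subseteq> closure {x. \<phi> x \<noteq> 0}"
  proof (rule subsetI, rule ccontr)
    fix x assume x: "x \<in> {x. deriv \<phi> x \<noteq> 0}" "x \<notin> closure {x. \<phi> x \<noteq> 0}"
    have "((\<lambda>_. 0) has_real_derivative 0) (at x)" by simp
    then have "(\<phi> has_real_derivative 0) (at x)"
      by (rule has_field_derivative_transform_within_open[of _ _ _ "- closure {x. \<phi> x \<noteq> 0}"])
        (use x closure_subset[of "{x. \<phi> x \<noteq> 0}"] in auto)
    then show False using x DERIV_imp_deriv by blast
  qed
  then have "closure {x. deriv \<phi> x \<noteq> 0} \<subseteq> closure {x. \<phi> x \<noteq> 0}"
    by (simp add: closure_minimal)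
  moreover from this have "compact (closure {x. deriv \<phi> x \<noteq> 0})"
    using c(1) by (metis bounded_subset closed_closure compact_eq_bounded_closed)
  ultimately show ?thesis
    using c smooth_deriv[OF s] by (auto simp: test_functions_iff)
qed

lemma test_function_UNIV: "\<phi> \<in> test_functions \<Omega> \<Longrightarrow> \<phi> \<in> test_functions UNIV"
  using test_functions_mono by blast

lemma test_function_continuous:
  "\<phi> \<in> test_functions \<Omega> \<Longrightarrow> continuous_on A (\<lambda>x. complex_of_real (\<phi> x))"
  by (intro continuous_on_of_real smooth_continuous_on) (simp add: test_functions_iff)

lemma test_function_DERIV:
  "\<phi> \<in> test_functions \<Omega> \<Longrightarrow> (\<phi> has_real_derivative deriv \<phi> x) (at x)"
  by (auto simp: test_functions_iff intro: smooth_DERIV)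

lemma test_function_boundE:
  assumes "\<phi> \<in> test_functions \<Omega>"
  obtains N where "N > 0" "\<And>x. x \<notin> {-N..N} \<Longrightarrow> \<phi> x = 0" "\<And>x. x \<notin> {-N..N} \<Longrightarrow> deriv \<phi> x = 0"
proof -
  have "\<phi> \<in> test_functions UNIV" "deriv \<phi> \<in> test_functions UNIV"
    using assms test_function_UNIV test_function_deriv by blast+
  note * = this
  obtain a b where ab: "\<And>x. x \<notin> {a..b} \<Longrightarrow> \<phi> x = 0"
    by (rule test_function_supportE[OF *(1) is_interval_univ UNIV_not_empty]) blast
  obtain c d where cd: "\<And>x. x \<notin> {c..d} \<Longrightarrow> deriv \<phi> x = 0"
    by (rule test_function_supportE[OF *(2) is_interval_univ UNIV_not_empty]) blast
  define N where "N = Max {1, - a, b, - c, d}"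
  have N: "1 \<le> N" "- a \<le> N" "b \<le> N" "- c \<le> N" "d \<le> N"
    unfolding N_def by (rule Max_ge; simp)+
  have "\<phi> x = 0 \<and> deriv \<phi> x = 0" if "x \<notin> {- N..N}" for x
  proof -
    have "x \<notin> {a..b}" "x \<notin> {c..d}" using that N by auto
    then show ?thesis using ab cd by blast
  qed
  then show ?thesis using that[of N] N(1) by force
qed

lemma integrable_mult_test_function:
  assumes "locally_integrable w" "\<phi> \<in> test_functions \<Omega>"
  shows "integrable lborel (\<lambda>x. w x * of_real (\<phi> x))"
proof -
  obtain N where "\<And>x. x \<notin> {-N..N} \<Longrightarrow> \<phi> x = 0"
    using assms(2) test_function_boundE by blast
  then show ?thesis
    using assms test_function_continuous by (intro locally_integrable_mult_compact_support[of _ _ "-N" N]) auto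
qed

lemma AE_zero_of_interval_integrals:
  fixes f :: "real \<Rightarrow> complex"
  assumes f: "integrable lborel f" and supp: "\<And>x. x \<notin> {p..q} \<Longrightarrow> f x = 0"
    and I: "\<And>c d. p \<le> c \<Longrightarrow> c \<le> d \<Longrightarrow> d \<le> q \<Longrightarrow> (LINT x:{c..d}|lborel. f x) = 0"
  shows "AE x in lborel. f x = 0"
proof (rule sigma_finite_measure.density_zero[OF lborel.sigma_finite_measure_axioms f])
  have si: "set_integrable lborel A f" if "A \<in> sets borel" for A
    using integrable_mult_indicator[OF _ f, of A] that by (simp add: set_integrable_def)
  have I': "(LINT x:{a..b}|lborel. f x) = 0" for a b
  proof -
    have "(LINT x:{a..b}|lborel. f x) = (LINT x:{max a p..min b q}|lborel. f x)"
      unfolding set_lebesgue_integral_def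
    proof (rule Bochner_Integration.integral_cong)
      show "indicat_real {a..b} x *\<^sub>R f x = indicat_real {max a p..min b q} x *\<^sub>R f x" for x
        using supp[of x] by (cases "x \<in> {p..q}") (simp_all add: indicator_def)
    qed simp
    then show ?thesis
      using I[of "max a p" "min b q"] by (cases "max a p \<le> min b q") (simp_all add: set_lebesgue_integral_def)
  qed
  have tot: "(LINT x:UNIV|lborel. f x) = 0"
  proof -
    have "(LINT x:UNIV|lborel. f x) = (LINT x:{p..q}|lborel. f x)"
      unfolding set_lebesgue_integral_def
    proof (rule Bochner_Integration.integral_cong)
      show "indicat_real UNIV x *\<^sub>R f x = indicat_real {p..q} x *\<^sub>R f x" for x
        using supp[of x] by (cases "x \<in> {p..q}") (simp_all add: indicator_def)
    qed simp
    then show ?thesis using I' by simp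
  qed
  fix A :: "real set" assume "A \<in> sets lborel"
  then have "A \<in> sets borel" by simp
  then show "set_lebesgue_integral lborel A f = 0"
  proof (induction rule: borel_set_induct)
    case (compl A)
    have "(LINT x:A \<union> -A|lborel. f x) = (LINT x:A|lborel. f x) + (LINT x:-A|lborel. f x)"
      using compl by (intro set_integral_Un si) auto
    then show ?case using compl tot by (simp add: Un_commute)
  next
    case (union F)
    have "(LINT x:(\<Union>i. F i)|lborel. f x) = (\<Sum>i. (LINT x:F i|lborel. f x))"
      using union by (intro lebesgue_integral_countable_add si) (auto simp: disjoint_family_on_def)
    then show ?case using union by simp
  qed (auto simp: I' set_lebesgue_integral_def[of _ "{}"])
qed

text \<open>
  If \<open>\<beta>\<close> is a bump on the interval, then the test functions \<open>1 - exp (- n \<beta>)\<close> take values in \<open>[0, 1]\<close>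
  and increase to the indicator function of its interior, so dominated convergence applies.
\<close>

lemma integral_zero_of_test_functions:
  assumes w: "locally_integrable w" and cd: "c < d" "{c..d} \<subseteq> \<Omega>"
    and z: "\<And>\<phi>. \<phi> \<in> test_functions \<Omega> \<Longrightarrow> pairing w \<phi> = 0"
  shows "(LINT x:{c..d}|lborel. w x) = 0"
proof -
  define \<phi> where "\<phi> n x = 1 - exp (- real n * bump c d x)" for n x
  have \<phi>_smooth: "smooth (\<phi> n)" for n
    using smooth_add[OF smooth_const[of 1] smooth_mult[OF smooth_const[of "-1"]
        smooth_exp[OF smooth_mult[OF smooth_const[of "- real n"] smooth_bump[of c d]]]]]
    by (simp add: \<phi>_def[abs_def])
  have \<phi>_out: "\<phi> n x = 0" if "x \<notin> {c<..<d}" for n x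
    using that bump_pos_iff[of c d x] bump_nonneg[of c d x] by (auto simp: \<phi>_def)
  have \<phi>_test: "\<phi> n \<in> test_functions \<Omega>" for n
    by (rule test_functionsI[OF \<phi>_smooth cd(2)]) (auto intro: \<phi>_out)
  have \<phi>_bound: "\<bar>\<phi> n x\<bar> \<le> indicator {c..d} x" for n x
    using \<phi>_out[of x n] bump_nonneg[of c d x] by (auto simp: \<phi>_def indicator_def)
  have int: "integrable lborel (\<lambda>x. indicator {c..d} x *\<^sub>R w x)"
    using w by (simp add: locally_integrable_def set_integrable_def)
  have lim: "(\<lambda>n. \<phi> n x) \<longlonglongrightarrow> indicator {c<..<d} x" for x
  proof (cases "x \<in> {c<..<d}")
    case True
    then have "bump c d x > 0" by (simp add: bump_pos_iff)
    then have "(\<lambda>n. 1 - exp (- (real n * bump c d x))) \<longlonglongrightarrow> 1 - 0"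
      by (intro tendsto_diff tendsto_const filterlim_compose[OF exp_at_bot]
          filterlim_compose[OF filterlim_uminus_at_bot_at_top]
          filterlim_at_top_mult_tendsto_pos[OF tendsto_const _ filterlim_real_sequentially, of "bump c d x", unfolded mult.commute[of "bump c d x"]])
    then show ?thesis using True by (simp add: \<phi>_def)
  qed (simp add: \<phi>_out)
  have ae: "AE x in lborel. indicator {c..d} x = (indicator {c<..<d} x :: real)"
  proof -
    have "AE x in lborel. x \<notin> {c, d}"
      by (intro AE_not_in finite_imp_null_set_lborel) simp
    then show ?thesis by eventually_elim (auto simp: indicator_def)
  qed
  have "(\<lambda>n. LINT x|lborel. w x * of_real (\<phi> n x)) \<longlonglongrightarrow> (LINT x|lborel. indicator {c..d} x *\<^sub>R w x)"
  proof (rule integral_dominated_convergence[where w = "\<lambda>x. norm (indicator {c..d} x *\<^sub>R w x)"])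
    show "AE x in lborel. (\<lambda>n. w x * complex_of_real (\<phi> n x)) \<longlonglongrightarrow> indicat_real {c..d} x *\<^sub>R w x"
      using ae
    proof eventually_elim
      case (elim x)
      have "(\<lambda>n. w x * complex_of_real (\<phi> n x)) \<longlonglongrightarrow> w x * of_real (indicator {c<..<d} x)"
        by (intro tendsto_intros lim)
      then show ?case using elim by (simp add: scaleR_conv_of_real mult.commute)
    qed
    show "AE x in lborel. norm (w x * complex_of_real (\<phi> n x)) \<le> norm (indicator {c..d} x *\<^sub>R w x)" for n
    proof (intro AE_I2)
      fix x
      show "norm (w x * complex_of_real (\<phi> n x)) \<le> norm (indicator {c..d} x *\<^sub>R w x)"
        using mult_left_mono[OF \<phi>_bound[of n x], of "cmod (w x)"] by (simp add: norm_mult mult.commute)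
    qed
    show "(\<lambda>x. w x * complex_of_real (\<phi> n x)) \<in> borel_measurable lborel" for n
      using integrable_mult_test_function[OF w \<phi>_test] borel_measurable_integrable by blast
    show "integrable lborel (\<lambda>x. norm (indicator {c..d} x *\<^sub>R w x))"
      by (rule integrable_norm[OF int])
  qed (use int in auto)
  moreover have "(LINT x|lborel. w x * of_real (\<phi> n x)) = 0" for n
    using z \<phi>_test by blast
  ultimately show ?thesis
    by (simp add: set_lebesgue_integral_def LIMSEQ_const_iff)
qed

text \<open>
  All integrals over compact subintervals of \<open>\<Omega>\<close> vanish, hence so does the function almost everywhere
  on each of them. Countably many, those with rational endpoints, cover \<open>\<Omega>\<close>.
\<close>

lemma fundamental_lemma:
  assumes w: "locally_integrable w" and "open \<Omega>"
    and z: "\<And>\<phi>. \<phi> \<in> test_functions \<Omega> \<Longrightarrow> pairing w \<phi> = 0"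
  shows "AE x in lborel. x \<in> \<Omega> \<longrightarrow> w x = 0"
proof -
  have 1: "AE x in lborel. x \<in> {p..q} \<longrightarrow> w x = 0" if "{p..q} \<subseteq> \<Omega>" for p q
  proof -
    have "AE x in lborel. indicator {p..q} x *\<^sub>R w x = 0"
    proof (rule AE_zero_of_interval_integrals[of _ p q])
      show "integrable lborel (\<lambda>x. indicat_real {p..q} x *\<^sub>R w x)"
        using w by (simp add: locally_integrable_def set_integrable_def)
      fix c d assume cd: "p \<le> c" "c \<le> d" "d \<le> q"
      have "(LINT x:{c..d}|lborel. indicat_real {p..q} x *\<^sub>R w x) = (LINT x:{c..d}|lborel. w x)"
        unfolding set_lebesgue_integral_def using cd
        by (intro Bochner_Integration.integral_cong) (auto simp: indicator_def)
      also have "\<dots> = 0"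
      proof (cases "c < d")
        case True
        then show ?thesis
          by (intro integral_zero_of_test_functions[OF w True _ z]) (use cd that in auto)
      next
        case False
        then have "c = d" using cd by simp
        have "AE x in lborel. indicat_real {c..d} x *\<^sub>R w x = 0"
          using AE_lborel_singleton[of d] by eventually_elim (use \<open>c = d\<close> in \<open>auto simp: indicator_def\<close>)
        then show ?thesis
          unfolding set_lebesgue_integral_def by (rule integral_eq_zero_AE)
      qed
      finally show "(LINT x:{c..d}|lborel. indicat_real {p..q} x *\<^sub>R w x) = 0" .
    qed auto
    then show ?thesis by eventually_elim (auto simp: indicator_def)
  qed
  let ?R = "{(p, q) \<in> \<rat> \<times> \<rat>. {p..q} \<subseteq> \<Omega>}"
  have "countable ?R"
    by (rule countable_subset[of _ "\<rat> \<times> \<rat>"]) (auto intro: countable_rat)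
  then have "AE x in lborel. \<forall>(p, q)\<in>?R. x \<in> {p..q} \<longrightarrow> w x = 0"
    using 1 by (subst AE_ball_countable) auto
  then show ?thesis
  proof eventually_elim
    case (elim x)
    show ?case
    proof
      assume "x \<in> \<Omega>"
      then obtain e where e: "e > 0" "ball x e \<subseteq> \<Omega>"
        using \<open>open \<Omega>\<close> openE by blast
      obtain p q where "p \<in> \<rat>" "x - e < p" "p < x" "q \<in> \<rat>" "x < q" "q < x + e"
        using Rats_dense_in_real[of "x - e" x] Rats_dense_in_real[of x "x + e"] e by auto
      moreover from this have "{p..q} \<subseteq> \<Omega>"
        using e by (auto simp: ball_def dist_real_def subset_eq)
      ultimately show "w x = 0" using elim by auto
    qed
  qed
qed

text \<open>
  Fix a test function \<open>\<theta>\<close> of integral one. For every test function \<open>\<psi>\<close> the function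
  \<open>\<psi> - (\<integral>\<psi>) \<theta>\<close> has integral zero and therefore is the derivative of a test function supported in the
  interval \<open>\<Omega>\<close>. Consequently \<open>w - C\<close> with \<open>C = \<integral>w\<theta>\<close> annihilates all test functions.
\<close>

lemma du_Bois_Reymond:
  assumes w: "locally_integrable w" and \<Omega>: "open \<Omega>" "is_interval \<Omega>"
    and z: "\<And>\<phi>. \<phi> \<in> test_functions \<Omega> \<Longrightarrow> pairing w (deriv \<phi>) = 0"
  shows "\<exists>C. AE x in lborel. x \<in> \<Omega> \<longrightarrow> w x = C"
proof (cases "\<Omega> = {}")
  case False
  then obtain a e where "e > 0" "cball a e \<subseteq> \<Omega>"
    using \<Omega>(1) by (meson all_not_in_conv open_contains_cball)
  then have ae: "e > 0" "{a - e..a + e} \<subseteq> \<Omega>"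
    by (auto simp: cball_eq_atLeastAtMost)
  define \<theta>0 where "\<theta>0 = bump (a - e) (a + e)"
  have \<theta>0: "\<theta>0 \<in> test_functions \<Omega>"
    unfolding \<theta>0_def
    by (rule test_functionsI[OF smooth_bump ae(2)]) (use bump_pos_iff[of "a-e" "a+e"] bump_nonneg[of "a-e" "a+e"] in \<open>force simp: order_less_le\<close>)
  have int_test: "integrable lborel \<psi>" if "\<psi> \<in> test_functions \<Omega>" for \<psi>
  proof -
    have "integrable lborel (\<lambda>x. 1 * complex_of_real (\<psi> x))"
      by (rule integrable_mult_test_function[OF _ that]) (auto intro: locally_integrable_continuous)
    from integrable_Re[OF this] show ?thesis by simp
  qed
  have m0: "(LINT x|lborel. \<theta>0 x) \<noteq> 0"
  proof
    assume "(LINT x|lborel. \<theta>0 x) = 0"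
    then have "AE x in lborel. \<theta>0 x = 0"
      using int_test[OF \<theta>0] bump_nonneg by (subst (asm) integral_nonneg_eq_0_iff_AE) (auto simp: \<theta>0_def)
    moreover have "\<theta>0 x \<noteq> 0" if "x \<in> {a - e<..<a + e}" for x
      using bump_pos_iff[of "a-e" "a+e" x] that by (auto simp: \<theta>0_def)
    ultimately have "AE x in lborel. x \<notin> {a - e<..<a + e}"
      by (auto elim: AE_mp)
    then have "emeasure lborel {a - e<..<a + e} = 0"
      by (subst (asm) AE_iff_measurable[of "{a - e<..<a + e}"]) auto
    then show False using ae by simp
  qed
  define \<theta> where "\<theta> x = \<theta>0 x / (LINT x|lborel. \<theta>0 x)" for x
  have \<theta>_smooth: "smooth \<theta>"
    using smooth_mult[OF smooth_const[of "1 / (LINT x|lborel. \<theta>0 x)"] smooth_bump]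
    by (simp add: \<theta>_def[abs_def] \<theta>0_def)
  have \<theta>_out: "\<theta> x = 0" if "x \<notin> {a - e..a + e}" for x
    using that bump_pos_iff[of "a-e" "a+e" x] bump_nonneg[of "a-e" "a+e" x]
    by (auto simp: \<theta>_def \<theta>0_def order_less_le)
  have \<theta>: "\<theta> \<in> test_functions \<Omega>"
    by (rule test_functionsI[OF \<theta>_smooth ae(2) \<theta>_out])
  have \<theta>1: "(LINT x|lborel. \<theta> x) = 1"
    using m0 by (simp add: \<theta>_def)
  define C where "C = pairing w \<theta>"
  have "AE x in lborel. x \<in> \<Omega> \<longrightarrow> w x - C = 0"
  proof (rule fundamental_lemma[OF _ \<Omega>(1)])
    show lC: "locally_integrable (\<lambda>x. w x - C)"
      by (intro locally_integrable_diff w locally_integrable_continuous continuous_intros)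
    fix \<psi> assume \<psi>: "\<psi> \<in> test_functions \<Omega>"
    obtain c0 d0 where s0: "c0 \<le> d0" "{c0..d0} \<subseteq> \<Omega>" "\<And>x. x \<notin> {c0..d0} \<Longrightarrow> \<psi> x = 0"
      using test_function_supportE[OF \<psi> \<Omega>(2) False] by blast
    \<comment> \<open>\<open>{c..d}\<close> contains the supports of both \<open>\<psi>\<close> and \<open>\<theta>\<close>.\<close>
    define c d where "c = min c0 (a - e)" and "d = max d0 (a + e)"
    have cd: "c \<le> d" "{c..d} \<subseteq> \<Omega>"
    proof -
      show "c \<le> d" using s0(1) ae by (auto simp: c_def d_def)
      have "c \<in> \<Omega>" "d \<in> \<Omega>"
        using s0(1,2) ae by (auto simp: c_def d_def min_def max_def)
      then show "{c..d} \<subseteq> \<Omega>"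
        using mem_is_interval_1_I[OF \<Omega>(2)] by (meson atLeastAtMost_iff subsetI)
    qed
    define m where "m = (LINT x|lborel. \<psi> x)"
    define \<eta> where "\<eta> x = \<psi> x - m * \<theta> x" for x
    have \<psi>_smooth: "smooth \<psi>" using \<psi> by (simp add: test_functions_iff)
    have \<eta>_smooth: "smooth \<eta>"
      using smooth_add[OF \<psi>_smooth smooth_mult[OF smooth_const[of "-m"] \<theta>_smooth]]
      by (simp add: \<eta>_def[abs_def])
    have \<eta>_out: "\<eta> x = 0" if "x \<notin> {c..d}" for x
    proof -
      have "x \<notin> {c0..d0}" "x \<notin> {a - e..a + e}" using that by (auto simp: c_def d_def)
      then show ?thesis using s0(3)[of x] \<theta>_out[of x] by (simp add: \<eta>_def)
    qed
    have \<eta>_c: "\<eta> x = 0" if "x < c" for x using that \<eta>_out[of x] by simp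
    have \<eta>_cont: "isCont \<eta> x" for x
      using smooth_DERIV[OF \<eta>_smooth] DERIV_isCont by blast
    obtain F where F: "\<And>x. (F has_vector_derivative \<eta> x) (at x)"
      using einterval_antiderivative[of "-\<infinity>" "\<infinity>" \<eta>] \<eta>_cont by auto
    define \<phi> where "\<phi> x = F x - F c" for x
    have D: "(\<phi> has_real_derivative \<eta> x) (at x)" for x
      unfolding \<phi>_def using F[of x]
      by (auto intro!: derivative_eq_intros simp: has_real_derivative_iff_has_vector_derivative)
    have int: "(\<eta> has_integral \<phi> y - \<phi> x) {x..y}" if "x \<le> y" for x y
      using that D by (intro fundamental_theorem_of_calculus)
        (auto simp: has_real_derivative_iff_has_vector_derivative intro: has_vector_derivative_at_within)
    have \<eta>_int: "(\<eta> has_integral 0) UNIV"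
    proof -
      have "integrable lborel \<eta>"
        unfolding \<eta>_def using int_test \<psi> \<theta> by (intro Bochner_Integration.integrable_diff integrable_mult_right) auto
      moreover have "(LINT x|lborel. \<eta> x) = 0"
        unfolding \<eta>_def using int_test \<psi> \<theta> by (simp add: \<theta>1 m_def)
      ultimately show ?thesis
        using has_integral_integral_lborel by metis
    qed
    have \<phi>_out: "\<phi> x = 0" if "x \<notin> {c..d}" for x
    proof (cases "x < c")
      case True
      have "(\<eta> has_integral \<phi> c - \<phi> x) {x..c}" using int True by simp
      moreover have "(\<eta> has_integral 0) {x..c}"
        by (rule has_integral_spike[of "{c}" _ _ "\<lambda>_. 0"]) (auto intro: \<eta>_c)
      ultimately have "\<phi> c - \<phi> x = 0" by (rule has_integral_unique)
      then show ?thesis by (simp add: \<phi>_def)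
    next
      case False
      then have "x > d" using that by auto
      have "(\<eta> has_integral \<phi> x - \<phi> c) {c..x}" using int cd \<open>x > d\<close> by simp
      moreover have "(\<eta> has_integral 0) {c..x}"
      proof -
        have "((\<lambda>t. if t \<in> {c..x} then \<eta> t else 0) has_integral 0) UNIV"
        proof (rule has_integral_eq[OF _ \<eta>_int])
          show "\<eta> t = (if t \<in> {c..x} then \<eta> t else 0)" for t
            using \<eta>_out[of t] \<open>x > d\<close> by (cases "t \<in> {c..d}") auto
        qed
        then show ?thesis by (simp only: has_integral_restrict_UNIV)
      qed
      ultimately have "\<phi> x - \<phi> c = 0" by (rule has_integral_unique)
      then show ?thesis by (simp add: \<phi>_def)
    qed
    have \<phi>: "\<phi> \<in> test_functions \<Omega>"
      by (rule test_functionsI[OF smooth_antideriv[OF \<eta>_smooth D] cd(2) \<phi>_out])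
    have "deriv \<phi> = \<eta>" using D DERIV_imp_deriv by blast
    then have 0: "pairing w \<eta> = 0" using z[OF \<phi>] by simp
    have "pairing w \<eta> =
        (LINT x|lborel. w x * of_real (\<psi> x) - of_real m * (w x * of_real (\<theta> x)))"
      by (simp add: \<eta>_def algebra_simps)
    also have "\<dots> = pairing w \<psi> - of_real m * C"
      unfolding C_def using integrable_mult_test_function[OF w] \<psi> \<theta> by simp
    also have "of_real m * C = pairing (\<lambda>x. C) \<psi>"
      unfolding m_def by simp
    also have "pairing w \<psi> - \<dots> = (LINT x|lborel. w x * of_real (\<psi> x) - C * of_real (\<psi> x))"
      using integrable_mult_test_function[OF w \<psi>] int_test[OF \<psi>] by simp
    finally show "pairing (\<lambda>x. w x - C) \<psi> = 0"
      using 0 by (simp add: algebra_simps)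
  qed
  then show ?thesis by auto
qed simp

section \<open>Primitives of locally integrable functions\<close>

text \<open>
  As \<open>v\<close> is merely locally integrable, being a primitive is expressed by integrals and not by
  derivatives.
\<close>

definition primitive_on :: "real set \<Rightarrow> (real \<Rightarrow> complex) \<Rightarrow> (real \<Rightarrow> complex) \<Rightarrow> bool" where
  "primitive_on \<Omega> P v \<longleftrightarrow>
     (\<forall>a b. a \<le> b \<longrightarrow> {a..b} \<subseteq> \<Omega> \<longrightarrow> P b - P a = (LINT y:{a..b}|lborel. v y))"

lemma primitive_exists:
  assumes "locally_integrable v"
  shows "\<exists>P. primitive_on UNIV P v"
proof (intro exI[of _ "\<lambda>x. LBINT y=ereal 0..ereal x. v y"], unfold primitive_on_def, intro allI impI)
  fix a b :: real assume "a \<le> b"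
  have ii: "interval_lebesgue_integrable lborel (ereal l) (ereal r) v" if "l \<le> r" for l r
  proof -
    have "set_integrable lborel {l..r} v"
      using assms by (auto simp: locally_integrable_def)
    then have "set_integrable lborel (einterval (ereal l) (ereal r)) v"
      by (rule set_integrable_subset) (auto simp: einterval_def)
    then show ?thesis using that by (simp add: interval_lebesgue_integrable_def)
  qed
  have "(LBINT y=ereal 0..ereal a. v y) + (LBINT y=ereal a..ereal b. v y) = (LBINT y=ereal 0..ereal b. v y)"
    using ii[of "min 0 (min a b)" "max 0 (max a b)"] by (intro interval_integral_sum) simp
  then show "(LBINT y=ereal 0..ereal b. v y) - (LBINT y=ereal 0..ereal a. v y) = (LINT y:{a..b}|lborel. v y)"
    using interval_integral_Icc[OF \<open>a \<le> b\<close>, of v] by (simp add: algebra_simps)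
qed

lemma primitive_on_integral:
  assumes "locally_integrable v" "primitive_on \<Omega> P v" "a \<le> b" "{a..b} \<subseteq> \<Omega>"
  shows "P b = P a + integral {a..b} v" "v integrable_on {a..b}"
proof -
  have "set_integrable lborel {a..b} v" using assms by (auto simp: locally_integrable_def)
  from set_borel_integral_eq_integral[OF this]
  show "P b = P a + integral {a..b} v" "v integrable_on {a..b}"
    using assms by (auto simp: primitive_on_def algebra_simps)
qed

lemma primitive_continuous:
  assumes "locally_integrable v" "primitive_on UNIV P v"
  shows "continuous_on UNIV P"
proof -
  have "isCont P x" for x
  proof -
    have "continuous_on {x - 1..x + 1} (\<lambda>t. P (x - 1) + integral {x - 1..t} v)"
      by (intro continuous_intros indefinite_integral_continuous_1 primitive_on_integral[OF assms]) auto
    then have "continuous_on {x - 1..x + 1} P"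
    proof (rule continuous_on_eq)
      show "P (x - 1) + integral {x - 1..t} v = P t" if "t \<in> {x - 1..x + 1}" for t
        using primitive_on_integral(1)[OF assms, of "x - 1" t] that by simp
    qed
    then show ?thesis
      by (rule continuous_on_interior) (simp add: interior_atLeastAtMost_real)
  qed
  then show ?thesis by (simp add: continuous_at_imp_continuous_on)
qed

lemma primitive_has_vector_derivative:
  assumes v: "locally_integrable v" and P: "primitive_on UNIV P v"
    and \<Omega>: "open \<Omega>" "x \<in> \<Omega>" and V: "continuous_on \<Omega> V" "AE y in lborel. y \<in> \<Omega> \<longrightarrow> v y = V y"
  shows "(P has_vector_derivative V x) (at x)"
proof -
  obtain e where "e > 0" "cball x e \<subseteq> \<Omega>" using \<Omega> open_contains_cball by blast
  then have e: "e > 0" "{x - e..x + e} \<subseteq> \<Omega>" by (auto simp: cball_eq_atLeastAtMost)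
  have eq: "P t = P (x - e) + integral {x - e..t} V" if t: "t \<in> {x - e..x + e}" for t
  proof -
    have i: "set_integrable lborel {x - e..t} V"
      by (rule borel_integrable_atLeastAtMost', rule continuous_on_subset[OF V(1)]) (use e t in force)
    have iv: "set_integrable lborel {x - e..t} v" using v by (simp add: locally_integrable_def)
    have "P t - P (x - e) = (LINT y:{x - e..t}|lborel. v y)"
      using P t by (simp add: primitive_on_def)
    also have "\<dots> = (LINT y:{x - e..t}|lborel. V y)"
      unfolding set_lebesgue_integral_def
    proof (rule integral_cong_AE)
      show "(\<lambda>y. indicat_real {x - e..t} y *\<^sub>R v y) \<in> borel_measurable lborel"
        using iv unfolding set_integrable_def by (rule borel_measurable_integrable)
      show "(\<lambda>y. indicat_real {x - e..t} y *\<^sub>R V y) \<in> borel_measurable lborel"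
        using i unfolding set_integrable_def by (rule borel_measurable_integrable)
      show "AE y in lborel. indicat_real {x - e..t} y *\<^sub>R v y = indicat_real {x - e..t} y *\<^sub>R V y"
        using V(2)
      proof eventually_elim
        case (elim y)
        moreover have "y \<in> \<Omega>" if "y \<in> {x - e..t}"
          by (rule subsetD[OF e(2)]) (use that t in simp)
        ultimately show ?case by (cases "y \<in> {x - e..t}") simp_all
      qed
    qed
    also have "\<dots> = integral {x - e..t} V"
      using set_borel_integral_eq_integral(2)[OF i] .
    finally show ?thesis by (simp add: algebra_simps)
  qed
  have "((\<lambda>t. integral {x - e..t} V) has_vector_derivative V x) (at x within {x - e..x + e})"
    by (rule integral_has_vector_derivative[OF continuous_on_subset[OF V(1) e(2)]]) (use e in auto)
  then have "((\<lambda>t. P (x - e) + integral {x - e..t} V) has_vector_derivative V x) (at x within {x - e..x + e})"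
    by (auto intro!: derivative_eq_intros)
  then have "(P has_vector_derivative V x) (at x within {x - e..x + e})"
  proof (rule has_vector_derivative_transform[rotated 2])
    show "x \<in> {x - e..x + e}" using e(1) by simp
  qed (rule eq)
  moreover have "at x within {x - e..x + e} = at x"
    by (rule at_within_interior) (use e in \<open>simp add: interior_atLeastAtMost_real\<close>)
  ultimately show ?thesis by simp
qed

lemma test_function_integral_deriv:
  assumes "\<phi> \<in> test_functions \<Omega>" and "\<phi> N = 0" and "y \<le> N"
  shows "(LINT x:{y..N}|lborel. complex_of_real (deriv \<phi> x)) = - complex_of_real (\<phi> y)"
proof -
  have "(LINT x:{y..N}|lborel. complex_of_real (deriv \<phi> x)) = of_real (\<phi> N) - of_real (\<phi> y)"
    unfolding set_lebesgue_integral_def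
  proof (rule integral_FTC_atLeastAtMost[OF \<open>y \<le> N\<close>])
    show "continuous_on {y..N} (\<lambda>x. complex_of_real (deriv \<phi> x))"
      using test_function_continuous[OF test_function_deriv[OF assms(1)]] .
    show "((\<lambda>x. complex_of_real (\<phi> x)) has_vector_derivative complex_of_real (deriv \<phi> x)) (at x within {y..N})" for x
      using test_function_DERIV[OF assms(1), of x]
      by (auto intro!: has_vector_derivative_of_real simp: has_real_derivative_iff_has_vector_derivative has_vector_derivative_at_within)
  qed
  then show ?thesis using \<open>\<phi> N = 0\<close> by simp
qed

text \<open>
  Write \<open>P x\<close> as \<open>P (-N)\<close> plus the integral of \<open>v\<close> over \<open>[-N, x]\<close>, with \<open>-N\<close> to the left of the support
  of \<open>\<phi>\<close>, and exchange the order of integration over the triangle \<open>y \<le> x\<close>. The inner integral of \<open>\<phi>'\<close>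
  over \<open>[y, N]\<close> is \<open>- \<phi> y\<close>.
\<close>

lemma integral_primitive_deriv_test_function:
  assumes v: "locally_integrable v" and P: "primitive_on UNIV P v" and \<phi>: "\<phi> \<in> test_functions \<Omega>"
  shows "pairing P (deriv \<phi>) = - pairing v \<phi>"
proof -
  obtain N0 where N0: "N0 > 0" "\<And>x. x \<notin> {-N0..N0} \<Longrightarrow> \<phi> x = 0" "\<And>x. x \<notin> {-N0..N0} \<Longrightarrow> deriv \<phi> x = 0"
    using test_function_boundE[OF \<phi>] by blast
  define N where "N = N0 + 1"
  have sub: "x \<notin> {-N0..N0}" if "x \<notin> {-N..N} \<or> \<bar>x\<bar> = N" for x
    using that N0(1) by (auto simp: N_def)
  have N: "N > 0" "\<And>x. x \<notin> {-N..N} \<Longrightarrow> \<phi> x = 0" "\<And>x. x \<notin> {-N..N} \<Longrightarrow> deriv \<phi> x = 0"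
    "\<phi> N = 0" "\<phi> (- N) = 0"
    using N0(1) N0(2,3)[OF sub] by (simp_all add: N_def)
  let ?v = "\<lambda>y. indicator {-N..N} y *\<^sub>R v y" and ?d = "\<lambda>x. complex_of_real (deriv \<phi> x)"
  let ?K = "\<lambda>y x. indicator {y..} x *\<^sub>R (?v y * ?d x)"
  have iv: "integrable lborel ?v" using v by (simp add: locally_integrable_def set_integrable_def)
  have [measurable]: "?v \<in> borel_measurable borel" using borel_measurable_integrable[OF iv] by simp
  have id: "integrable lborel ?d"
    using integrable_mult_test_function[OF locally_integrable_continuous test_function_deriv[OF \<phi>], of "\<lambda>_. 1"]
    by (simp add: continuous_on_const)
  have [measurable]: "?d \<in> borel_measurable borel" using borel_measurable_integrable[OF id] by simp
  have ind: "(\<lambda>(y::real, x). indicat_real {y..} x) \<in> borel_measurable (borel \<Otimes>\<^sub>M borel)"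
  proof -
    have eq: "(\<lambda>(y::real, x). indicat_real {y..} x) = (\<lambda>p. if fst p \<le> snd p then 1 else 0)"
      by (auto simp: indicator_def)
    show ?thesis unfolding eq by measurable
  qed
  have prod: "integrable (lborel \<Otimes>\<^sub>M lborel) (\<lambda>(y, x). ?v y * ?d x)"
  proof (rule lborel_pair.Fubini_integrable)
    show "(\<lambda>(y, x). ?v y * ?d x) \<in> borel_measurable (lborel \<Otimes>\<^sub>M lborel)" by measurable
    show "integrable lborel (\<lambda>y. LINT x|lborel. norm (case (y, x) of (y, x) \<Rightarrow> ?v y * ?d x))"
      using integrable_mult_left[of "LINT x|lborel. norm (?d x)", OF integrable_norm[OF iv]]
      by (simp add: norm_mult mult.assoc)
    show "AE y in lborel. integrable lborel (\<lambda>x. case (y, x) of (y, x) \<Rightarrow> ?v y * ?d x)"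
      using id by simp
  qed
  have int: "integrable (lborel \<Otimes>\<^sub>M lborel) (\<lambda>(y, x). ?K y x)"
  proof (rule Bochner_Integration.integrable_bound[OF prod])
    show "(\<lambda>(y, x). ?K y x) \<in> borel_measurable (lborel \<Otimes>\<^sub>M lborel)"
    proof -
      have "(\<lambda>(y::real, x). indicat_real {y..} x) \<in> borel_measurable (lborel \<Otimes>\<^sub>M lborel)"
        using ind by (simp cong: measurable_cong_sets)
      from borel_measurable_scaleR[OF this borel_measurable_integrable[OF prod]]
      show ?thesis by (simp add: split_beta)
    qed
  qed (auto simp: indicator_def)
  have "(LINT y|lborel. LINT x|lborel. ?K y x) = (LINT x|lborel. LINT y|lborel. ?K y x)"
    using lborel_pair.Fubini_integral[OF int] by simp
  moreover have "(LINT x|lborel. ?K y x) = - (v y * of_real (\<phi> y))" for y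
  proof (cases "y \<in> {-N..N}")
    case True
    have "(LINT x|lborel. ?K y x) = (LINT x|lborel. v y * (indicator {y..N} x *\<^sub>R ?d x))"
      using True N(3) by (intro Bochner_Integration.integral_cong) (auto simp: indicator_def)
    also have "\<dots> = v y * (LINT x:{y..N}|lborel. ?d x)"
      unfolding set_lebesgue_integral_def by (rule integral_mult_right_zero)
    also have "(LINT x:{y..N}|lborel. ?d x) = - of_real (\<phi> y)"
      by (rule test_function_integral_deriv[OF \<phi>]) (use True N(4) in auto)
    finally show ?thesis by simp
  qed (simp add: N(2))
  moreover have "(LINT y|lborel. ?K y x) = P x * ?d x - P (-N) * ?d x" for x
  proof (cases "x \<in> {-N..N}")
    case True
    have "(LINT y|lborel. ?K y x) = (LINT y|lborel. (indicator {-N..x} y *\<^sub>R v y) * ?d x)"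
      using True by (intro Bochner_Integration.integral_cong) (auto simp: indicator_def)
    also have "\<dots> = (LINT y:{-N..x}|lborel. v y) * ?d x"
      unfolding set_lebesgue_integral_def by (rule integral_mult_left_zero)
    also have "(LINT y:{-N..x}|lborel. v y) = P x - P (-N)"
      using P True by (simp add: primitive_on_def)
    finally show ?thesis by (simp add: algebra_simps)
  qed (simp add: N(3))
  moreover have "(LINT x|lborel. P x * ?d x - P (-N) * ?d x) = (LINT x|lborel. P x * ?d x)"
  proof -
    have i: "integrable lborel (\<lambda>x. P x * ?d x)"
      by (rule integrable_mult_test_function[OF locally_integrable_continuous[OF primitive_continuous[OF v P]]
          test_function_deriv[OF \<phi>]])
    have "(LINT x|lborel. ?d x) = (LINT x:{-N..N}|lborel. ?d x)"
      unfolding set_lebesgue_integral_def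
    proof (rule Bochner_Integration.integral_cong)
      show "?d x = indicat_real {-N..N} x *\<^sub>R ?d x" for x
        using N(3)[of x] by (cases "x \<in> {-N..N}") simp_all
    qed simp
    also have "\<dots> = - of_real (\<phi> (-N))"
      by (rule test_function_integral_deriv[OF \<phi>]) (use N(1,4) in auto)
    also have "\<phi> (-N) = 0" by (rule N(5))
    finally have "(LINT x|lborel. ?d x) = 0" by simp
    then show ?thesis using i id by simp
  qed
  ultimately show ?thesis by simp
qed

text \<open>
  The difference of \<open>u\<close> and any primitive of \<open>v\<close> has vanishing weak derivative, hence is constant.
  This regularity result turns weak solutions into classical ones.
\<close>

lemma weak_derivative_primitive:
  assumes u: "locally_integrable u" and v: "locally_integrable v" and \<Omega>: "open \<Omega>" "is_interval \<Omega>"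
    and D: "\<And>\<phi>. \<phi> \<in> test_functions \<Omega> \<Longrightarrow>
      pairing u (deriv \<phi>) = - pairing v \<phi>"
  shows "\<exists>U. primitive_on UNIV U v \<and> (AE x in lborel. x \<in> \<Omega> \<longrightarrow> u x = U x)"
proof -
  obtain P where P: "primitive_on UNIV P v" using primitive_exists[OF v] by blast
  have lP: "locally_integrable P"
    by (rule locally_integrable_continuous[OF primitive_continuous[OF v P]])
  have "\<exists>C. AE x in lborel. x \<in> \<Omega> \<longrightarrow> u x - P x = C"
  proof (rule du_Bois_Reymond[OF locally_integrable_diff[OF u lP] \<Omega>])
    fix \<phi> assume \<phi>: "\<phi> \<in> test_functions \<Omega>"
    have "pairing (\<lambda>x. u x - P x) (deriv \<phi>) =
      pairing u (deriv \<phi>) - pairing P (deriv \<phi>)"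
      using integrable_mult_test_function[OF u test_function_deriv[OF \<phi>]]
        integrable_mult_test_function[OF lP test_function_deriv[OF \<phi>]]
      by (simp add: algebra_simps)
    then show "pairing (\<lambda>x. u x - P x) (deriv \<phi>) = 0"
      using D[OF \<phi>] integral_primitive_deriv_test_function[OF v P \<phi>] by simp
  qed
  then obtain C where C: "AE x in lborel. x \<in> \<Omega> \<longrightarrow> u x - P x = C" by blast
  show ?thesis
  proof (intro exI[of _ "\<lambda>x. P x + C"] conjI)
    show "primitive_on UNIV (\<lambda>x. P x + C) v" using P by (simp add: primitive_on_def)
    show "AE x in lborel. x \<in> \<Omega> \<longrightarrow> u x = P x + C"
      using C by eventually_elim (auto simp: algebra_simps)
  qed
qed

section \<open>Weak derivatives and boundary values of square-integrable classes\<close>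

lemma square_integrable_rep: "square_integrable (rep_l2 u)"
  using Quotient_rep_reflp[OF Quotient_l2, of u] by (simp add: l2_rel_def)

lemma l2_eqI: "AE x in lborel. rep_l2 u x = rep_l2 v x \<Longrightarrow> u = v"
  using Quotient_rel_rep[OF Quotient_l2, of u v] square_integrable_rep by (simp add: l2_rel_def)

lemma rep_abs_l2: "square_integrable f \<Longrightarrow> AE x in lborel. rep_l2 (abs_l2 f) x = f x"
  using Quotient_rep_abs[OF Quotient_l2, of f] by (simp add: l2_rel_def)

lemma rep_plus: "AE x in lborel. rep_l2 (u + v) x = rep_l2 u x + rep_l2 v x"
  unfolding plus_l2_def map_fun_def o_def id_def
  by (rule rep_abs_l2, intro square_integrable_add square_integrable_rep)

lemma rep_uminus: "AE x in lborel. rep_l2 (- u) x = - rep_l2 u x"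
  using rep_abs_l2[OF square_integrable_cmult[OF square_integrable_rep, of "-1" u]]
  unfolding uminus_l2_def map_fun_def o_def id_def by simp

lemma rep_minus: "AE x in lborel. rep_l2 (u - v) x = rep_l2 u x - rep_l2 v x"
  unfolding minus_l2_def using rep_plus[of u "- v"] rep_uminus[of v] by eventually_elim simp

lemma rep_scaleC: "AE x in lborel. rep_l2 (c *\<^sub>C u) x = c * rep_l2 u x"
  unfolding scaleC_l2_def map_fun_def o_def id_def
  by (rule rep_abs_l2, intro square_integrable_cmult square_integrable_rep)

lemma rep_scaleR: "AE x in lborel. rep_l2 (r *\<^sub>R u) x = of_real r * rep_l2 u x"
  unfolding scaleR_l2_def map_fun_def o_def id_def
  by (rule rep_abs_l2, intro square_integrable_cmult square_integrable_rep)

lemma rep_mult_step_potential: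
  "AE x in lborel. rep_l2 (mult_step_potential Vp Vm u) x = step_potential Vp Vm x * rep_l2 u x"
  unfolding mult_step_potential_def map_fun_def o_def id_def
  by (rule rep_abs_l2, intro square_integrable_step_potential square_integrable_rep)

lemma norm_l2_rep: "norm u = l2_norm (rep_l2 u)"
  by (simp add: norm_l2_def)

lemma square_integrable_diff:
  "square_integrable f \<Longrightarrow> square_integrable g \<Longrightarrow> square_integrable (\<lambda>x. f x - g x)"
  using square_integrable_add[of f "\<lambda>x. -1 * g x"] square_integrable_cmult[of g "-1"] by simp

lemma locally_integrable_square_integrable:
  assumes "square_integrable f"
  shows "locally_integrable f"
  unfolding locally_integrable_def set_integrable_def
proof (intro allI)
  fix a b :: real
  have [measurable]: "f \<in> borel_measurable borel" and i: "integrable lborel (\<lambda>x. (cmod (f x))\<^sup>2)"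
    using assms by (auto simp: square_integrable_def)
  have "integrable lborel (\<lambda>x. indicator {a..b} x + (cmod (f x))\<^sup>2)"
    using i by (intro Bochner_Integration.integrable_add integrable_real_indicator)
      (auto simp: emeasure_lborel_Icc_eq)
  then show "integrable lborel (\<lambda>x. indicat_real {a..b} x *\<^sub>R f x)"
  proof (rule Bochner_Integration.integrable_bound)
    show "AE x in lborel. norm (indicat_real {a..b} x *\<^sub>R f x) \<le> norm (indicat_real {a..b} x + (cmod (f x))\<^sup>2)"
    proof (intro AE_I2)
      fix x
      have "0 \<le> (cmod (f x) - 1)\<^sup>2" by simp
      then have "2 * cmod (f x) \<le> 1 + (cmod (f x))\<^sup>2" by (simp add: power2_diff)
      then have "cmod (f x) \<le> 1 + (cmod (f x))\<^sup>2" using norm_ge_zero[of "f x"] by linarith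
      then show "norm (indicat_real {a..b} x *\<^sub>R f x) \<le> norm (indicat_real {a..b} x + (cmod (f x))\<^sup>2)"
        by (simp add: indicator_def)
    qed
  qed measurable
qed

lemmas locally_integrable_rep = locally_integrable_square_integrable[OF square_integrable_rep]

lemma has_weak_derivative_unique:
  assumes \<Omega>: "open \<Omega>" "finite (- \<Omega>)" and "has_weak_derivative k \<Omega> u v" "has_weak_derivative k \<Omega> u w"
  shows "v = w"
proof (rule l2_eqI)
  have "AE x in lborel. x \<in> \<Omega> \<longrightarrow> rep_l2 v x - rep_l2 w x = 0"
  proof (rule fundamental_lemma[OF _ \<Omega>(1)])
    fix \<phi> assume \<phi>: "\<phi> \<in> test_functions \<Omega>"
    have "(-1) ^ k * pairing (rep_l2 v) \<phi> =
        (-1) ^ k * pairing (rep_l2 w) \<phi>"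
      using assms \<phi> by (simp add: has_weak_derivative_def)
    then have "pairing (rep_l2 v) \<phi> = pairing (rep_l2 w) \<phi>"
      by simp
    then show "pairing (\<lambda>x. rep_l2 v x - rep_l2 w x) \<phi> = 0"
      using integrable_mult_test_function[OF locally_integrable_rep \<phi>] by (simp add: algebra_simps)
  qed (intro locally_integrable_diff locally_integrable_rep)
  moreover have "AE x in lborel. x \<notin> - \<Omega>"
    by (intro AE_not_in finite_imp_null_set_lborel \<Omega>)
  ultimately show "AE x in lborel. rep_l2 v x = rep_l2 w x"
    by eventually_elim simp
qed

lemma weak_derivative_eq:
  assumes "open \<Omega>" "finite (- \<Omega>)" "has_weak_derivative k \<Omega> u v"
  shows "weak_derivative k \<Omega> u = v"
  unfolding weak_derivative_def using assms has_weak_derivative_unique by (intro the_equality) blast+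

lemma has_weak_derivative_0: "has_weak_derivative 0 \<Omega> u u"
  by (simp add: has_weak_derivative_def)

lemma has_weak_derivative_mono:
  "has_weak_derivative k \<Omega>' u v \<Longrightarrow> \<Omega> \<subseteq> \<Omega>' \<Longrightarrow> has_weak_derivative k \<Omega> u v"
  using test_functions_mono unfolding has_weak_derivative_def by blast

text \<open>
  Derivatives of test functions are test functions, so weak derivatives of higher order may be taken
  one at a time.
\<close>

lemma has_weak_derivative_Suc:
  assumes "has_weak_derivative 1 \<Omega> u v"
  shows "has_weak_derivative (Suc k) \<Omega> u w \<longleftrightarrow> has_weak_derivative k \<Omega> v w"
proof -
  have test: "(deriv ^^ k) \<phi> \<in> test_functions \<Omega>" if "\<phi> \<in> test_functions \<Omega>" for \<phi> k
    using that by (induction k) (auto intro: test_function_deriv)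
  have "(LINT x|lborel. rep_l2 u x * of_real ((deriv ^^ Suc k) \<phi> x)) =
      - (LINT x|lborel. rep_l2 v x * of_real ((deriv ^^ k) \<phi> x))" if "\<phi> \<in> test_functions \<Omega>" for \<phi>
    using assms test[OF that, of k] by (simp add: has_weak_derivative_def)
  then show ?thesis by (simp add: has_weak_derivative_def del: funpow.simps)
qed

text \<open>
  The set where two continuous functions differ is open, and nonempty open sets are not null. This is
  what makes the three boundary values well defined.
\<close>

lemma continuous_AE_eq:
  fixes g h :: "real \<Rightarrow> complex"
  assumes \<Omega>: "open \<Omega>" and "continuous_on \<Omega> g" "continuous_on \<Omega> h"
    and ae: "AE x in lborel. x \<in> \<Omega> \<longrightarrow> g x = h x" and x: "x \<in> \<Omega>"
  shows "g x = h x"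
proof (rule ccontr)
  assume ne: "g x \<noteq> h x"
  have "continuous_on \<Omega> (\<lambda>y. g y - h y)" using assms by (intro continuous_intros)
  then have "open ((\<lambda>y. g y - h y) -` (- {0}) \<inter> \<Omega>)"
    using \<Omega> by (auto simp: continuous_on_open_vimage)
  then obtain e where e: "e > 0" "ball x e \<subseteq> (\<lambda>y. g y - h y) -` (- {0}) \<inter> \<Omega>"
    using ne x by (metis (no_types, lifting) ComplI IntI diff_eq_diff_less openE right_minus_eq singletonD vimageI)
  have "AE y in lborel. y \<notin> {x - e<..<x + e}"
    using ae
  proof eventually_elim
    case (elim y)
    have "g y \<noteq> h y \<and> y \<in> \<Omega>" if "y \<in> ball x e" using e(2) that by auto
    then show ?case using elim by (auto simp: ball_eq_greaterThanLessThan)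
  qed
  then have "emeasure lborel {x - e<..<x + e} = 0"
    by (subst (asm) AE_iff_measurable[of "{x - e<..<x + e}"]) auto
  then show False using e(1) by simp
qed

lemma point_value_eq:
  assumes "continuous_on UNIV g" "AE x in lborel. g x = rep_l2 u x"
  shows "point_value u a = g a"
  unfolding point_value_def
proof (rule the_equality)
  fix c assume "\<exists>g. continuous_on UNIV g \<and> (AE x in lborel. g x = rep_l2 u x) \<and> g a = c"
  then obtain h where h: "continuous_on UNIV h" "AE x in lborel. h x = rep_l2 u x" "h a = c" by blast
  have "AE x in lborel. x \<in> UNIV \<longrightarrow> h x = g x" using h(2) assms(2) by eventually_elim simp
  then have "h a = g a" using continuous_AE_eq[of UNIV h g a] h(1) assms(1) by blast
  then show "c = g a" using h by simp
qed (use assms in blast)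

lemma right_value_eq:
  assumes "continuous_on {a<..} g" "AE x in lborel. a < x \<longrightarrow> g x = rep_l2 u x" "(g \<longlongrightarrow> c) (at_right a)"
  shows "right_value u a = c"
  unfolding right_value_def
proof (rule the_equality)
  fix c' assume "\<exists>g. continuous_on {a<..} g \<and> (AE x in lborel. a < x \<longrightarrow> g x = rep_l2 u x) \<and> (g \<longlongrightarrow> c') (at_right a)"
  then obtain h where h: "continuous_on {a<..} h" "AE x in lborel. a < x \<longrightarrow> h x = rep_l2 u x"
    "(h \<longlongrightarrow> c') (at_right a)" by blast
  have ae: "AE x in lborel. x \<in> {a<..} \<longrightarrow> g x = h x" using h(2) assms(2) by eventually_elim simp
  have "eventually (\<lambda>x. g x = h x) (at_right a)"
    using continuous_AE_eq[OF open_greaterThan assms(1) h(1) ae] by (auto simp: eventually_at_filter)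
  then have "(h \<longlongrightarrow> c) (at_right a)" using assms(3) Lim_transform_eventually by blast
  then show "c' = c" using h(3) tendsto_unique trivial_limit_at_right_real by blast
qed (use assms in blast)

lemma left_value_eq:
  assumes "continuous_on {..<a} g" "AE x in lborel. x < a \<longrightarrow> g x = rep_l2 u x" "(g \<longlongrightarrow> c) (at_left a)"
  shows "left_value u a = c"
  unfolding left_value_def
proof (rule the_equality)
  fix c' assume "\<exists>g. continuous_on {..<a} g \<and> (AE x in lborel. x < a \<longrightarrow> g x = rep_l2 u x) \<and> (g \<longlongrightarrow> c') (at_left a)"
  then obtain h where h: "continuous_on {..<a} h" "AE x in lborel. x < a \<longrightarrow> h x = rep_l2 u x"
    "(h \<longlongrightarrow> c') (at_left a)" by blast
  have ae: "AE x in lborel. x \<in> {..<a} \<longrightarrow> g x = h x" using h(2) assms(2) by eventually_elim simp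
  have "eventually (\<lambda>x. g x = h x) (at_left a)"
    using continuous_AE_eq[OF open_lessThan assms(1) h(1) ae] by (auto simp: eventually_at_filter)
  then have "(h \<longlongrightarrow> c) (at_left a)" using assms(3) Lim_transform_eventually by blast
  then show "c' = c" using h(3) tendsto_unique trivial_limit_at_left_real by blast
qed (use assms in blast)

section \<open>Weak solutions of \<open>u'' = k\<^sup>2 u\<close>\<close>

text \<open>
  Here \<open>v\<close> is the weak derivative of \<open>u\<close>. Replacing \<open>u\<close> and \<open>v\<close> by primitives of \<open>v\<close> and \<open>k\<^sup>2 u\<close> gives
  continuous representatives \<open>U\<close> and \<open>W\<close>, which then solve \<open>U' = W\<close>, \<open>W' = k\<^sup>2 U\<close> classically. The
  combinations \<open>W \<plusminus> k U\<close> solve first-order equations and are multiples of \<open>exp (\<plusminus> k x)\<close>.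
\<close>

lemma weak_solution_exponential:
  assumes u: "locally_integrable u" and v: "locally_integrable v" and \<Omega>: "open \<Omega>" "is_interval \<Omega>" and k: "k \<noteq> 0"
    and D1: "\<And>\<phi>. \<phi> \<in> test_functions \<Omega> \<Longrightarrow>
      pairing u (deriv \<phi>) = - pairing v \<phi>"
    and D2: "\<And>\<phi>. \<phi> \<in> test_functions \<Omega> \<Longrightarrow>
      pairing v (deriv \<phi>) = - pairing (\<lambda>x. k\<^sup>2 * u x) \<phi>"
  shows "\<exists>A B. AE x in lborel. x \<in> \<Omega> \<longrightarrow> u x = A * exp (k * of_real x) + B * exp (- k * of_real x)"
proof -
  have ku: "locally_integrable (\<lambda>x. k\<^sup>2 * u x)"
    using u by (simp add: locally_integrable_def set_integrable_mult_right)
  obtain U where U: "primitive_on UNIV U v" "AE x in lborel. x \<in> \<Omega> \<longrightarrow> u x = U x"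
    using weak_derivative_primitive[OF u v \<Omega> D1] by blast
  obtain W where W: "primitive_on UNIV W (\<lambda>x. k\<^sup>2 * u x)" "AE x in lborel. x \<in> \<Omega> \<longrightarrow> v x = W x"
    using weak_derivative_primitive[OF v ku \<Omega> D2] by blast
  have cU: "continuous_on A U" and cW: "continuous_on A W" for A
    using primitive_continuous[OF v U(1)] primitive_continuous[OF ku W(1)] continuous_on_subset by blast+
  have dU: "(U has_vector_derivative W x) (at x)" if "x \<in> \<Omega>" for x
    by (rule primitive_has_vector_derivative[OF v U(1) \<Omega>(1) that cW W(2)])
  have dW: "(W has_vector_derivative k\<^sup>2 * U x) (at x)" if "x \<in> \<Omega>" for x
  proof (rule primitive_has_vector_derivative[OF ku W(1) \<Omega>(1) that, where V = "\<lambda>x. k\<^sup>2 * U x"])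
    show "continuous_on \<Omega> (\<lambda>x. k\<^sup>2 * U x)" by (intro continuous_intros cU)
    show "AE y in lborel. y \<in> \<Omega> \<longrightarrow> k\<^sup>2 * u y = k\<^sup>2 * U y" using U(2) by eventually_elim simp
  qed
  have dE: "((\<lambda>x. exp (c * of_real x)) has_vector_derivative c * exp (c * of_real x)) (at x)" for c :: complex and x :: real
    by (rule has_vector_derivative_real_field) (auto intro!: derivative_eq_intros)
  have const: "\<exists>C. \<forall>x\<in>\<Omega>. (W x + m * U x) * exp (- m * of_real x) = C" if m: "m\<^sup>2 = k\<^sup>2" for m
  proof -
    have deriv0: "((\<lambda>x. (W x + m * U x) * exp (- m * of_real x)) has_vector_derivative 0) (at x within \<Omega>)" if "x \<in> \<Omega>" for x
    proof -
      have "((\<lambda>x. (W x + m * U x) * exp (- m * of_real x)) has_vector_derivative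
         (W x + m * U x) * (- m * exp (- m * of_real x)) + (k\<^sup>2 * U x + m * W x) * exp (- m * of_real x)) (at x)"
        by (intro has_vector_derivative_mult has_vector_derivative_add has_vector_derivative_mult_right dU dW dE that)
      moreover have "(W x + m * U x) * (- m * exp (- m * of_real x)) + (k\<^sup>2 * U x + m * W x) * exp (- m * of_real x) = 0"
        unfolding m[symmetric] by (simp add: algebra_simps power2_eq_square)
      ultimately show ?thesis by (metis has_vector_derivative_at_within)
    qed
    show ?thesis
    proof (rule has_vector_derivative_zero_constant[OF is_interval_convex[OF \<Omega>(2)] deriv0])
      fix C assume "\<And>x. x \<in> \<Omega> \<Longrightarrow> (W x + m * U x) * exp (- m * of_real x) = C"
      then show ?thesis by blast
    qed
  qed
  obtain C1 where C1: "\<And>x. x \<in> \<Omega> \<Longrightarrow> (W x + k * U x) * exp (- k * of_real x) = C1"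
    using const[of k] by blast
  obtain C2 where C2: "\<And>x. x \<in> \<Omega> \<Longrightarrow> (W x + (- k) * U x) * exp (- (- k) * of_real x) = C2"
    using const[of "- k"] by auto
  have "U x = (C1 / (2 * k)) * exp (k * of_real x) + (- C2 / (2 * k)) * exp (- k * of_real x)" if "x \<in> \<Omega>" for x
  proof -
    have e: "exp (- k * of_real x) * exp (k * of_real x) = 1" by (simp add: exp_minus)
    have "C1 * exp (k * of_real x) = (W x + k * U x) * (exp (- k * of_real x) * exp (k * of_real x))"
      using C1[OF that] by (simp add: mult.assoc[symmetric])
    then have 1: "C1 * exp (k * of_real x) = W x + k * U x" unfolding e by simp
    have "C2 * exp (- k * of_real x) = (W x - k * U x) * (exp (- k * of_real x) * exp (k * of_real x))"
      using C2[OF that, symmetric] by (simp add: mult_ac)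
    then have 2: "C2 * exp (- k * of_real x) = W x - k * U x" unfolding e by simp
    have "(C1 / (2 * k)) * exp (k * of_real x) + (- C2 / (2 * k)) * exp (- k * of_real x) =
        (C1 * exp (k * of_real x) - C2 * exp (- k * of_real x)) / (2 * k)"
      by (simp add: diff_divide_distrib)
    also have "\<dots> = U x" unfolding 1 2 using k by simp
    finally show ?thesis by simp
  qed
  then show ?thesis
    using U(2) by (intro exI[of _ "C1 / (2 * k)"] exI[of _ "- C2 / (2 * k)"]) (auto elim!: AE_mp)
qed

lemma square_integrable_not_large:
  assumes f: "square_integrable f"
    and ge: "AE x in lborel. x \<in> S \<longrightarrow> 1 \<le> cmod (f x)"
    and long: "\<And>n. \<exists>a. {a..a + real n} \<subseteq> S"
  shows False
proof -
  have [measurable]: "f \<in> borel_measurable borel" and i: "integrable lborel (\<lambda>x. (cmod (f x))\<^sup>2)"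
    using f by (auto simp: square_integrable_def)
  have "real n \<le> (LINT x|lborel. (cmod (f x))\<^sup>2)" for n
  proof -
    obtain a where a: "{a..a + real n} \<subseteq> S" using long by blast
    have "(LINT x|lborel. indicator {a..a + real n} x) \<le> (LINT x|lborel. (cmod (f x))\<^sup>2)"
    proof (rule integral_mono_AE[OF _ i])
      show "AE x in lborel. indicat_real {a..a + real n} x \<le> (cmod (f x))\<^sup>2"
        using ge
      proof eventually_elim
        case (elim x)
        then have "x \<in> {a..a + real n} \<Longrightarrow> 1 \<le> (cmod (f x))\<^sup>2"
          using a by (auto intro!: one_le_power)
        then show ?case by (simp add: indicator_def)
      qed
    qed simp
    then show ?thesis by simp
  qed
  then show False
    by (meson linorder_not_le reals_Archimedean2)
qed

text \<open>
  The growing exponential eventually exceeds the decaying one by at least \<open>1\<close> in modulus; the threshold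
  is obtained from \<open>exp t \<ge> t\<close>.
\<close>

lemma exponential_growth_not_square_integrable:
  assumes f: "square_integrable f" and k: "Re k > 0"
  shows "AE x in lborel. 0 < x \<longrightarrow> f x = A * exp (k * of_real x) + B * exp (- k * of_real x) \<Longrightarrow> A = 0"
    and "AE x in lborel. x < 0 \<longrightarrow> f x = A * exp (k * of_real x) + B * exp (- k * of_real x) \<Longrightarrow> B = 0"
proof -
  have key: "1 \<le> cmod (A * exp (k * of_real x) + B * exp (- k * of_real x))"
    if A: "A \<noteq> 0" and x: "(cmod B + 1) / (cmod A * Re k) \<le> x" for A B x
  proof -
    have x0: "0 \<le> x" using x k by (meson add_nonneg_nonneg divide_nonneg_nonneg less_imp_le mult_nonneg_nonneg norm_ge_zero order_trans zero_le_one)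
    have "cmod B + 1 \<le> cmod A * (Re k * x)"
      using x k A by (simp add: pos_divide_le_eq mult_ac)
    also have "\<dots> \<le> cmod A * exp (Re k * x)"
      by (intro mult_left_mono order_trans[OF _ exp_ge_add_one_self]) auto
    also have "\<dots> = cmod (A * exp (k * of_real x))" by (simp add: norm_mult)
    finally have 1: "cmod B + 1 \<le> cmod (A * exp (k * of_real x))" .
    have "cmod (B * exp (- k * of_real x)) \<le> cmod B * 1"
      using x0 k by (simp only: norm_mult norm_exp_eq_Re, intro mult_left_mono) auto
    then show ?thesis
      using 1 norm_diff_ineq[of "A * exp (k * of_real x)" "B * exp (- k * of_real x)"] by linarith
  qed
  show "A = 0" if ae: "AE x in lborel. 0 < x \<longrightarrow> f x = A * exp (k * of_real x) + B * exp (- k * of_real x)"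
  proof (rule ccontr)
    assume A: "A \<noteq> 0"
    let ?r = "(cmod B + 1) / (cmod A * Re k)"
    have r: "0 < ?r" using A k by (simp add: add_nonneg_pos)
    show False
    proof (rule square_integrable_not_large[OF f, of "{?r..}"])
      show "AE x in lborel. x \<in> {?r..} \<longrightarrow> 1 \<le> cmod (f x)"
        using ae
      proof eventually_elim
        case (elim x)
        then show ?case using key[OF A, of B x] r by auto
      qed
      show "\<exists>a. {a..a + real n} \<subseteq> {?r..}" for n by (rule exI[of _ ?r]) auto
    qed
  qed
  show "B = 0" if ae: "AE x in lborel. x < 0 \<longrightarrow> f x = A * exp (k * of_real x) + B * exp (- k * of_real x)"
  proof (rule ccontr)
    assume B: "B \<noteq> 0"
    let ?r = "(cmod A + 1) / (cmod B * Re k)"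
    have r: "0 < ?r" using B k by (simp add: add_nonneg_pos)
    show False
    proof (rule square_integrable_not_large[OF f, of "{..- ?r}"])
      show "AE x in lborel. x \<in> {..- ?r} \<longrightarrow> 1 \<le> cmod (f x)"
        using ae
      proof eventually_elim
        case (elim x)
        then show ?case using key[OF B, of A "- x"] r by (auto simp: add.commute)
      qed
      show "\<exists>a. {a..a + real n} \<subseteq> {..- ?r}" for n by (rule exI[of _ "- ?r - real n"]) auto
    qed
  qed
qed

section \<open>Integral operators with exponentially dominated kernels\<close>

lemma has_bochner_integral_exp_half_line:
  fixes a :: real assumes "a > 0"
  shows "has_bochner_integral lborel (\<lambda>x. indicator {0..} x *\<^sub>R exp (- a * x)) (1 / a)"
proof (rule has_bochner_integral_nn_integral)
  have "(\<integral>\<^sup>+x. ennreal (exp (- a * x)) * indicator {0..} x \<partial>lborel) = ennreal (0 - - exp (- a * 0) / a)"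
  proof (rule nn_integral_FTC_atLeast)
    show "((\<lambda>x. - exp (- a * x) / a) has_real_derivative exp (- a * x)) (at x)" for x
      using assms by (auto intro!: derivative_eq_intros)
    have "filterlim (\<lambda>x. - a * x) at_bot at_top"
      using assms by (intro filterlim_tendsto_neg_mult_at_bot[OF tendsto_const]) (auto intro: filterlim_ident)
    then have "((\<lambda>x. exp (- a * x)) \<longlongrightarrow> 0) at_top"
      by (rule filterlim_compose[OF exp_at_bot])
    from tendsto_divide[OF tendsto_minus[OF this] tendsto_const[of a]]
    show "((\<lambda>x. - exp (- a * x) / a) \<longlongrightarrow> 0) at_top" using assms by simp
  qed auto
  also have "(\<integral>\<^sup>+x. ennreal (exp (- a * x)) * indicator {0..} x \<partial>lborel) =
      (\<integral>\<^sup>+x. ennreal (indicator {0..} x *\<^sub>R exp (- a * x)) \<partial>lborel)"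
    by (intro nn_integral_cong) (auto simp: indicator_def)
  finally show "(\<integral>\<^sup>+x. ennreal (indicator {0..} x *\<^sub>R exp (- a * x)) \<partial>lborel) = ennreal (1 / a)"
    by simp
qed (use assms in auto)

lemma exp_kernel_integral:
  fixes a x :: real assumes a: "a > 0"
  shows "integrable lborel (\<lambda>y. exp (- a * \<bar>x - y\<bar>))"
    and "(LINT y|lborel. exp (- a * \<bar>x - y\<bar>)) = 2 / a"
proof -
  have "has_bochner_integral lborel (\<lambda>y. indicator {0..} y *\<^sub>R exp (- a * \<bar>y\<bar>)) (1 / a)"
    using has_bochner_integral_exp_half_line[OF a]
    by (rule has_bochner_integral_cong[THEN iffD1, rotated -1]) (auto simp: indicator_def)
  from has_bochner_integral_even_function[OF this]
  have hb: "has_bochner_integral lborel (\<lambda>y. exp (- a * \<bar>y\<bar>)) (2 / a)" by simp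
  have "integrable lborel (\<lambda>y. exp (- a * \<bar>- x + 1 * y\<bar>))"
    using hb by (intro lborel_integrable_real_affine) (auto simp: has_bochner_integral_iff)
  moreover have "(LINT y|lborel. exp (- a * \<bar>y\<bar>)) = (LINT y|lborel. exp (- a * \<bar>- x + 1 * y\<bar>))"
    using lborel_integral_real_affine[of 1 "\<lambda>y. exp (- a * \<bar>y\<bar>)" "- x"] by simp
  moreover have "(\<lambda>y. exp (- a * \<bar>- x + 1 * y\<bar>)) = (\<lambda>y. exp (- a * \<bar>x - y\<bar>))"
    by (simp add: abs_minus_commute)
  ultimately show "integrable lborel (\<lambda>y. exp (- a * \<bar>x - y\<bar>))"
    and "(LINT y|lborel. exp (- a * \<bar>x - y\<bar>)) = 2 / a"
    using hb by (simp_all add: has_bochner_integral_iff)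
qed

text \<open>
  The quadratic polynomial \<open>t \<mapsto> \<integral>(t p - q)\<^sup>2\<close> is nonnegative; evaluate it at its minimum.
\<close>

lemma Cauchy_Schwarz_integral:
  fixes p q :: "'a \<Rightarrow> real"
  assumes p: "integrable M (\<lambda>x. (p x)\<^sup>2)" and q: "integrable M (\<lambda>x. (q x)\<^sup>2)"
    and pq: "integrable M (\<lambda>x. p x * q x)"
  shows "(LINT x|M. p x * q x)\<^sup>2 \<le> (LINT x|M. (p x)\<^sup>2) * (LINT x|M. (q x)\<^sup>2)"
proof -
  define A B I where "A = (LINT x|M. (p x)\<^sup>2)" and "B = (LINT x|M. (q x)\<^sup>2)" and "I = (LINT x|M. p x * q x)"
  have quad: "0 \<le> t\<^sup>2 * A - 2 * t * I + B" for t
  proof -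
    have "0 \<le> (LINT x|M. (t * p x - q x)\<^sup>2)" by simp
    also have "\<dots> = (LINT x|M. t\<^sup>2 * (p x)\<^sup>2 - 2 * t * (p x * q x) + (q x)\<^sup>2)"
      by (rule Bochner_Integration.integral_cong) (simp_all add: power2_diff power_mult_distrib mult_ac)
    also have "\<dots> = t\<^sup>2 * A - 2 * t * I + B"
      unfolding A_def B_def I_def using p q pq by simp
    finally show ?thesis .
  qed
  have "I\<^sup>2 \<le> A * B"
  proof (cases "A = 0")
    case True
    have "I = 0"
    proof (rule ccontr)
      assume "I \<noteq> 0"
      then show False using quad[of "(B + 1) / (2 * I)"] True by (simp add: field_simps)
    qed
    then show ?thesis using True by simp
  next
    case False
    moreover have "A \<ge> 0" by (simp add: A_def)
    ultimately have A: "A > 0" by simp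
    have "0 \<le> (I / A)\<^sup>2 * A - 2 * (I / A) * I + B" by (rule quad)
    also have "\<dots> = B - I\<^sup>2 / A" using A by (simp add: field_simps power2_eq_square)
    finally show ?thesis using A by (simp add: field_simps)
  qed
  then show ?thesis by (simp add: A_def B_def I_def)
qed

text \<open>
  A class of kernels containing the Green functions below and their derivatives. The bound by
  \<open>C exp (- a |x - y|)\<close> suffices for boundedness on square-integrable functions, for Fubini's theorem,
  and for dominated convergence in \<open>x\<close>.
\<close>

definition exp_kernel :: "real \<Rightarrow> real \<Rightarrow> (real \<Rightarrow> real \<Rightarrow> complex) \<Rightarrow> bool" where
  "exp_kernel a C K \<longleftrightarrow> (\<lambda>(x, y). K x y) \<in> borel_measurable (borel \<Otimes>\<^sub>M borel) \<and>
     (\<forall>x y. cmod (K x y) \<le> C * exp (- a * \<bar>x - y\<bar>))"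

definition kernel_op :: "(real \<Rightarrow> real \<Rightarrow> complex) \<Rightarrow> (real \<Rightarrow> complex) \<Rightarrow> real \<Rightarrow> complex" where
  "kernel_op K f x = (LINT y|lborel. K x y * f y)"

lemma exp_kernel_measurable:
  assumes "exp_kernel a C K"
  shows "(\<lambda>(x, y). K x y) \<in> borel_measurable (lborel \<Otimes>\<^sub>M lborel)" "(\<lambda>y. K x y) \<in> borel_measurable borel"
    "(\<lambda>x. K x y) \<in> borel_measurable borel"
proof -
  have m[measurable]: "(\<lambda>(x, y). K x y) \<in> borel_measurable (borel \<Otimes>\<^sub>M borel)" using assms by (simp add: exp_kernel_def)
  then show "(\<lambda>(x, y). K x y) \<in> borel_measurable (lborel \<Otimes>\<^sub>M lborel)" by (simp cong: measurable_cong_sets)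
  show "(\<lambda>y. K x y) \<in> borel_measurable borel"
    using measurable_compose[OF measurable_Pair1' m, of x] by simp
  show "(\<lambda>x. K x y) \<in> borel_measurable borel"
    using measurable_compose[OF measurable_Pair2' m, of y] by simp
qed

lemma exp_kernel_bound: "exp_kernel a C K \<Longrightarrow> cmod (K x y) \<le> C * exp (- a * \<bar>x - y\<bar>)"
  by (simp add: exp_kernel_def)

lemma exp_kernel_nonneg: "exp_kernel a C K \<Longrightarrow> 0 \<le> C"
  using order_trans[OF norm_ge_zero exp_kernel_bound[of a C K 0 0]] by simp

context
  fixes a C :: real and K :: "real \<Rightarrow> real \<Rightarrow> complex" and f :: "real \<Rightarrow> complex"
  assumes a: "a > 0" and K: "exp_kernel a C K" and f: "square_integrable f"
begin

lemma exp_weight_mult_integrable: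
  "integrable lborel (\<lambda>y. exp (- a * \<bar>x - y\<bar>) * cmod (f y))"
  "(LINT y|lborel. exp (- a * \<bar>x - y\<bar>) * cmod (f y)) \<le> 2 / a + (LINT y|lborel. (cmod (f y))\<^sup>2)"
proof -
  have [measurable]: "f \<in> borel_measurable borel" and i: "integrable lborel (\<lambda>x. (cmod (f x))\<^sup>2)"
    using f by (auto simp: square_integrable_def)
  have b: "exp (- a * \<bar>x - y\<bar>) * cmod (f y) \<le> exp (- a * \<bar>x - y\<bar>) + (cmod (f y))\<^sup>2" for y
  proof -
    let ?e = "exp (- a * \<bar>x - y\<bar>)" and ?c = "cmod (f y)"
    have e: "0 < ?e" "?e \<le> 1" using a by auto
    have "0 \<le> (?e - ?c)\<^sup>2" by simp
    then have "2 * (?e * ?c) \<le> ?e\<^sup>2 + ?c\<^sup>2" by (simp add: power2_diff)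
    moreover have "?e\<^sup>2 \<le> ?e" using e by (simp add: power2_eq_square mult_left_le_one_le)
    moreover have "0 \<le> ?e * ?c" using e by simp
    ultimately show ?thesis by linarith
  qed
  have i2: "integrable lborel (\<lambda>y. exp (- a * \<bar>x - y\<bar>) + (cmod (f y))\<^sup>2)"
    using i exp_kernel_integral[OF a] by simp
  then show i3: "integrable lborel (\<lambda>y. exp (- a * \<bar>x - y\<bar>) * cmod (f y))"
  proof (rule Bochner_Integration.integrable_bound)
    show "AE y in lborel. norm (exp (- a * \<bar>x - y\<bar>) * cmod (f y)) \<le> norm (exp (- a * \<bar>x - y\<bar>) + (cmod (f y))\<^sup>2)"
    proof (intro AE_I2)
      fix y show "norm (exp (- a * \<bar>x - y\<bar>) * cmod (f y)) \<le> norm (exp (- a * \<bar>x - y\<bar>) + (cmod (f y))\<^sup>2)"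
        using b[of y] by (simp add: add_nonneg_nonneg)
    qed
  qed measurable
  have "(LINT y|lborel. exp (- a * \<bar>x - y\<bar>) * cmod (f y)) \<le> (LINT y|lborel. exp (- a * \<bar>x - y\<bar>) + (cmod (f y))\<^sup>2)"
    using i3 i2 b by (intro integral_mono) auto
  also have "\<dots> = 2 / a + (LINT y|lborel. (cmod (f y))\<^sup>2)"
    using i exp_kernel_integral[OF a] by simp
  finally show "(LINT y|lborel. exp (- a * \<bar>x - y\<bar>) * cmod (f y)) \<le> 2 / a + (LINT y|lborel. (cmod (f y))\<^sup>2)" .
qed

lemma kernel_op_integrable: "integrable lborel (\<lambda>y. K x y * f y)"
proof -
  have [measurable]: "f \<in> borel_measurable borel" "(\<lambda>y. K x y) \<in> borel_measurable borel"
    using f exp_kernel_measurable[OF K] by (auto simp: square_integrable_def)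
  show ?thesis
  proof (rule Bochner_Integration.integrable_bound[OF integrable_mult_right[OF exp_weight_mult_integrable(1)]])
    show "AE y in lborel. norm (K x y * f y) \<le> norm (C * (exp (- a * \<bar>x - y\<bar>) * cmod (f y)))"
      using exp_kernel_bound[OF K, of x] exp_kernel_nonneg[OF K]
      by (intro AE_I2) (simp add: norm_mult mult.assoc[symmetric] mult_right_mono)
  qed measurable
qed

lemma kernel_op_abs_le:
  "(LINT y|lborel. norm (K x y * f y)) \<le> C * (LINT y|lborel. exp (- a * \<bar>x - y\<bar>) * cmod (f y))"
proof -
  have "(LINT y|lborel. norm (K x y * f y)) \<le> (LINT y|lborel. C * (exp (- a * \<bar>x - y\<bar>) * cmod (f y)))"
    using exp_kernel_bound[OF K, of x]
    by (intro integral_mono integrable_norm kernel_op_integrable integrable_mult_right exp_weight_mult_integrable)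
      (simp add: norm_mult mult.assoc[symmetric] mult_right_mono)
  then show ?thesis by simp
qed

lemma kernel_op_measurable: "kernel_op K f \<in> borel_measurable borel"
proof -
  have [measurable]: "f \<in> borel_measurable borel" "(\<lambda>(x, y). K x y) \<in> borel_measurable (borel \<Otimes>\<^sub>M borel)"
    using f K by (auto simp: square_integrable_def exp_kernel_def)
  have "(\<lambda>x. LINT y|lborel. K x y * f y) \<in> borel_measurable borel"
    by (rule lborel.borel_measurable_lebesgue_integral) measurable
  then show ?thesis by (simp add: kernel_op_def[abs_def])
qed

text \<open>
  Schur's test: the Cauchy-Schwarz inequality is applied after writing \<open>exp (- a |x - y|)\<close> as the square of
  \<open>exp (- (a / 2) |x - y|)\<close>, and each of the two integrals of \<open>exp (- a |x - y|)\<close>, over \<open>y\<close> and then over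
  \<open>x\<close>, contributes a factor \<open>2 / a\<close>.
\<close>

lemma Schur_bound:
  "square_integrable (kernel_op K f)" "l2_norm (kernel_op K f) \<le> 2 * C / a * l2_norm f"
proof -
  have [measurable]: "f \<in> borel_measurable borel" and i: "integrable lborel (\<lambda>x. (cmod (f x))\<^sup>2)"
    using f by (auto simp: square_integrable_def)
  let ?e = "\<lambda>x y. exp (- a * \<bar>x - y\<bar>)"
  have m: "(\<lambda>(x, y). ?e x y * (cmod (f x))\<^sup>2) \<in> borel_measurable (lborel \<Otimes>\<^sub>M lborel)" by measurable
  have prod: "integrable (lborel \<Otimes>\<^sub>M lborel) (\<lambda>(y, x). ?e y x * (cmod (f y))\<^sup>2)"
  proof (rule lborel_pair.Fubini_integrable[OF m])
    show "integrable lborel (\<lambda>y. LINT x|lborel. norm (case (y, x) of (y, x) \<Rightarrow> ?e y x * (cmod (f y))\<^sup>2))"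
      using integrable_mult_right[OF i, of "2 / a"] exp_kernel_integral[OF a] by (simp add: norm_mult)
    show "AE y in lborel. integrable lborel (\<lambda>x. case (y, x) of (y, x) \<Rightarrow> ?e y x * (cmod (f y))\<^sup>2)"
      using exp_kernel_integral[OF a] by simp
  qed
  have J_int: "integrable lborel (\<lambda>x. LINT y|lborel. ?e y x * (cmod (f y))\<^sup>2)"
    using lborel_pair.integrable_snd[OF prod] .
  have J_ae: "AE x in lborel. integrable lborel (\<lambda>y. ?e y x * (cmod (f y))\<^sup>2)"
    using lborel_pair.AE_integrable_snd[OF prod] .
  have "(LINT x|lborel. LINT y|lborel. ?e y x * (cmod (f y))\<^sup>2) = (LINT y|lborel. LINT x|lborel. ?e y x * (cmod (f y))\<^sup>2)"
    by (rule lborel_pair.Fubini_integral[OF prod])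
  also have "\<dots> = (LINT y|lborel. 2 / a * (cmod (f y))\<^sup>2)"
    by (simp only: integral_mult_left_zero exp_kernel_integral(2)[OF a])
  finally have J_val: "(LINT x|lborel. LINT y|lborel. ?e y x * (cmod (f y))\<^sup>2) = 2 / a * (l2_norm f)\<^sup>2"
    by (simp add: l2_norm_power2)
  have pw: "AE x in lborel. (cmod (kernel_op K f x))\<^sup>2 \<le> C\<^sup>2 * (2 / a) * (LINT y|lborel. ?e y x * (cmod (f y))\<^sup>2)"
    using J_ae
  proof eventually_elim
    case (elim x)
    have s: "?e x y = exp (- a / 2 * \<bar>x - y\<bar>) ^ 2" for x y
      by (simp add: power2_eq_square exp_add[symmetric])
    have "cmod (kernel_op K f x) \<le> (LINT y|lborel. norm (K x y * f y))"
      unfolding kernel_op_def by simp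
    also have "\<dots> \<le> C * (LINT y|lborel. ?e x y * cmod (f y))" by (rule kernel_op_abs_le)
    finally have "(cmod (kernel_op K f x))\<^sup>2 \<le> (C * (LINT y|lborel. ?e x y * cmod (f y)))\<^sup>2"
      by (intro power_mono) auto
    also have "\<dots> = C\<^sup>2 * (LINT y|lborel. ?e x y * cmod (f y))\<^sup>2" by (simp add: power_mult_distrib)
    also have "(LINT y|lborel. ?e x y * cmod (f y))\<^sup>2 \<le> (LINT y|lborel. ?e x y) * (LINT y|lborel. ?e x y * (cmod (f y))\<^sup>2)"
    proof -
      have "(LINT y|lborel. exp (- a / 2 * \<bar>x - y\<bar>) * (exp (- a / 2 * \<bar>x - y\<bar>) * cmod (f y)))\<^sup>2
         \<le> (LINT y|lborel. (exp (- a / 2 * \<bar>x - y\<bar>))\<^sup>2) * (LINT y|lborel. (exp (- a / 2 * \<bar>x - y\<bar>) * cmod (f y))\<^sup>2)"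
      proof (rule Cauchy_Schwarz_integral)
        show "integrable lborel (\<lambda>y. (exp (- a / 2 * \<bar>x - y\<bar>))\<^sup>2)"
          using exp_kernel_integral(1)[OF a, of x] unfolding s .
        show "integrable lborel (\<lambda>y. (exp (- a / 2 * \<bar>x - y\<bar>) * cmod (f y))\<^sup>2)"
          unfolding power_mult_distrib s[symmetric] using elim by (simp add: abs_minus_commute)
        show "integrable lborel (\<lambda>y. exp (- a / 2 * \<bar>x - y\<bar>) * (exp (- a / 2 * \<bar>x - y\<bar>) * cmod (f y)))"
          unfolding mult.assoc[symmetric] power2_eq_square[symmetric] s[symmetric]
          by (rule exp_weight_mult_integrable(1))
      qed
      then show ?thesis
        unfolding power_mult_distrib s[symmetric] unfolding mult.assoc[symmetric] power2_eq_square[symmetric] s[symmetric]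
        by (simp add: power2_eq_square)
    qed
    also have "(LINT y|lborel. ?e x y) = 2 / a" by (rule exp_kernel_integral(2)[OF a])
    finally show ?case by (simp add: mult_left_mono abs_minus_commute mult.assoc)
  qed
  have [measurable]: "kernel_op K f \<in> borel_measurable borel" by (rule kernel_op_measurable)
  have bd: "integrable lborel (\<lambda>x. C\<^sup>2 * (2 / a) * (LINT y|lborel. ?e y x * (cmod (f y))\<^sup>2))"
    using J_int by simp
  have int: "integrable lborel (\<lambda>x. (cmod (kernel_op K f x))\<^sup>2)"
  proof (rule Bochner_Integration.integrable_bound[OF bd])
    show "AE x in lborel. norm ((cmod (kernel_op K f x))\<^sup>2) \<le> norm (C\<^sup>2 * (2 / a) * (LINT y|lborel. ?e y x * (cmod (f y))\<^sup>2))"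
      using pw by eventually_elim (use a in auto)
  qed measurable
  then show "square_integrable (kernel_op K f)" by (simp add: square_integrable_def)
  have "(l2_norm (kernel_op K f))\<^sup>2 \<le> (LINT x|lborel. C\<^sup>2 * (2 / a) * (LINT y|lborel. ?e y x * (cmod (f y))\<^sup>2))"
    unfolding l2_norm_power2 by (rule integral_mono_AE[OF int bd pw])
  also have "\<dots> = C\<^sup>2 * (2 / a) * (2 / a * (l2_norm f)\<^sup>2)"
    by (simp only: integral_mult_right_zero J_val)
  also have "\<dots> = (2 * C / a * l2_norm f)\<^sup>2" by (simp add: power2_eq_square)
  finally show "l2_norm (kernel_op K f) \<le> 2 * C / a * l2_norm f"
    by (rule power2_le_imp_le) (use a exp_kernel_nonneg[OF K] l2_norm_nonneg in simp)
qed

lemma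
  assumes \<phi>: "integrable lborel (\<phi> :: real \<Rightarrow> complex)"
  shows kernel_op_Fubini: "(LINT x|lborel. kernel_op K f x * \<phi> x) = (LINT y|lborel. f y * (LINT x|lborel. K x y * \<phi> x))"
    and kernel_op_test_integrable: "integrable lborel (\<lambda>y. f y * (LINT x|lborel. K x y * \<phi> x))"
proof -
  have [measurable]: "f \<in> borel_measurable borel" "(\<lambda>(x, y). K x y) \<in> borel_measurable (borel \<Otimes>\<^sub>M borel)"
    "\<phi> \<in> borel_measurable borel"
    using f K borel_measurable_integrable[OF \<phi>] by (auto simp: square_integrable_def exp_kernel_def)
  have prod: "integrable (lborel \<Otimes>\<^sub>M lborel) (\<lambda>(x, y). K x y * f y * \<phi> x)"
  proof (rule lborel_pair.Fubini_integrable)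
    show "(\<lambda>(x, y). K x y * f y * \<phi> x) \<in> borel_measurable (lborel \<Otimes>\<^sub>M lborel)" by measurable
    let ?B = "C * (2 / a + (LINT y|lborel. (cmod (f y))\<^sup>2))"
    show "integrable lborel (\<lambda>x. LINT y|lborel. norm (case (x, y) of (x, y) \<Rightarrow> K x y * f y * \<phi> x))"
    proof (rule Bochner_Integration.integrable_bound[OF integrable_mult_right[OF integrable_norm[OF \<phi>], of ?B]])
      show "(\<lambda>x. LINT y|lborel. norm (case (x, y) of (x, y) \<Rightarrow> K x y * f y * \<phi> x)) \<in> borel_measurable lborel"
        by measurable
      show "AE x in lborel. norm (LINT y|lborel. norm (case (x, y) of (x, y) \<Rightarrow> K x y * f y * \<phi> x)) \<le> norm (?B * norm (\<phi> x))"
      proof (intro AE_I2)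
        fix x
        have "(LINT y|lborel. norm (K x y * f y)) \<le> C * (LINT y|lborel. exp (- a * \<bar>x - y\<bar>) * cmod (f y))"
          by (rule kernel_op_abs_le)
        also have "\<dots> \<le> ?B"
          by (intro mult_left_mono exp_weight_mult_integrable exp_kernel_nonneg[OF K])
        finally have 1: "(LINT y|lborel. norm (K x y * f y)) \<le> ?B" .
        have "(LINT y|lborel. norm (case (x, y) of (x, y) \<Rightarrow> K x y * f y * \<phi> x)) = (LINT y|lborel. norm (K x y * f y)) * norm (\<phi> x)"
          by (simp add: norm_mult)
        moreover have "0 \<le> ?B * norm (\<phi> x)"
          using exp_kernel_nonneg[OF K] a by (intro mult_nonneg_nonneg add_nonneg_nonneg) auto
        ultimately show "norm (LINT y|lborel. norm (case (x, y) of (x, y) \<Rightarrow> K x y * f y * \<phi> x)) \<le> norm (?B * norm (\<phi> x))"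
          using mult_right_mono[OF 1, of "norm (\<phi> x)"] by (simp del: norm_mult)
      qed
    qed
    show "AE x in lborel. integrable lborel (\<lambda>y. case (x, y) of (x, y) \<Rightarrow> K x y * f y * \<phi> x)"
      using kernel_op_integrable by simp
  qed
  have pull: "(LINT x|lborel. K x y * f y * \<phi> x) = f y * (LINT x|lborel. K x y * \<phi> x)" for y
  proof -
    have "(LINT x|lborel. K x y * f y * \<phi> x) = (LINT x|lborel. f y * (K x y * \<phi> x))"
      by (simp add: mult_ac)
    then show ?thesis by simp
  qed
  have "(LINT x|lborel. kernel_op K f x * \<phi> x) = (LINT x|lborel. LINT y|lborel. K x y * f y * \<phi> x)"
    by (simp add: kernel_op_def)
  also have "\<dots> = (LINT y|lborel. LINT x|lborel. K x y * f y * \<phi> x)"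
    using lborel_pair.Fubini_integral[OF prod] by simp
  also have "\<dots> = (LINT y|lborel. f y * (LINT x|lborel. K x y * \<phi> x))"
    by (simp only: pull)
  finally show "(LINT x|lborel. kernel_op K f x * \<phi> x) = (LINT y|lborel. f y * (LINT x|lborel. K x y * \<phi> x))" .
  show "integrable lborel (\<lambda>y. f y * (LINT x|lborel. K x y * \<phi> x))"
    using lborel_pair.integrable_snd[OF prod] by (simp only: pull)
qed

text \<open>
  A sequence converging to \<open>x0\<close> stays within some distance \<open>R\<close> of \<open>x0\<close>, so the kernel along it is
  dominated by \<open>C exp (a R) exp (- a |x0 - y|)\<close>.
\<close>

lemma kernel_op_tendsto:
  assumes [measurable]: "L \<in> borel_measurable borel"
    and lim: "AE y in lborel. ((\<lambda>x. K x y) \<longlongrightarrow> L y) (at x0 within S)"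
  shows "(kernel_op K f \<longlongrightarrow> (LINT y|lborel. L y * f y)) (at x0 within S)"
  unfolding tendsto_at_iff_sequentially
proof (intro allI impI)
  fix X assume X: "\<forall>i. X i \<in> S - {x0}" "X \<longlonglongrightarrow> x0"
  have [measurable]: "f \<in> borel_measurable borel" "\<And>x. (\<lambda>y. K x y) \<in> borel_measurable borel"
    using f exp_kernel_measurable[OF K] by (auto simp: square_integrable_def)
  have "(\<lambda>i. X i - x0) \<longlonglongrightarrow> 0" using X(2) LIM_zero by blast
  then have "Bseq (\<lambda>i. X i - x0)" by (intro convergent_imp_Bseq) (auto simp: convergent_def)
  then obtain R where R: "\<And>i. \<bar>X i - x0\<bar> \<le> R" by (auto simp: Bseq_def)
  have "(\<lambda>i. LINT y|lborel. K (X i) y * f y) \<longlonglongrightarrow> (LINT y|lborel. L y * f y)"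
  proof (rule integral_dominated_convergence[where w = "\<lambda>y. C * exp (a * R) * (exp (- a * \<bar>x0 - y\<bar>) * cmod (f y))"])
    show "integrable lborel (\<lambda>y. C * exp (a * R) * (exp (- a * \<bar>x0 - y\<bar>) * cmod (f y)))"
      by (intro integrable_mult_right exp_weight_mult_integrable)
    show "AE y in lborel. (\<lambda>i. K (X i) y * f y) \<longlonglongrightarrow> L y * f y"
      using lim
    proof eventually_elim
      case (elim y)
      then have "((\<lambda>x. K x y) \<circ> X) \<longlonglongrightarrow> L y"
        using X unfolding tendsto_at_iff_sequentially by blast
      then show ?case by (intro tendsto_mult tendsto_const) (simp add: o_def)
    qed
    show "AE y in lborel. norm (K (X i) y * f y) \<le> C * exp (a * R) * (exp (- a * \<bar>x0 - y\<bar>) * cmod (f y))" for i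
    proof (intro AE_I2)
      fix y
      have "\<bar>x0 - y\<bar> \<le> R + \<bar>X i - y\<bar>" using R[of i] by linarith
      then have "a * \<bar>x0 - y\<bar> \<le> a * (R + \<bar>X i - y\<bar>)" using a by (intro mult_left_mono) auto
      then have "exp (- a * \<bar>X i - y\<bar>) \<le> exp (a * R) * exp (- a * \<bar>x0 - y\<bar>)"
        by (simp add: exp_add[symmetric] algebra_simps)
      then have "C * exp (- a * \<bar>X i - y\<bar>) \<le> C * (exp (a * R) * exp (- a * \<bar>x0 - y\<bar>))"
        using exp_kernel_nonneg[OF K] by (intro mult_left_mono)
      then have "cmod (K (X i) y) \<le> C * (exp (a * R) * exp (- a * \<bar>x0 - y\<bar>))"
        using exp_kernel_bound[OF K, of "X i" y] by linarith
      from mult_right_mono[OF this, of "cmod (f y)"]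
      show "norm (K (X i) y * f y) \<le> C * exp (a * R) * (exp (- a * \<bar>x0 - y\<bar>) * cmod (f y))"
        by (simp add: norm_mult mult_ac)
    qed
  qed auto
  then show "(kernel_op K f \<circ> X) \<longlonglongrightarrow> (LINT y|lborel. L y * f y)"
    by (simp add: kernel_op_def o_def)
qed

lemma kernel_op_continuous_on:
  assumes S: "open S" and lim: "\<And>x. x \<in> S \<Longrightarrow> AE y in lborel. isCont (\<lambda>x. K x y) x"
  shows "continuous_on S (kernel_op K f)"
proof (rule continuous_at_imp_continuous_on, rule ballI)
  fix x assume "x \<in> S"
  then have "(kernel_op K f \<longlongrightarrow> (LINT y|lborel. K x y * f y)) (at x)"
    using lim by (intro kernel_op_tendsto exp_kernel_measurable[OF K]) (auto simp: isCont_def)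
  then show "isCont (kernel_op K f) x" by (simp add: isCont_def kernel_op_def)
qed

end

text \<open>
  By Fubini's theorem the weak derivative in \<open>x\<close> of an integral operator can be computed for each fixed
  \<open>y\<close>. The number \<open>s\<close> is the height of the downward jump of the kernel on the diagonal.
\<close>

lemma kernel_op_integration_by_parts:
  assumes a: "a > 0" and K: "exp_kernel a C K" and K': "exp_kernel a C' K'" and f: "square_integrable f"
    and \<phi>: "\<phi> \<in> test_functions \<Omega>"
    and ibp: "AE y in lborel. pairing (\<lambda>x. K x y) (deriv \<phi>) =
      - pairing (\<lambda>x. K' x y) \<phi> + s * of_real (\<phi> y)"
  shows "pairing (kernel_op K f) (deriv \<phi>) =
     - pairing (\<lambda>x. kernel_op K' f x - s * f x) \<phi>"
proof -
  have li: "locally_integrable f" "locally_integrable (kernel_op K' f)" "locally_integrable (\<lambda>_. 1)"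
    using Schur_bound(1)[OF a K' f] f locally_integrable_square_integrable locally_integrable_continuous
    by (auto intro: continuous_intros)
  have i\<phi>: "integrable lborel (\<lambda>x. complex_of_real (\<phi> x))"
    "integrable lborel (\<lambda>x. complex_of_real (deriv \<phi> x))"
    using integrable_mult_test_function[OF li(3)] \<phi> test_function_deriv[OF \<phi>] by simp_all
  have [measurable]: "f \<in> borel_measurable borel" "(\<lambda>(x, y). K x y) \<in> borel_measurable (borel \<Otimes>\<^sub>M borel)"
    "(\<lambda>(x, y). K' x y) \<in> borel_measurable (borel \<Otimes>\<^sub>M borel)"
    "(\<lambda>x. complex_of_real (\<phi> x)) \<in> borel_measurable borel"
    "(\<lambda>x. complex_of_real (deriv \<phi> x)) \<in> borel_measurable borel"
    using f K K' i\<phi>[THEN borel_measurable_integrable] by (auto simp: square_integrable_def exp_kernel_def)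
  have if\<phi>: "integrable lborel (\<lambda>y. f y * of_real (\<phi> y))" "integrable lborel (\<lambda>y. kernel_op K' f y * of_real (\<phi> y))"
    using integrable_mult_test_function[OF _ \<phi>] li by auto
  have iK': "integrable lborel (\<lambda>y. f y * pairing (\<lambda>x. K' x y) \<phi>)"
    by (rule kernel_op_test_integrable[OF a K' f i\<phi>(1)])
  have "pairing (kernel_op K f) (deriv \<phi>) =
      (LINT y|lborel. f y * pairing (\<lambda>x. K x y) (deriv \<phi>))"
    by (rule kernel_op_Fubini[OF a K f i\<phi>(2)])
  also have "\<dots> = (LINT y|lborel. - (f y * pairing (\<lambda>x. K' x y) \<phi>) + s * (f y * of_real (\<phi> y)))"
  proof (rule integral_cong_AE)
    show "AE y in lborel. f y * pairing (\<lambda>x. K x y) (deriv \<phi>) =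
        - (f y * pairing (\<lambda>x. K' x y) \<phi>) + s * (f y * of_real (\<phi> y))"
      using ibp
    proof eventually_elim
      case (elim y)
      show ?case unfolding elim by (simp add: distrib_left right_diff_distrib mult.left_commute)
    qed
  qed measurable
  also have "\<dots> = - (LINT y|lborel. f y * pairing (\<lambda>x. K' x y) \<phi>) + s * (LINT y|lborel. f y * of_real (\<phi> y))"
    using iK' if\<phi> by simp
  also have "(LINT y|lborel. f y * pairing (\<lambda>x. K' x y) \<phi>) = pairing (kernel_op K' f) \<phi>"
    by (rule kernel_op_Fubini[OF a K' f i\<phi>(1), symmetric])
  also have "- pairing (kernel_op K' f) \<phi> + s * (LINT y|lborel. f y * of_real (\<phi> y)) =
      - (LINT x|lborel. kernel_op K' f x * of_real (\<phi> x) - s * (f x * of_real (\<phi> x)))"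
    using if\<phi> by simp
  also have "(\<lambda>x. kernel_op K' f x * of_real (\<phi> x) - s * (f x * of_real (\<phi> x))) =
      (\<lambda>x. (kernel_op K' f x - s * f x) * complex_of_real (\<phi> x))"
    by (simp add: algebra_simps)
  finally show ?thesis .
qed

section \<open>The Dirichlet Green function of a half-line\<close>

lemma exp_affine_derivative:
  "((\<lambda>s. exp (c * of_real s + d)) has_vector_derivative c * exp (c * of_real s + d)) (at s)" for c d :: complex
  by (rule has_vector_derivative_real_field) (auto intro!: derivative_eq_intros)

text \<open>
  The kernel of the inverse of \<open>- d\<^sup>2/ds\<^sup>2 + k\<^sup>2\<close> on the half-line \<open>s > 0\<close> with a Dirichlet condition at
  \<open>0\<close>, by the method of images.
\<close>

definition dirichlet_green :: "complex \<Rightarrow> real \<Rightarrow> real \<Rightarrow> complex" where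
  "dirichlet_green k s t = (exp (- k * of_real \<bar>s - t\<bar>) - exp (- k * of_real (s + t))) / (2 * k)"

definition dirichlet_green_deriv :: "complex \<Rightarrow> real \<Rightarrow> real \<Rightarrow> complex" where
  "dirichlet_green_deriv k s t =
     ((if s < t then 1 else -1) * exp (- k * of_real \<bar>s - t\<bar>) + exp (- k * of_real (s + t))) / 2"

text \<open>
  The derivative of the Green function has a downward jump of height one at \<open>s = t\<close>. Adding back the
  step yields this function; the maxima make its continuity evident.
\<close>

definition dirichlet_green_deriv_cont :: "complex \<Rightarrow> real \<Rightarrow> real \<Rightarrow> complex" where
  "dirichlet_green_deriv_cont k s t = (exp (- k * of_real (max (t - s) 0)) + 1 - exp (- k * of_real (max (s - t) 0))
     + exp (- k * of_real (s + t))) / 2"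

lemma dirichlet_green_0: "0 \<le> s \<Longrightarrow> dirichlet_green k s 0 = 0" "0 \<le> t \<Longrightarrow> dirichlet_green k 0 t = 0"
  "0 \<le> s \<Longrightarrow> dirichlet_green_deriv k s 0 = 0"
  by (simp_all add: dirichlet_green_def dirichlet_green_deriv_def)

lemma dirichlet_green_deriv_jump:
  "s \<noteq> t \<Longrightarrow> dirichlet_green_deriv_cont k s t = dirichlet_green_deriv k s t + (if t \<le> s then 1 else 0)"
  by (cases s t rule: linorder_cases)
    (simp_all add: dirichlet_green_deriv_cont_def dirichlet_green_deriv_def max_def field_simps)

lemma dirichlet_green_derivative:
  assumes "s \<noteq> t" "k \<noteq> 0"
  shows "((\<lambda>s. dirichlet_green k s t) has_vector_derivative dirichlet_green_deriv k s t) (at s)"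
    and "((\<lambda>s. dirichlet_green_deriv k s t) has_vector_derivative k\<^sup>2 * dirichlet_green k s t) (at s)"
proof -
  \<comment> \<open>\<open>\<sigma>\<close> is the sign of \<open>t - s\<close>; on \<open>\<Omega>\<close> it turns the absolute value into an affine function.\<close>
  define \<sigma> :: complex where "\<sigma> = (if s < t then 1 else -1)"
  define \<Omega> where "\<Omega> = (if s < t then {..<t} else {t<..})"
  have \<Omega>: "open \<Omega>" "s \<in> \<Omega>" using assms by (auto simp: \<Omega>_def)
  have e1: "- k * of_real \<bar>r - t\<bar> = \<sigma> * k * of_real r + (- (\<sigma> * k * of_real t))" if "r \<in> \<Omega>" for r
    using that by (auto simp: \<Omega>_def \<sigma>_def abs_if algebra_simps split: if_splits)
  have e2: "- k * of_real (r + t) = (- k) * of_real r + (- (k * of_real t))" for r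
    by (simp add: algebra_simps)
  let ?E1 = "\<lambda>r. exp (\<sigma> * k * of_real r + (- (\<sigma> * k * of_real t)))"
  let ?E2 = "\<lambda>r. exp ((- k) * of_real r + (- (k * of_real t)))"
  have g: "dirichlet_green k r t = (?E1 r - ?E2 r) * (1 / (2 * k))" if "r \<in> \<Omega>" for r
    unfolding dirichlet_green_def e1[OF that] e2 by simp
  have g': "dirichlet_green_deriv k r t = (\<sigma> * ?E1 r + ?E2 r) * (1 / 2)" if "r \<in> \<Omega>" for r
  proof -
    have "(if r < t then 1 else -1) = \<sigma>" using that by (auto simp: \<sigma>_def \<Omega>_def split: if_splits)
    then show ?thesis unfolding dirichlet_green_deriv_def e1[OF that] e2 by simp
  qed
  have alg1: "(\<sigma> * k * A - (- k) * B) * (1 / (2 * k)) = (\<sigma> * A + B) * (1 / 2)" for A B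
    using assms(2) by (simp add: field_simps)
  have alg2: "(\<sigma> * (\<sigma> * k * A) + (- k) * B) * (1 / 2) = k\<^sup>2 * ((A - B) * (1 / (2 * k)))" for A B
  proof -
    have "\<sigma> * (\<sigma> * k * A) = k * A" by (simp add: \<sigma>_def)
    then show ?thesis using assms(2) by (simp add: field_simps power2_eq_square)
  qed
  have "((\<lambda>r. (?E1 r - ?E2 r) * (1 / (2 * k))) has_vector_derivative (\<sigma> * k * ?E1 s - (- k) * ?E2 s) * (1 / (2 * k))) (at s)"
    by (intro has_vector_derivative_mult_left has_vector_derivative_diff exp_affine_derivative)
  moreover have "(\<sigma> * k * ?E1 s - (- k) * ?E2 s) * (1 / (2 * k)) = dirichlet_green_deriv k s t"
    unfolding g'[OF \<Omega>(2)] by (rule alg1)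
  ultimately show "((\<lambda>s. dirichlet_green k s t) has_vector_derivative dirichlet_green_deriv k s t) (at s)"
    by (auto intro!: has_vector_derivative_transform_within_open[OF _ \<Omega> g[symmetric]])
  have "((\<lambda>r. (\<sigma> * ?E1 r + ?E2 r) * (1 / 2)) has_vector_derivative (\<sigma> * (\<sigma> * k * ?E1 s) + (- k) * ?E2 s) * (1 / 2)) (at s)"
    by (intro has_vector_derivative_mult_left has_vector_derivative_mult_right has_vector_derivative_add exp_affine_derivative)
  moreover have "(\<sigma> * (\<sigma> * k * ?E1 s) + (- k) * ?E2 s) * (1 / 2) = k\<^sup>2 * dirichlet_green k s t"
    unfolding g[OF \<Omega>(2)] by (rule alg2)
  ultimately show "((\<lambda>s. dirichlet_green_deriv k s t) has_vector_derivative k\<^sup>2 * dirichlet_green k s t) (at s)"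
    by (auto intro!: has_vector_derivative_transform_within_open[OF _ \<Omega> g'[symmetric]])
qed

lemma cmod_exp_le:
  assumes "a \<le> Re k" "0 \<le> r" "r' \<le> r" "0 \<le> a" shows "cmod (exp (- k * of_real r)) \<le> exp (- a * r')"
proof -
  have "a * r' \<le> Re k * r"
    using assms by (meson mult_left_mono mult_right_mono order_trans)
  then show ?thesis by simp
qed

lemma dirichlet_green_bounds:
  assumes "0 \<le> s" "0 \<le> t" "0 < a" "a \<le> Re k"
  shows "cmod (dirichlet_green k s t) \<le> 1 / cmod k * exp (- a * \<bar>s - t\<bar>)"
    and "cmod (dirichlet_green_deriv k s t) \<le> exp (- a * \<bar>s - t\<bar>)"
proof -
  have k: "cmod k > 0" using assms by auto
  have E: "cmod (exp (- k * of_real \<bar>s - t\<bar>)) \<le> exp (- a * \<bar>s - t\<bar>)"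
    "cmod (exp (- k * of_real (s + t))) \<le> exp (- a * \<bar>s - t\<bar>)"
    using assms by (intro cmod_exp_le; simp)+
  have "cmod (dirichlet_green k s t) = cmod (exp (- k * of_real \<bar>s - t\<bar>) - exp (- k * of_real (s + t))) / (2 * cmod k)"
    by (simp add: dirichlet_green_def norm_divide norm_mult)
  also have "\<dots> \<le> (exp (- a * \<bar>s - t\<bar>) + exp (- a * \<bar>s - t\<bar>)) / (2 * cmod k)"
    by (rule divide_right_mono[OF order_trans[OF norm_triangle_ineq4 add_mono[OF E]]]) simp
  finally show "cmod (dirichlet_green k s t) \<le> 1 / cmod k * exp (- a * \<bar>s - t\<bar>)" by simp
  have E1': "cmod ((if s < t then 1 else -1) * exp (- k * of_real \<bar>s - t\<bar>)) \<le> exp (- a * \<bar>s - t\<bar>)"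
    using E(1) by (cases "s < t") (simp_all only: if_True if_False mult_1 mult_minus1 norm_minus_cancel)
  have "cmod (dirichlet_green_deriv k s t) =
      cmod ((if s < t then 1 else -1) * exp (- k * of_real \<bar>s - t\<bar>) + exp (- k * of_real (s + t))) / 2"
    by (simp only: dirichlet_green_deriv_def norm_divide) simp
  also have "\<dots> \<le> (exp (- a * \<bar>s - t\<bar>) + exp (- a * \<bar>s - t\<bar>)) / 2"
    by (rule divide_right_mono[OF order_trans[OF norm_triangle_ineq add_mono[OF E1' E(2)]]]) simp
  finally show "cmod (dirichlet_green_deriv k s t) \<le> exp (- a * \<bar>s - t\<bar>)" by simp
qed

lemma exp_kernel_add:
  assumes "exp_kernel a C K" "exp_kernel a C' K'"
  shows "exp_kernel a (C + C') (\<lambda>x y. K x y + K' x y)"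
  unfolding exp_kernel_def
proof (intro conjI allI)
  have [measurable]: "(\<lambda>(x, y). K x y) \<in> borel_measurable (borel \<Otimes>\<^sub>M borel)"
    "(\<lambda>(x, y). K' x y) \<in> borel_measurable (borel \<Otimes>\<^sub>M borel)"
    using assms by (auto simp: exp_kernel_def)
  show "(\<lambda>(x, y). K x y + K' x y) \<in> borel_measurable (borel \<Otimes>\<^sub>M borel)" by measurable
  show "cmod (K x y + K' x y) \<le> (C + C') * exp (- a * \<bar>x - y\<bar>)" for x y
    using norm_triangle_le[OF add_mono[OF exp_kernel_bound[OF assms(1)] exp_kernel_bound[OF assms(2)]], of x y x y]
    by (simp add: distrib_right)
qed

lemma exp_kernel_mult:
  assumes K: "exp_kernel a C K" and m: "m \<in> borel_measurable borel" "\<And>x. cmod (m x) \<le> B"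
  shows "exp_kernel a (B * C) (\<lambda>x y. m x * K x y)"
  unfolding exp_kernel_def
proof (intro conjI allI)
  have [measurable]: "(\<lambda>(x, y). K x y) \<in> borel_measurable (borel \<Otimes>\<^sub>M borel)" "m \<in> borel_measurable borel"
    using assms by (auto simp: exp_kernel_def)
  show "(\<lambda>(x, y). m x * K x y) \<in> borel_measurable (borel \<Otimes>\<^sub>M borel)" by measurable
  have "0 \<le> B" using order_trans[OF norm_ge_zero m(2)] .
  then show "cmod (m x * K x y) \<le> (B * C) * exp (- a * \<bar>x - y\<bar>)" for x y
    using mult_mono[OF m(2)[of x] exp_kernel_bound[OF K, of x y]] by (simp add: norm_mult mult.assoc)
qed

lemma exp_kernel_mult_integrable:
  assumes a: "a > 0" and K: "exp_kernel a C K" and \<phi>: "integrable lborel (\<phi> :: real \<Rightarrow> complex)"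
  shows "integrable lborel (\<lambda>x. K x y * \<phi> x)"
proof (rule Bochner_Integration.integrable_bound[OF integrable_mult_right[OF integrable_norm[OF \<phi>], of C]])
  have [measurable]: "(\<lambda>x. K x y) \<in> borel_measurable borel" "\<phi> \<in> borel_measurable borel"
    using exp_kernel_measurable[OF K] borel_measurable_integrable[OF \<phi>] by auto
  show "(\<lambda>x. K x y * \<phi> x) \<in> borel_measurable lborel" by measurable
  show "AE x in lborel. norm (K x y * \<phi> x) \<le> norm (C * norm (\<phi> x))"
  proof (intro AE_I2)
    fix x
    have "C * exp (- a * \<bar>x - y\<bar>) \<le> C * 1"
      using a exp_kernel_nonneg[OF K] by (intro mult_left_mono) auto
    then have "cmod (K x y) \<le> C" using exp_kernel_bound[OF K, of x y] by linarith
    from mult_right_mono[OF this, of "cmod (\<phi> x)"]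
    show "norm (K x y * \<phi> x) \<le> norm (C * norm (\<phi> x))"
      using exp_kernel_nonneg[OF K] by (simp add: norm_mult)
  qed
qed

text \<open>
  Finitely many points without derivative do no harm as long as the product with the test function is
  continuous.
\<close>

lemma integration_by_parts_test_function:
  assumes S: "finite S" and H: "\<And>x. x \<notin> S \<Longrightarrow> (H has_vector_derivative H' x) (at x)"
    and \<phi>: "\<phi> \<in> test_functions \<Omega>" and cont: "continuous_on UNIV (\<lambda>x. H x * complex_of_real (\<phi> x))"
    and i1: "integrable lborel (\<lambda>x. H x * complex_of_real (deriv \<phi> x))"
    and i2: "integrable lborel (\<lambda>x. H' x * complex_of_real (\<phi> x))"
  shows "pairing H (deriv \<phi>) = - pairing H' \<phi>"
proof -
  obtain N where N: "N > 0" "\<And>x. x \<notin> {-N..N} \<Longrightarrow> \<phi> x = 0" "\<And>x. x \<notin> {-N..N} \<Longrightarrow> deriv \<phi> x = 0"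
    using test_function_boundE[OF \<phi>] by blast
  let ?F = "\<lambda>x. H x * of_real (\<phi> x)" and ?f = "\<lambda>x. H x * of_real (deriv \<phi> x) + H' x * of_real (\<phi> x)"
  have "(?f has_integral (?F (N + 1) - ?F (- N - 1))) {- N - 1..N + 1}"
  proof (rule fundamental_theorem_of_calculus_interior_strong[OF S])
    show "- N - 1 \<le> N + 1" using N by simp
    show "(?F has_vector_derivative ?f x) (at x)" if "x \<in> {- N - 1<..<N + 1} - S" for x
    proof (rule has_vector_derivative_mult)
      show "(H has_vector_derivative H' x) (at x)" using H that by simp
      show "((\<lambda>x. complex_of_real (\<phi> x)) has_vector_derivative complex_of_real (deriv \<phi> x)) (at x)"
        using test_function_DERIV[OF \<phi>, of x]
        by (auto intro!: has_vector_derivative_of_real simp: has_real_derivative_iff_has_vector_derivative)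
    qed
    show "continuous_on {- N - 1..N + 1} ?F" using cont continuous_on_subset by blast
  qed
  then have "(?f has_integral 0) {- N - 1..N + 1}" using N by simp
  then have "(?f has_integral 0) UNIV"
    by (rule has_integral_on_superset) (use N(2,3) in auto)
  moreover have "(?f has_integral (LINT x|lborel. ?f x)) UNIV"
    using i1 i2 by (intro has_integral_integral_lborel Bochner_Integration.integrable_add)
  ultimately have "(LINT x|lborel. ?f x) = 0" using has_integral_unique by blast
  then show ?thesis using i1 i2 by (simp add: add_eq_0_iff2)
qed

lemma continuous_mult_test_function:
  assumes \<phi>: "\<phi> \<in> test_functions \<Omega>" and "open \<Omega>" and H: "continuous_on \<Omega> H"
  shows "continuous_on UNIV (\<lambda>x. H x * complex_of_real (\<phi> x))"
proof -
  let ?K = "closure {x. \<phi> x \<noteq> 0}"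
  have "continuous_on \<Omega> (\<lambda>x. H x * complex_of_real (\<phi> x))"
    by (intro continuous_on_mult H test_function_continuous[OF \<phi>])
  moreover have "continuous_on (- ?K) (\<lambda>x. H x * complex_of_real (\<phi> x))"
    by (rule continuous_on_eq[of _ "\<lambda>_. 0"]) (use closure_subset[of "{x. \<phi> x \<noteq> 0}"] in auto)
  ultimately have "continuous_on (\<Omega> \<union> - ?K) (\<lambda>x. H x * complex_of_real (\<phi> x))"
    using \<open>open \<Omega>\<close> by (intro continuous_on_open_Un) auto
  moreover have "\<Omega> \<union> - ?K = UNIV" using \<phi> by (auto simp: test_functions_iff)
  ultimately show ?thesis by simp
qed

section \<open>The Green function of the point interaction\<close>

text \<open>
  In the application \<open>kp\<close> and \<open>km\<close> are square roots of \<open>V\<^sub>+ - z\<close> and \<open>V\<^sub>- - z\<close>, and \<open>w = \<alpha> + kp + km\<close>.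
\<close>

locale step_green =
  fixes kp km w :: complex
  assumes kp: "Re kp > 0" and km: "Re km > 0" and w: "w \<noteq> 0"
begin

abbreviation "k_squared \<equiv> step_potential (kp\<^sup>2) (km\<^sup>2)"

definition rate :: real where "rate = min (Re kp) (Re km)"

text \<open>
  The solution of \<open>u'' = k_squared u\<close> off the origin that is continuous, decays at both ends and has
  value \<open>1\<close> at \<open>0\<close>. Positive and negative parts are used instead of a case distinction so that continuity
  and measurability are immediate.
\<close>

definition psi :: "real \<Rightarrow> complex" where
  "psi x = exp (- kp * of_real (max x 0) - km * of_real (max (- x) 0))"

definition psi_deriv :: "real \<Rightarrow> complex" where
  "psi_deriv x = (if 0 < x then - kp else km) * psi x"

text \<open>
  The half-line Green functions vanish as soon as one argument is \<open>0\<close>, so the sum decouples the two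
  half-lines: it vanishes unless \<open>x\<close> and \<open>y\<close> lie on the same side of the origin.
\<close>

definition dirichlet_kernel :: "real \<Rightarrow> real \<Rightarrow> complex" where
  "dirichlet_kernel x y =
     dirichlet_green kp (max x 0) (max y 0) + dirichlet_green km (max (- x) 0) (max (- y) 0)"

definition dirichlet_kernel_deriv :: "real \<Rightarrow> real \<Rightarrow> complex" where
  "dirichlet_kernel_deriv x y = (if 0 < x then dirichlet_green_deriv kp x (max y 0)
     else - dirichlet_green_deriv km (- x) (max (- y) 0))"

text \<open>
  The resolvent kernel. The rank-one term carries the point interaction: its coefficient is forced by
  the jump condition at the origin, see \<open>trace_jump\<close> below.
\<close>

definition green :: "real \<Rightarrow> real \<Rightarrow> complex" where
  "green x y = dirichlet_kernel x y + psi x * (psi y / w)"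

definition green_deriv :: "real \<Rightarrow> real \<Rightarrow> complex" where
  "green_deriv x y = dirichlet_kernel_deriv x y + psi_deriv x * (psi y / w)"

lemma rate_pos: "0 < rate" using kp km by (simp add: rate_def)
lemma rate_le: "rate \<le> Re kp" "rate \<le> Re km" by (simp_all add: rate_def)
lemma k_nonzero: "kp \<noteq> 0" "km \<noteq> 0" using kp km by auto

lemma psi_pos: "0 \<le> x \<Longrightarrow> psi x = exp (- kp * of_real x)" and psi_neg: "x \<le> 0 \<Longrightarrow> psi x = exp (km * of_real x)"
  by (simp_all add: psi_def max_def)

lemma psi_bound: "cmod (psi x) \<le> exp (- rate * \<bar>x\<bar>)"
  using cmod_exp_le[of rate kp "x" "\<bar>x\<bar>"] cmod_exp_le[of rate km "- x" "\<bar>x\<bar>"] rate_pos rate_le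
  by (cases "0 \<le> x") (simp_all add: psi_pos psi_neg)

lemma psi_continuous: "continuous_on A psi"
  unfolding psi_def[abs_def] by (intro continuous_intros)

lemma psi_measurable[measurable]: "psi \<in> borel_measurable borel"
  by (rule borel_measurable_continuous_onI[OF psi_continuous])

lemma psi_derivative: "x \<noteq> 0 \<Longrightarrow> (psi has_vector_derivative psi_deriv x) (at x)"
proof (cases "0 < x")
  case True
  have "(psi has_vector_derivative - kp * exp (- kp * of_real x + 0)) (at x)"
    by (rule has_vector_derivative_transform_within_open[OF exp_affine_derivative, of "{0<..}"])
      (use True in \<open>auto simp: psi_pos\<close>)
  then show ?thesis using True by (simp add: psi_deriv_def psi_pos)
next
  case False
  assume "x \<noteq> 0"
  with False have x: "x < 0" by simp
  have "(psi has_vector_derivative km * exp (km * of_real x + 0)) (at x)"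
    by (rule has_vector_derivative_transform_within_open[OF exp_affine_derivative, of "{..<0}"])
      (use x in \<open>auto simp: psi_neg\<close>)
  then show ?thesis using x by (simp add: psi_deriv_def psi_neg)
qed

lemma psi_deriv_derivative:
  assumes "x \<noteq> 0"
  shows "(psi_deriv has_vector_derivative k_squared x * psi x) (at x)"
proof -
  define c where "c = (if 0 < x then - kp else km)"
  define \<Omega> where "\<Omega> = (if 0 < x then {0<..} else {..<0::real})"
  have "((\<lambda>x. c * psi x) has_vector_derivative c * psi_deriv x) (at x)"
    by (intro has_vector_derivative_mult_right psi_derivative assms)
  then have "(psi_deriv has_vector_derivative c * psi_deriv x) (at x)"
    by (rule has_vector_derivative_transform_within_open[of _ _ _ \<Omega>])
      (use assms in \<open>auto simp: \<Omega>_def c_def psi_deriv_def split: if_splits\<close>)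
  moreover have "c * psi_deriv x = k_squared x * psi x"
    using assms by (simp add: c_def psi_deriv_def step_potential_def power2_eq_square)
  ultimately show ?thesis by simp
qed

lemma exp_kernel_psi: "exp_kernel rate (1 / cmod w) (\<lambda>x y. psi x * (psi y / w))"
  unfolding exp_kernel_def
proof (intro conjI allI)
  show "(\<lambda>(x, y). psi x * (psi y / w)) \<in> borel_measurable (borel \<Otimes>\<^sub>M borel)" by measurable
  fix x y :: real
  have "cmod (psi x) * cmod (psi y) \<le> exp (- rate * \<bar>x\<bar>) * exp (- rate * \<bar>y\<bar>)"
    by (intro mult_mono psi_bound) auto
  also have "\<dots> = exp (- rate * (\<bar>x\<bar> + \<bar>y\<bar>))" by (simp add: exp_add[symmetric] algebra_simps)
  also have "\<dots> \<le> exp (- rate * \<bar>x - y\<bar>)"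
    using rate_pos by (simp add: abs_triangle_ineq4)
  finally show "cmod (psi x * (psi y / w)) \<le> 1 / cmod w * exp (- rate * \<bar>x - y\<bar>)"
    by (simp add: norm_mult norm_divide divide_right_mono)
qed

text \<open>
  The constant is what makes the Dirichlet part negligible: with Schur's test it gives a norm of at most
  \<open>2 / (min |kp| |km| * rate)\<close>, where the large modulus of \<open>kp\<close> and \<open>km\<close> compensates the small \<open>rate\<close>.
\<close>

lemma exp_kernel_dirichlet: "exp_kernel rate (1 / min (cmod kp) (cmod km)) dirichlet_kernel"
  unfolding exp_kernel_def
proof (intro conjI allI)
  show "(\<lambda>(x, y). dirichlet_kernel x y) \<in> borel_measurable (borel \<Otimes>\<^sub>M borel)"
    unfolding dirichlet_kernel_def dirichlet_green_def by measurable
  fix x y :: real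
  let ?m = "min (cmod kp) (cmod km)"
  have m: "0 < ?m" "1 / cmod kp \<le> 1 / ?m" "1 / cmod km \<le> 1 / ?m"
    using k_nonzero by (auto intro!: divide_left_mono simp: min_def)
  consider "0 \<le> x" "0 \<le> y" | "x \<le> 0" "y \<le> 0" | "0 \<le> x" "y \<le> 0" | "x \<le> 0" "0 \<le> y"
    using linear[of 0 x] linear[of 0 y] by blast
  then show "cmod (dirichlet_kernel x y) \<le> 1 / ?m * exp (- rate * \<bar>x - y\<bar>)"
  proof cases
    case 1
    then have "cmod (dirichlet_kernel x y) \<le> 1 / cmod kp * exp (- rate * \<bar>x - y\<bar>)"
      using dirichlet_green_bounds(1)[of x y rate kp] rate_pos rate_le
      by (simp add: dirichlet_kernel_def dirichlet_green_0)
    also have "\<dots> \<le> 1 / ?m * exp (- rate * \<bar>x - y\<bar>)" by (intro mult_right_mono m) simp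
    finally show ?thesis .
  next
    case 2
    then have "cmod (dirichlet_kernel x y) \<le> 1 / cmod km * exp (- rate * \<bar>(- x) - (- y)\<bar>)"
      using dirichlet_green_bounds(1)[of "- x" "- y" rate km] rate_pos rate_le
      by (simp add: dirichlet_kernel_def dirichlet_green_0)
    also have "\<dots> \<le> 1 / ?m * exp (- rate * \<bar>(- x) - (- y)\<bar>)" by (intro mult_right_mono m) simp
    also have "\<bar>(- x) - (- y)\<bar> = \<bar>x - y\<bar>" by simp
    finally show ?thesis .
  qed (use m in \<open>simp_all add: dirichlet_kernel_def dirichlet_green_0\<close>)
qed

lemma exp_kernel_dirichlet_deriv: "exp_kernel rate 1 dirichlet_kernel_deriv"
  unfolding exp_kernel_def
proof (intro conjI allI)
  show "(\<lambda>(x, y). dirichlet_kernel_deriv x y) \<in> borel_measurable (borel \<Otimes>\<^sub>M borel)"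
    unfolding dirichlet_kernel_deriv_def dirichlet_green_deriv_def by measurable
  fix x y :: real
  consider "0 < x" "0 \<le> y" | "x \<le> 0" "y \<le> 0" | "0 < x" "y \<le> 0" | "x \<le> 0" "0 \<le> y"
    using not_less[of 0 x] linear[of 0 y] by blast
  then show "cmod (dirichlet_kernel_deriv x y) \<le> 1 * exp (- rate * \<bar>x - y\<bar>)"
  proof cases
    case 1
    then show ?thesis
      using dirichlet_green_bounds(2)[of x y rate kp] rate_pos rate_le
      by (simp add: dirichlet_kernel_deriv_def)
  next
    case 2
    then have "cmod (dirichlet_kernel_deriv x y) \<le> exp (- rate * \<bar>(- x) - (- y)\<bar>)"
      using dirichlet_green_bounds(2)[of "- x" "- y" rate km] rate_pos rate_le
      by (simp add: dirichlet_kernel_deriv_def)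
    also have "\<bar>(- x) - (- y)\<bar> = \<bar>x - y\<bar>" by simp
    finally show ?thesis by simp
  qed (simp_all add: dirichlet_kernel_deriv_def dirichlet_green_0)
qed

lemma exp_kernel_green: "exp_kernel rate (1 / min (cmod kp) (cmod km) + 1 / cmod w) green"
  unfolding green_def[abs_def] by (intro exp_kernel_add exp_kernel_dirichlet exp_kernel_psi)

lemma exp_kernel_green_deriv:
  "exp_kernel rate (1 + max (cmod kp) (cmod km) * (1 / cmod w)) green_deriv"
proof -
  have "exp_kernel rate (max (cmod kp) (cmod km) * (1 / cmod w))
      (\<lambda>x y. (if 0 < x then - kp else km) * (psi x * (psi y / w)))"
  proof (rule exp_kernel_mult[OF exp_kernel_psi, where m = "\<lambda>x::real. if 0 < x then - kp else km"])
    show "(\<lambda>x::real. if 0 < x then - kp else km) \<in> borel_measurable borel" by measurable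
  qed auto
  from exp_kernel_add[OF exp_kernel_dirichlet_deriv this] show ?thesis
    by (simp add: green_deriv_def[abs_def] psi_deriv_def mult.assoc)
qed

lemma exp_kernel_green_second:
  "exp_kernel rate (max (cmod (kp\<^sup>2)) (cmod (km\<^sup>2)) * (1 / min (cmod kp) (cmod km) + 1 / cmod w))
     (\<lambda>x y. k_squared x * green x y)"
proof (rule exp_kernel_mult[OF exp_kernel_green])
  show "k_squared \<in> borel_measurable borel"
    unfolding step_potential_def[abs_def] by measurable
qed (simp add: step_potential_def)

lemma green_continuous: "continuous_on A (\<lambda>x. green x y)"
proof -
  have "continuous_on A (\<lambda>x. dirichlet_kernel x y)"
    unfolding dirichlet_kernel_def dirichlet_green_def using k_nonzero by (intro continuous_intros) auto
  then show ?thesis unfolding green_def by (intro continuous_intros psi_continuous)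
qed

lemma dirichlet_kernel_derivative:
  assumes x: "x \<noteq> 0" "x \<noteq> y"
  shows "((\<lambda>x. dirichlet_kernel x y) has_vector_derivative dirichlet_kernel_deriv x y) (at x)"
    and "((\<lambda>x. dirichlet_kernel_deriv x y) has_vector_derivative
      k_squared x * dirichlet_kernel x y) (at x)"
proof -
  have "((\<lambda>x. dirichlet_kernel x y) has_vector_derivative dirichlet_kernel_deriv x y) (at x) \<and>
    ((\<lambda>x. dirichlet_kernel_deriv x y) has_vector_derivative
      k_squared x * dirichlet_kernel x y) (at x)"
  proof (cases "0 < x")
    case True
    have D: "dirichlet_kernel r y = dirichlet_green kp r (max y 0)"
      "dirichlet_kernel_deriv r y = dirichlet_green_deriv kp r (max y 0)" if "r \<in> {0<..}" for r
      using that by (simp_all add: dirichlet_kernel_def dirichlet_kernel_deriv_def dirichlet_green_0)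
    have ne: "x \<noteq> max y 0" using x True by (simp add: max_def)
    show ?thesis
      using has_vector_derivative_transform_within_open[OF dirichlet_green_derivative(1)[OF ne k_nonzero(1)], of "{0<..}" "\<lambda>x. dirichlet_kernel x y"]
        has_vector_derivative_transform_within_open[OF dirichlet_green_derivative(2)[OF ne k_nonzero(1)], of "{0<..}" "\<lambda>x. dirichlet_kernel_deriv x y"]
        True D by (simp add: step_potential_def)
  next
    case False
    then have x0: "x < 0" using x by simp
    have D: "dirichlet_kernel r y = dirichlet_green km (- r) (max (- y) 0)"
      "dirichlet_kernel_deriv r y = - dirichlet_green_deriv km (- r) (max (- y) 0)" if "r \<in> {..<0}" for r
      using that by (simp_all add: dirichlet_kernel_def dirichlet_kernel_deriv_def dirichlet_green_0)
    have ne: "- x \<noteq> max (- y) 0" using x x0 by (simp add: max_def)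
    have m: "(uminus has_vector_derivative -1) (at x)"
      by (auto intro!: derivative_eq_intros)
    note c = vector_diff_chain_at[OF m, of "\<lambda>s. dirichlet_green km s (max (- y) 0)", OF dirichlet_green_derivative(1)[OF ne k_nonzero(2)]]
      vector_diff_chain_at[OF m, of "\<lambda>s. dirichlet_green_deriv km s (max (- y) 0)", OF dirichlet_green_derivative(2)[OF ne k_nonzero(2)], THEN has_vector_derivative_minus]
    show ?thesis
      using has_vector_derivative_transform_within_open[OF c(1), of "{..<0}" "\<lambda>x. dirichlet_kernel x y"]
        has_vector_derivative_transform_within_open[OF c(2), of "{..<0}" "\<lambda>x. dirichlet_kernel_deriv x y"]
        x0 D by (simp add: step_potential_def)
  qed
  then show "((\<lambda>x. dirichlet_kernel x y) has_vector_derivative dirichlet_kernel_deriv x y) (at x)"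
    and "((\<lambda>x. dirichlet_kernel_deriv x y) has_vector_derivative
      k_squared x * dirichlet_kernel x y) (at x)" by auto
qed

lemma green_derivative:
  assumes x: "x \<noteq> 0" "x \<noteq> y"
  shows "((\<lambda>x. green x y) has_vector_derivative green_deriv x y) (at x)"
    and "((\<lambda>x. green_deriv x y) has_vector_derivative k_squared x * green x y) (at x)"
proof -
  show "((\<lambda>x. green x y) has_vector_derivative green_deriv x y) (at x)"
    unfolding green_def green_deriv_def
    by (intro has_vector_derivative_add has_vector_derivative_mult_left dirichlet_kernel_derivative psi_derivative x)
  have "((\<lambda>x. green_deriv x y) has_vector_derivative k_squared x * dirichlet_kernel x y
      + (k_squared x * psi x) * (psi y / w)) (at x)"
    unfolding green_deriv_def
    by (intro has_vector_derivative_add has_vector_derivative_mult_left dirichlet_kernel_derivative psi_deriv_derivative x)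
  then show "((\<lambda>x. green_deriv x y) has_vector_derivative k_squared x * green x y) (at x)"
    by (simp add: green_def distrib_left mult.assoc)
qed

lemma green_integration_by_parts:
  assumes \<phi>: "\<phi> \<in> test_functions \<Omega>"
  shows "pairing (\<lambda>x. green x y) (deriv \<phi>) = - pairing (\<lambda>x. green_deriv x y) \<phi>"
proof (rule integration_by_parts_test_function[of "{0, y}"])
  have i: "integrable lborel (\<lambda>x. complex_of_real (\<phi> x))" if "\<phi> \<in> test_functions \<Omega>" for \<phi>
    using integrable_mult_test_function[OF locally_integrable_continuous that, of "\<lambda>_. 1"] by (simp add: continuous_on_const)
  show "integrable lborel (\<lambda>x. green x y * complex_of_real (deriv \<phi> x))"
    by (intro exp_kernel_mult_integrable[OF rate_pos exp_kernel_green] i test_function_deriv[OF \<phi>])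
  show "integrable lborel (\<lambda>x. green_deriv x y * complex_of_real (\<phi> x))"
    by (intro exp_kernel_mult_integrable[OF rate_pos exp_kernel_green_deriv] i \<phi>)
  show "continuous_on UNIV (\<lambda>x. green x y * complex_of_real (\<phi> x))"
    by (intro continuous_on_mult green_continuous test_function_continuous[OF \<phi>])
qed (use green_derivative(1) \<phi> in auto)

text \<open>
  Adding the step at \<open>y\<close> to \<open>green_deriv\<close> gives a function \<open>H\<close> that is continuous away from the origin, where
  the test function vanishes. Integration by parts for \<open>H\<close> gives the first term; the step itself,
  integrated against \<open>\<phi>'\<close>, gives the point evaluation at \<open>y\<close>.
\<close>

lemma green_deriv_integration_by_parts:
  assumes \<phi>: "\<phi> \<in> test_functions (UNIV - {0})"
  shows "pairing (\<lambda>x. green_deriv x y) (deriv \<phi>) =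
    - pairing (\<lambda>x. k_squared x * green x y) \<phi> + of_real (\<phi> y)"
proof -
  have o: "open (UNIV - {0::real})" by (simp add: open_delete)
  define H where "H x = (if 0 < x then dirichlet_green_deriv_cont kp x (max y 0)
     else 1 - dirichlet_green_deriv_cont km (- x) (max (- y) 0)) + psi_deriv x * (psi y / w)" for x
  have H: "H x = green_deriv x y + (if y \<le> x then 1 else 0)" if "x \<noteq> 0" "x \<noteq> y" for x
  proof (cases "0 < x")
    case True
    then have "x \<noteq> max y 0" "(max y 0 \<le> x) = (y \<le> x)" using that by (auto simp: max_def)
    then show ?thesis
      using True by (simp add: H_def green_deriv_def dirichlet_kernel_deriv_def dirichlet_green_deriv_jump)
  next
    case False
    then have "- x \<noteq> max (- y) 0" "(max (- y) 0 \<le> - x) = (\<not> y \<le> x)" using that by (auto simp: max_def)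
    then show ?thesis
      using False by (simp add: H_def green_deriv_def dirichlet_kernel_deriv_def dirichlet_green_deriv_jump)
  qed
  have contH: "continuous_on (UNIV - {0}) H"
  proof -
    have "continuous_on {0<..} H"
    proof (rule continuous_on_eq)
      show "continuous_on {0<..} (\<lambda>x. dirichlet_green_deriv_cont kp x (max y 0) + (- kp * psi x) * (psi y / w))"
        unfolding dirichlet_green_deriv_cont_def by (intro continuous_intros psi_continuous) auto
    qed (simp add: H_def psi_deriv_def)
    moreover have "continuous_on {..<0} H"
    proof (rule continuous_on_eq)
      show "continuous_on {..<0} (\<lambda>x. 1 - dirichlet_green_deriv_cont km (- x) (max (- y) 0) + (km * psi x) * (psi y / w))"
        unfolding dirichlet_green_deriv_cont_def by (intro continuous_intros psi_continuous) auto
    qed (simp add: H_def psi_deriv_def)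
    ultimately have "continuous_on ({0<..} \<union> {..<0}) H" by (intro continuous_on_open_Un) auto
    moreover have "{0<..} \<union> {..<0} = UNIV - {0::real}" by auto
    ultimately show ?thesis by simp
  qed
  have i: "integrable lborel (\<lambda>x. complex_of_real (\<phi> x))" if "\<phi> \<in> test_functions (UNIV - {0})" for \<phi>
    using integrable_mult_test_function[OF locally_integrable_continuous that, of "\<lambda>_. 1"] by (simp add: continuous_on_const)
  have iH: "integrable lborel (\<lambda>x. H x * complex_of_real (deriv \<phi> x))"
  proof -
    obtain N where "N > 0" "\<And>x. x \<notin> {-N..N} \<Longrightarrow> \<phi> x = 0"
      and N: "\<And>x. x \<notin> {-N..N} \<Longrightarrow> deriv \<phi> x = 0" using test_function_boundE[OF \<phi>] by blast
    have "integrable lborel (\<lambda>x. 1 * (H x * complex_of_real (deriv \<phi> x)))"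
    proof (rule locally_integrable_mult_compact_support[of _ _ "-N" N])
      show "continuous_on UNIV (\<lambda>x. H x * complex_of_real (deriv \<phi> x))"
        by (rule continuous_mult_test_function[OF test_function_deriv[OF \<phi>] o contH])
      show "H x * complex_of_real (deriv \<phi> x) = 0" if "x \<notin> {-N..N}" for x
        using N[OF that] by simp
    qed (rule locally_integrable_continuous, rule continuous_on_const)
    then show ?thesis by simp
  qed
  have i1: "integrable lborel (\<lambda>x. green_deriv x y * complex_of_real (deriv \<phi> x))"
    by (intro exp_kernel_mult_integrable[OF rate_pos exp_kernel_green_deriv] i test_function_deriv[OF \<phi>])
  have i2: "integrable lborel (\<lambda>x. indicator {y..} x *\<^sub>R complex_of_real (deriv \<phi> x))"
    by (intro integrable_mult_indicator i test_function_deriv[OF \<phi>]) simp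
  have "pairing H (deriv \<phi>) =
      - pairing (\<lambda>x. k_squared x * green x y) \<phi>"
  proof (rule integration_by_parts_test_function[OF _ _ \<phi> continuous_mult_test_function[OF \<phi> o contH] iH])
    show "integrable lborel (\<lambda>x. k_squared x * green x y * complex_of_real (\<phi> x))"
      by (intro exp_kernel_mult_integrable[OF rate_pos exp_kernel_green_second] i \<phi>)
    fix x assume x: "x \<notin> {0, y}"
    have "((\<lambda>x. if y \<le> x then 1 else 0 :: complex) has_vector_derivative 0) (at x)"
      by (rule has_vector_derivative_transform_within_open[OF has_vector_derivative_const[of "if y \<le> x then 1 else 0 :: complex"],
            of "if y \<le> x then {y<..} else {..<y}"]) (use x in auto)
    from has_vector_derivative_add[OF green_derivative(2) this]
    have "((\<lambda>x. green_deriv x y + (if y \<le> x then 1 else 0)) has_vector_derivative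
        k_squared x * green x y + 0) (at x)" using x by simp
    then show "(H has_vector_derivative k_squared x * green x y) (at x)"
      by (simp only: add_0_right, elim has_vector_derivative_transform_within_open[of _ _ _ "- {0, y}"])
        (use x H in auto)
  qed simp
  moreover have "pairing H (deriv \<phi>) =
      (LINT x|lborel. green_deriv x y * of_real (deriv \<phi> x) + indicator {y..} x *\<^sub>R complex_of_real (deriv \<phi> x))"
  proof (rule integral_cong_AE)
    have "AE x in lborel. x \<notin> {0, y}" by (intro AE_not_in finite_imp_null_set_lborel) simp
    then show "AE x in lborel. H x * of_real (deriv \<phi> x) =
        green_deriv x y * of_real (deriv \<phi> x) + indicator {y..} x *\<^sub>R complex_of_real (deriv \<phi> x)"
      by eventually_elim (simp add: H algebra_simps indicator_def)
  qed (use iH i1 i2 in auto)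
  moreover have "(LINT x|lborel. indicator {y..} x *\<^sub>R complex_of_real (deriv \<phi> x)) = - of_real (\<phi> y)"
  proof -
    obtain N0 where "N0 > 0" and N0: "\<And>x. x \<notin> {-N0..N0} \<Longrightarrow> \<phi> x = 0" "\<And>x. x \<notin> {-N0..N0} \<Longrightarrow> deriv \<phi> x = 0"
      using test_function_boundE[OF \<phi>] by blast
    define N where "N = max N0 \<bar>y\<bar> + 1"
    have "(LINT x|lborel. indicator {y..} x *\<^sub>R complex_of_real (deriv \<phi> x)) = (LINT x:{y..N}|lborel. complex_of_real (deriv \<phi> x))"
      unfolding set_lebesgue_integral_def
    proof (rule Bochner_Integration.integral_cong[OF refl])
      fix x
      show "indicat_real {y..} x *\<^sub>R complex_of_real (deriv \<phi> x) = indicat_real {y..N} x *\<^sub>R complex_of_real (deriv \<phi> x)"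
        using N0(2)[of x] by (cases "x \<in> {-N0..N0}") (auto simp: indicator_def N_def)
    qed
    also have "\<dots> = - of_real (\<phi> y)"
      by (rule test_function_integral_deriv[OF \<phi> N0(1)]) (auto simp: N_def)
    finally show ?thesis .
  qed
  ultimately show ?thesis using i1 i2 by (simp add: algebra_simps)
qed

lemma green_deriv_right_limit:
  assumes "y \<noteq> 0"
  shows "((\<lambda>x. green_deriv x y) \<longlongrightarrow> (if 0 < y then psi y else 0) - kp * (psi y / w)) (at_right 0)"
proof -
  have ev: "eventually (\<lambda>x. 0 < x \<and> x < \<bar>y\<bar>) (at_right 0)"
    using assms eventually_at_right_real[of 0 "\<bar>y\<bar>"] by auto
  have *: "((\<lambda>x. (exp (- kp * of_real (y - x)) + exp (- kp * of_real (x + y))) / 2) \<longlongrightarrow>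
      (exp (- kp * of_real (y - 0)) + exp (- kp * of_real (0 + y))) / 2) (at_right 0)"
    by (intro tendsto_intros) auto
  have p: "((\<lambda>x. - kp * psi x * (psi y / w)) \<longlongrightarrow> - kp * psi 0 * (psi y / w)) (at_right 0)"
    using psi_continuous[of UNIV] by (intro tendsto_intros) (simp add: continuous_on_def, metis UNIV_I filterlim_at_split)
  have "((\<lambda>x. dirichlet_kernel_deriv x y) \<longlongrightarrow> (if 0 < y then psi y else 0)) (at_right 0)"
  proof (cases "0 < y")
    case True
    then show ?thesis
      using * by (simp add: psi_pos) (erule Lim_transform_eventually, use ev in eventually_elim,
        simp add: dirichlet_kernel_deriv_def dirichlet_green_deriv_def)
  next
    case False
    show ?thesis
      using False by simp (rule Lim_transform_eventually[OF tendsto_const], use ev in eventually_elim,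
        simp add: dirichlet_kernel_deriv_def dirichlet_green_0)
  qed
  moreover have "((\<lambda>x. psi_deriv x * (psi y / w)) \<longlongrightarrow> - kp * psi 0 * (psi y / w)) (at_right 0)"
    by (rule Lim_transform_eventually[OF p], use ev in eventually_elim) (simp add: psi_deriv_def)
  ultimately have "((\<lambda>x. dirichlet_kernel_deriv x y + psi_deriv x * (psi y / w)) \<longlongrightarrow>
      (if 0 < y then psi y else 0) + - kp * psi 0 * (psi y / w)) (at_right 0)"
    by (rule tendsto_add)
  then show ?thesis by (simp add: green_deriv_def psi_pos)
qed

lemma green_deriv_left_limit:
  assumes "y \<noteq> 0"
  shows "((\<lambda>x. green_deriv x y) \<longlongrightarrow> (if y < 0 then - psi y else 0) + km * (psi y / w)) (at_left 0)"
proof -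
  have ev: "eventually (\<lambda>x. x < 0 \<and> - \<bar>y\<bar> < x) (at_left 0)"
    using assms eventually_at_left_real[of "- \<bar>y\<bar>" 0] by (auto elim: eventually_mono)
  have *: "((\<lambda>x. - ((exp (- km * of_real (x - y)) + exp (- km * of_real (- x - y))) / 2)) \<longlongrightarrow>
      - ((exp (- km * of_real (0 - y)) + exp (- km * of_real (- 0 - y))) / 2)) (at_left 0)"
    by (intro tendsto_intros) auto
  have p: "((\<lambda>x. km * psi x * (psi y / w)) \<longlongrightarrow> km * psi 0 * (psi y / w)) (at_left 0)"
    using psi_continuous[of UNIV] by (intro tendsto_intros) (simp add: continuous_on_def, metis UNIV_I filterlim_at_split)
  have "((\<lambda>x. dirichlet_kernel_deriv x y) \<longlongrightarrow> (if y < 0 then - psi y else 0)) (at_left 0)"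
  proof (cases "y < 0")
    case True
    then show ?thesis
      using * by (simp add: psi_neg) (erule Lim_transform_eventually, use ev in eventually_elim,
        simp add: dirichlet_kernel_deriv_def dirichlet_green_deriv_def)
  next
    case False
    show ?thesis
      using False by simp (rule Lim_transform_eventually[OF tendsto_const], use ev in eventually_elim,
        simp add: dirichlet_kernel_deriv_def dirichlet_green_0)
  qed
  moreover have "((\<lambda>x. psi_deriv x * (psi y / w)) \<longlongrightarrow> km * psi 0 * (psi y / w)) (at_left 0)"
    by (rule Lim_transform_eventually[OF p], use ev in eventually_elim) (simp add: psi_deriv_def)
  ultimately have "((\<lambda>x. dirichlet_kernel_deriv x y + psi_deriv x * (psi y / w)) \<longlongrightarrow>
      (if y < 0 then - psi y else 0) + km * psi 0 * (psi y / w)) (at_left 0)"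
    by (rule tendsto_add)
  then show ?thesis by (simp add: green_deriv_def psi_pos)
qed

end

section \<open>The resolvent\<close>

lemma kernel_op_cong_AE:
  assumes K: "exp_kernel a C K" and "f \<in> borel_measurable borel" "g \<in> borel_measurable borel"
    and "AE y in lborel. f y = g y"
  shows "kernel_op K f = kernel_op K g"
proof
  fix x
  have [measurable]: "(\<lambda>y. K x y) \<in> borel_measurable borel" "f \<in> borel_measurable borel" "g \<in> borel_measurable borel"
    using exp_kernel_measurable[OF K] assms by auto
  show "kernel_op K f x = kernel_op K g x"
    unfolding kernel_op_def by (rule integral_cong_AE) (use assms(4) in \<open>auto elim!: AE_mp\<close>)
qed

lemma rep_measurable[measurable]: "rep_l2 u \<in> borel_measurable borel"
  using square_integrable_rep[of u] by (simp add: square_integrable_def)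

lemma square_integrable_measurable: "square_integrable f \<Longrightarrow> f \<in> borel_measurable borel"
  by (simp add: square_integrable_def)

lemma integral_mult_cong_AE:
  fixes f g \<phi> :: "real \<Rightarrow> complex"
  assumes "f \<in> borel_measurable borel" "g \<in> borel_measurable borel" "\<phi> \<in> borel_measurable borel"
    and "AE x in lborel. f x * \<phi> x = g x * \<phi> x"
  shows "(LINT x|lborel. f x * \<phi> x) = (LINT x|lborel. g x * \<phi> x)"
  by (rule integral_cong_AE) (use assms in auto)

lemma test_function_measurable: "\<phi> \<in> test_functions \<Omega> \<Longrightarrow> (\<lambda>x. complex_of_real (\<phi> x)) \<in> borel_measurable borel"
  by (intro borel_measurable_continuous_onI test_function_continuous)

lemma has_weak_derivative_1_iff:
  assumes f: "square_integrable f" "AE x in lborel. rep_l2 u x = f x"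
    and g: "square_integrable g" "AE x in lborel. rep_l2 v x = g x"
  shows "has_weak_derivative 1 \<Omega> u v \<longleftrightarrow> (\<forall>\<phi>\<in>test_functions \<Omega>.
    pairing f (deriv \<phi>) = - pairing g \<phi>)"
proof -
  have "pairing (rep_l2 u) (deriv \<phi>) = pairing f (deriv \<phi>)"
    "pairing (rep_l2 v) \<phi> = pairing g \<phi>"
    if \<phi>: "\<phi> \<in> test_functions \<Omega>" for \<phi>
  proof -
    show "pairing (rep_l2 u) (deriv \<phi>) = pairing f (deriv \<phi>)"
      by (intro integral_mult_cong_AE rep_measurable square_integrable_measurable[OF f(1)]
          test_function_measurable[OF test_function_deriv[OF \<phi>]]) (use f(2) in \<open>auto elim!: AE_mp\<close>)
    show "pairing (rep_l2 v) \<phi> = pairing g \<phi>"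
      by (intro integral_mult_cong_AE rep_measurable square_integrable_measurable[OF g(1)]
          test_function_measurable[OF \<phi>]) (use g(2) in \<open>auto elim!: AE_mp\<close>)
  qed
  then show ?thesis by (simp add: has_weak_derivative_def)
qed

lemma has_weak_derivative_diff:
  assumes "has_weak_derivative 1 \<Omega> u v" "has_weak_derivative 1 \<Omega> u' v'"
  shows "has_weak_derivative 1 \<Omega> (u - u') (v - v')"
  unfolding has_weak_derivative_1_iff[OF square_integrable_diff[OF square_integrable_rep square_integrable_rep] rep_minus
      square_integrable_diff[OF square_integrable_rep square_integrable_rep] rep_minus]
proof
  fix \<phi> assume \<phi>: "\<phi> \<in> test_functions \<Omega>"
  note i = integrable_mult_test_function[OF locally_integrable_rep]
  show "pairing (\<lambda>x. rep_l2 u x - rep_l2 u' x) (deriv \<phi>) =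
      - pairing (\<lambda>x. rep_l2 v x - rep_l2 v' x) \<phi>"
    using i[OF \<phi>] i[OF test_function_deriv[OF \<phi>]] assms \<phi>
    by (simp add: left_diff_distrib has_weak_derivative_def)
qed

text \<open>
  The operator \<open>res\<close> defined below turns out to be the resolvent at \<open>z\<close>.
\<close>

locale step_resolvent = step_green kp km w for kp km w :: complex +
  fixes Vp Vm \<alpha> z :: complex
  assumes kp2: "kp\<^sup>2 = Vp - z" and km2: "km\<^sup>2 = Vm - z" and w_eq: "w = \<alpha> + kp + km"
begin

definition res :: "l2 \<Rightarrow> l2" where
  "res f = abs_l2 (kernel_op green (rep_l2 f))"

definition res_deriv :: "l2 \<Rightarrow> l2" where
  "res_deriv f = abs_l2 (kernel_op green_deriv (rep_l2 f))"

definition res_second_deriv :: "l2 \<Rightarrow> l2" where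
  "res_second_deriv f = abs_l2 (\<lambda>x. k_squared x * kernel_op green (rep_l2 f) x - rep_l2 f x)"

lemmas sq_green = Schur_bound(1)[OF rate_pos exp_kernel_green square_integrable_rep]
lemmas sq_green_deriv = Schur_bound(1)[OF rate_pos exp_kernel_green_deriv square_integrable_rep]

lemma sq_green_second: "square_integrable (\<lambda>x. k_squared x * kernel_op green (rep_l2 f) x - rep_l2 f x)"
  by (intro square_integrable_diff square_integrable_step_potential sq_green square_integrable_rep)

lemma rep_res: "AE x in lborel. rep_l2 (res f) x = kernel_op green (rep_l2 f) x"
  unfolding res_def by (rule rep_abs_l2[OF sq_green])
lemma rep_res_deriv: "AE x in lborel. rep_l2 (res_deriv f) x = kernel_op green_deriv (rep_l2 f) x"
  unfolding res_deriv_def by (rule rep_abs_l2[OF sq_green_deriv])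
lemma rep_res_second_deriv: "AE x in lborel. rep_l2 (res_second_deriv f) x =
    k_squared x * kernel_op green (rep_l2 f) x - rep_l2 f x"
  unfolding res_second_deriv_def by (rule rep_abs_l2[OF sq_green_second])

lemma open_punctured: "open (UNIV - {0::real})" "finite (- (UNIV - {0::real}))"
  by (auto simp: open_delete)

lemma res_weak_derivative: "has_weak_derivative 1 UNIV (res f) (res_deriv f)"
  unfolding has_weak_derivative_1_iff[OF sq_green rep_res sq_green_deriv rep_res_deriv]
proof
  fix \<phi> assume \<phi>: "\<phi> \<in> test_functions UNIV"
  show "pairing (kernel_op green (rep_l2 f)) (deriv \<phi>) =
      - pairing (kernel_op green_deriv (rep_l2 f)) \<phi>"
    using kernel_op_integration_by_parts[OF rate_pos exp_kernel_green exp_kernel_green_deriv square_integrable_rep \<phi>, of 0 f]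
      green_integration_by_parts[OF \<phi>] by simp
qed

lemma res_deriv_weak_derivative: "has_weak_derivative 1 (UNIV - {0}) (res_deriv f) (res_second_deriv f)"
  unfolding has_weak_derivative_1_iff[OF sq_green_deriv rep_res_deriv sq_green_second rep_res_second_deriv]
proof
  fix \<phi> :: "real \<Rightarrow> real" assume \<phi>: "\<phi> \<in> test_functions (UNIV - {0})"
  have k: "kernel_op (\<lambda>x y. k_squared x * green x y) (rep_l2 f) x =
      k_squared x * kernel_op green (rep_l2 f) x" for x
    unfolding kernel_op_def mult.assoc by (rule integral_mult_right_zero)
  show "pairing (kernel_op green_deriv (rep_l2 f)) (deriv \<phi>) =
      - pairing (\<lambda>x. k_squared x * kernel_op green (rep_l2 f) x - rep_l2 f x) \<phi>"
    using kernel_op_integration_by_parts[OF rate_pos exp_kernel_green_deriv exp_kernel_green_second square_integrable_rep \<phi>, of 1 f]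
      green_deriv_integration_by_parts[OF \<phi>] by (simp add: k)
qed

lemma res_second_weak_derivative: "has_weak_derivative 2 (UNIV - {0}) (res f) (res_second_deriv f)"
proof -
  have "has_weak_derivative 1 (UNIV - {0}) (res f) (res_deriv f)"
    by (rule has_weak_derivative_mono[OF res_weak_derivative]) simp
  from has_weak_derivative_Suc[OF this, of 1] show ?thesis
    using res_deriv_weak_derivative by (simp add: numeral_2_eq_2)
qed

lemma green_0: "green 0 y = psi y / w"
proof -
  have "dirichlet_kernel 0 y = 0" by (simp add: dirichlet_kernel_def dirichlet_green_0)
  then show ?thesis by (simp add: green_def psi_pos)
qed

lemma psi_mult_integrable:
  assumes "square_integrable f"
  shows "integrable lborel (\<lambda>y. psi y * f y)"
proof -
  have "integrable lborel (\<lambda>y. w * (psi 0 * (psi y / w) * f y))"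
    by (rule integrable_mult_right[OF kernel_op_integrable[OF rate_pos exp_kernel_psi assms]])
  then show ?thesis using w by (simp add: psi_pos)
qed

lemma kernel_op_green_continuous: "continuous_on A (kernel_op green (rep_l2 f))"
proof -
  have "continuous_on UNIV (kernel_op green (rep_l2 f))"
    by (rule kernel_op_continuous_on[OF rate_pos exp_kernel_green square_integrable_rep open_UNIV])
      (use green_continuous[of UNIV] in \<open>auto simp: continuous_on_eq_continuous_at\<close>)
  then show ?thesis using continuous_on_subset by blast
qed

lemma kernel_op_green_deriv_continuous: "A \<subseteq> UNIV - {0} \<Longrightarrow> continuous_on A (kernel_op green_deriv (rep_l2 f))"
proof -
  have "continuous_on (UNIV - {0}) (kernel_op green_deriv (rep_l2 f))"
  proof (rule kernel_op_continuous_on[OF rate_pos exp_kernel_green_deriv square_integrable_rep open_punctured(1)])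
    fix x :: real assume "x \<in> UNIV - {0}"
    then have "isCont (\<lambda>x. green_deriv x y) x" if "y \<noteq> x" for y
      using has_vector_derivative_continuous[OF green_derivative(2)] that by auto
    then show "AE y in lborel. isCont (\<lambda>x. green_deriv x y) x"
      using AE_lborel_singleton[of x] by (auto elim!: AE_mp)
  qed
  then show "A \<subseteq> UNIV - {0} \<Longrightarrow> ?thesis" using continuous_on_subset by blast
qed

definition right_trace :: "l2 \<Rightarrow> complex" where
  "right_trace f = (LINT y|lborel. ((if 0 < y then psi y else 0) - kp * (psi y / w)) * rep_l2 f y)"

definition left_trace :: "l2 \<Rightarrow> complex" where
  "left_trace f = (LINT y|lborel. ((if y < 0 then - psi y else 0) + km * (psi y / w)) * rep_l2 f y)"

text \<open>
  The one-sided limits of the kernel \<open>green_deriv\<close> at the origin exist for every \<open>y \<noteq> 0\<close>, and dominated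
  convergence transfers them to the operator.
\<close>

lemma right_trace: "(kernel_op green_deriv (rep_l2 f) \<longlongrightarrow> right_trace f) (at_right 0)"
  unfolding right_trace_def
proof (rule kernel_op_tendsto[OF rate_pos exp_kernel_green_deriv square_integrable_rep])
  show "(\<lambda>y. (if 0 < y then psi y else 0) - kp * (psi y / w)) \<in> borel_measurable borel" by measurable
  show "AE y in lborel. ((\<lambda>x. green_deriv x y) \<longlongrightarrow> (if 0 < y then psi y else 0) - kp * (psi y / w)) (at_right 0)"
    using AE_lborel_singleton[of 0] by eventually_elim (rule green_deriv_right_limit)
qed

lemma left_trace: "(kernel_op green_deriv (rep_l2 f) \<longlongrightarrow> left_trace f) (at_left 0)"
  unfolding left_trace_def
proof (rule kernel_op_tendsto[OF rate_pos exp_kernel_green_deriv square_integrable_rep])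
  show "(\<lambda>y. (if y < 0 then - psi y else 0) + km * (psi y / w)) \<in> borel_measurable borel" by measurable
  show "AE y in lborel. ((\<lambda>x. green_deriv x y) \<longlongrightarrow> (if y < 0 then - psi y else 0) + km * (psi y / w)) (at_left 0)"
    using AE_lborel_singleton[of 0] by eventually_elim (rule green_deriv_left_limit)
qed

text \<open>
  The Dirichlet part contributes \<open>psi y\<close> to the jump of the kernel and the rank-one part
  \<open>- (kp + km) psi y / w\<close>. With \<open>w = \<alpha> + kp + km\<close> the sum is \<open>\<alpha> psi y / w\<close>, which is \<open>\<alpha>\<close> times the kernel at
  \<open>x = 0\<close>.
\<close>

lemma trace_jump: "right_trace f - left_trace f = \<alpha> * kernel_op green (rep_l2 f) 0"
proof -
  let ?f = "rep_l2 f"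
  let ?P = "(\<lambda>y. psi y * ?f y)"
  have i: "integrable lborel ?P" by (rule psi_mult_integrable[OF square_integrable_rep])
  have r: "((if 0 < y then psi y else 0) - kp * (psi y / w)) * ?f y = indicator {0<..} y *\<^sub>R ?P y - (kp / w) * ?P y"
    and l: "((if y < 0 then - psi y else 0) + km * (psi y / w)) * ?f y = (km / w) * ?P y - indicator {..<0} y *\<^sub>R ?P y" for y
    by (auto simp: indicator_def algebra_simps)
  have ir: "integrable lborel (\<lambda>y. indicator {0<..} y *\<^sub>R ?P y - (kp / w) * ?P y)"
    and il: "integrable lborel (\<lambda>y. (km / w) * ?P y - indicator {..<0} y *\<^sub>R ?P y)"
    by (intro Bochner_Integration.integrable_diff integrable_mult_indicator integrable_mult_right i; simp)+
  have "right_trace f - left_trace f = (LINT y|lborel. (indicator {0<..} y *\<^sub>R ?P y - (kp / w) * ?P y)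
      - ((km / w) * ?P y - indicator {..<0} y *\<^sub>R ?P y))"
    unfolding right_trace_def left_trace_def r l using ir il by simp
  also have "\<dots> = (LINT y|lborel. (\<alpha> / w) * ?P y)"
  proof (rule integral_cong_AE)
    show "AE y in lborel. indicator {0<..} y *\<^sub>R ?P y - (kp / w) * ?P y - ((km / w) * ?P y - indicator {..<0} y *\<^sub>R ?P y) = (\<alpha> / w) * ?P y"
      using AE_lborel_singleton[of 0]
    proof eventually_elim
      case (elim y)
      have "indicator {0<..} y *\<^sub>R ?P y - (kp / w) * ?P y - ((km / w) * ?P y - indicator {..<0} y *\<^sub>R ?P y) =
         (1 - kp / w - km / w) * ?P y"
        using elim by (cases "0 < y") (simp_all add: algebra_simps)
      also have "1 - kp / w - km / w = \<alpha> / w"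
      proof -
        have "\<alpha> = w - kp - km" using w_eq by simp
        then show ?thesis using w by (simp only: diff_divide_distrib) simp
      qed
      finally show ?case .
    qed
  qed (use ir il i in auto)
  also have "\<dots> = \<alpha> * (LINT y|lborel. (1 / w) * ?P y)" by simp
  also have "(LINT y|lborel. (1 / w) * ?P y) = kernel_op green ?f 0" by (simp add: kernel_op_def green_0)
  finally show ?thesis .
qed

lemma res_in_dom: "res f \<in> dom_L \<alpha>"
proof -
  have w1: "has_weak_derivative 1 (UNIV - {0}) (res f) (res_deriv f)"
    by (rule has_weak_derivative_mono[OF res_weak_derivative]) simp
  have "j = 0 \<or> j = 1" if "j \<le> 1" for j :: nat using that by auto
  then have s1: "res f \<in> sobolev 1 UNIV"
    unfolding sobolev_def using has_weak_derivative_0 res_weak_derivative by blast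
  have "j = 0 \<or> j = 1 \<or> j = 2" if "j \<le> 2" for j :: nat using that by auto
  then have s2: "res f \<in> sobolev 2 (UNIV - {0})"
    unfolding sobolev_def using has_weak_derivative_0 w1 res_second_weak_derivative by blast
  have wd: "weak_derivative 1 (UNIV - {0}) (res f) = res_deriv f"
    by (rule weak_derivative_eq[OF open_punctured w1])
  have "right_value (res_deriv f) 0 = right_trace f"
    by (rule right_value_eq[OF kernel_op_green_deriv_continuous _ right_trace])
      (use rep_res_deriv[of f] in \<open>auto elim!: AE_mp\<close>)
  moreover have "left_value (res_deriv f) 0 = left_trace f"
    by (rule left_value_eq[OF kernel_op_green_deriv_continuous _ left_trace])
      (use rep_res_deriv[of f] in \<open>auto elim!: AE_mp\<close>)
  moreover have "point_value (res f) 0 = kernel_op green (rep_l2 f) 0"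
    by (rule point_value_eq[OF kernel_op_green_continuous]) (use rep_res[of f] in \<open>auto elim!: AE_mp\<close>)
  ultimately show ?thesis
    using s1 s2 trace_jump[of f] by (simp add: dom_L_def wd del: One_nat_def)
qed

lemma step_shift: "k_squared x = step_potential Vp Vm x - z"
  by (simp add: step_potential_def kp2 km2)

lemma op_res: "op_L Vp Vm (res f) - z *\<^sub>C res f = f"
proof (rule l2_eqI)
  have "weak_derivative 2 (UNIV - {0}) (res f) = res_second_deriv f"
    by (rule weak_derivative_eq[OF open_punctured res_second_weak_derivative])
  then have op: "op_L Vp Vm (res f) = - res_second_deriv f + mult_step_potential Vp Vm (res f)"
    by (simp add: op_L_def)
  show "AE x in lborel. rep_l2 (op_L Vp Vm (res f) - z *\<^sub>C res f) x = rep_l2 f x"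
    unfolding op
    using rep_minus[of "- res_second_deriv f + mult_step_potential Vp Vm (res f)" "z *\<^sub>C res f"]
      rep_plus[of "- res_second_deriv f" "mult_step_potential Vp Vm (res f)"] rep_uminus[of "res_second_deriv f"]
      rep_mult_step_potential[of Vp Vm "res f"] rep_scaleC[of z "res f"] rep_res[of f] rep_res_second_deriv[of f]
    by eventually_elim (simp add: step_shift algebra_simps)
qed

lemma psi_square_integral:
  "has_bochner_integral lborel (\<lambda>x. (cmod (psi x))\<^sup>2) (1 / (2 * Re kp) + 1 / (2 * Re km))"
proof -
  have h: "has_bochner_integral lborel (\<lambda>x. indicator {0..} x *\<^sub>R exp (- (2 * Re kp) * x)) (1 / (2 * Re kp))"
    "has_bochner_integral lborel (\<lambda>x. indicator {0..} x *\<^sub>R exp (- (2 * Re km) * x)) (1 / (2 * Re km))"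
    using kp km by (intro has_bochner_integral_exp_half_line; simp)+
  have "has_bochner_integral lborel (\<lambda>x. indicator {0..} (0 + (-1) * x) *\<^sub>R exp (- (2 * Re km) * (0 + (-1) * x)))
     ((1 / (2 * Re km)) /\<^sub>R \<bar>-1\<bar>)"
    by (rule lborel_has_bochner_integral_real_affine_iff[THEN iffD1, OF _ h(2)]) simp
  from has_bochner_integral_add[OF h(1) this]
  have hb: "has_bochner_integral lborel (\<lambda>x. indicator {0..} x *\<^sub>R exp (- (2 * Re kp) * x) +
      indicator {0..} (- x) *\<^sub>R exp (2 * Re km * x)) (1 / (2 * Re kp) + 1 / (2 * Re km))" by simp
  show ?thesis
  proof (rule has_bochner_integralI_AE[OF hb])
    show "AE x in lborel. indicator {0..} x *\<^sub>R exp (- (2 * Re kp) * x) + indicator {0..} (- x) *\<^sub>R exp (2 * Re km * x)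
        = (cmod (psi x))\<^sup>2"
      using AE_lborel_singleton[of 0]
    proof eventually_elim
      case (elim x)
      have e: "(exp t)\<^sup>2 = exp (2 * t)" for t :: real by (simp add: power2_eq_square exp_add[symmetric])
      show ?case
        using elim by (cases "0 < x") (simp_all add: psi_pos psi_neg e indicator_def)
    qed
  qed measurable
qed

lemma psi_square_integrable: "square_integrable psi"
  using psi_square_integral by (simp add: square_integrable_def has_bochner_integral_iff)

lemma psi_deriv_square_integrable: "square_integrable psi_deriv"
  unfolding psi_deriv_def[abs_def]
  by (rule square_integrable_bounded_mult[OF psi_square_integrable, of _ "max (cmod kp) (cmod km)"]) auto

lemma psi_integration_by_parts:
  assumes \<phi>: "\<phi> \<in> test_functions \<Omega>"
  shows "pairing psi (deriv \<phi>) = - pairing psi_deriv \<phi>"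
  by (rule integration_by_parts_test_function[of "{0}", OF _ psi_derivative \<phi>])
    (use integrable_mult_test_function[OF locally_integrable_square_integrable[OF psi_deriv_square_integrable] \<phi>]
      integrable_mult_test_function[OF locally_integrable_square_integrable[OF psi_square_integrable] test_function_deriv[OF \<phi>]]
      in \<open>auto intro!: continuous_on_mult psi_continuous test_function_continuous[OF \<phi>]\<close>)

text \<open>
  On each half-line a square-integrable weak solution is a multiple of the decaying exponential. Having
  a weak derivative across the origin makes it continuous there, so the two multiples agree.
\<close>

lemma homogeneous_weak_solution:
  assumes d: "has_weak_derivative 1 UNIV d d1" and d1: "has_weak_derivative 1 (UNIV - {0}) d1 d2"
    and d2: "AE x in lborel. rep_l2 d2 x = k_squared x * rep_l2 d x"
  shows "\<exists>B. (AE x in lborel. rep_l2 d x = B * psi x) \<and> (AE x in lborel. rep_l2 d1 x = B * psi_deriv x)"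
proof -
  have D1: "pairing (rep_l2 d) (deriv \<phi>) = - pairing (rep_l2 d1) \<phi>"
    if "\<phi> \<in> test_functions \<Omega>" for \<phi> \<Omega>
    using d test_function_UNIV[OF that] by (simp add: has_weak_derivative_def)
  have D2: "pairing (rep_l2 d1) (deriv \<phi>) = - pairing (\<lambda>x. c\<^sup>2 * rep_l2 d x) \<phi>"
    if \<phi>: "\<phi> \<in> test_functions \<Omega>" and \<Omega>: "\<Omega> \<subseteq> UNIV - {0}"
      "\<And>x. x \<in> \<Omega> \<Longrightarrow> k_squared x = c\<^sup>2" for \<phi> \<Omega> c
  proof -
    have "\<phi> \<in> test_functions (UNIV - {0})" using \<phi> \<Omega>(1) test_functions_mono by blast
    then have "pairing (rep_l2 d1) (deriv \<phi>) = - pairing (rep_l2 d2) \<phi>"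
      using d1 by (simp add: has_weak_derivative_def)
    also have "pairing (rep_l2 d2) \<phi> = pairing (\<lambda>x. c\<^sup>2 * rep_l2 d x) \<phi>"
    proof (rule integral_mult_cong_AE)
      have z: "\<phi> x = 0" if "x \<notin> \<Omega>" for x
        using \<phi> that closure_subset[of "{x. \<phi> x \<noteq> 0}"] by (auto simp: test_functions_iff)
      show "AE x in lborel. rep_l2 d2 x * of_real (\<phi> x) = c\<^sup>2 * rep_l2 d x * of_real (\<phi> x)"
        using d2
      proof eventually_elim
        case (elim x)
        then show ?case using \<Omega>(2)[of x] z[of x] by (cases "x \<in> \<Omega>") simp_all
      qed
    qed (use test_function_measurable[OF \<phi>] in measurable)
    finally show ?thesis .
  qed
  obtain U where U: "primitive_on UNIV U (rep_l2 d1)" "AE x in lborel. x \<in> UNIV \<longrightarrow> rep_l2 d x = U x"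
    using weak_derivative_primitive[OF locally_integrable_rep locally_integrable_rep open_UNIV is_interval_univ D1[where \<Omega> = UNIV]] by blast
  have cU: "continuous_on A U" for A
    using primitive_continuous[OF locally_integrable_rep U(1)] continuous_on_subset by blast
  have "\<exists>A B. AE x in lborel. x \<in> {0<..} \<longrightarrow> rep_l2 d x = A * exp (kp * of_real x) + B * exp (- kp * of_real x)"
    by (rule weak_solution_exponential[OF locally_integrable_rep locally_integrable_rep open_greaterThan
          is_interval_convex_1[THEN iffD2, OF convex_real_interval(3)] k_nonzero(1) D1 D2]) (auto simp: step_potential_def)
  then obtain A1 B1 where r: "AE x in lborel. 0 < x \<longrightarrow> rep_l2 d x = A1 * exp (kp * of_real x) + B1 * exp (- kp * of_real x)"
    by (auto simp: greaterThan_iff)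
  have "\<exists>A B. AE x in lborel. x \<in> {..<0} \<longrightarrow> rep_l2 d x = A * exp (km * of_real x) + B * exp (- km * of_real x)"
    by (rule weak_solution_exponential[OF locally_integrable_rep locally_integrable_rep open_lessThan
          is_interval_convex_1[THEN iffD2, OF convex_real_interval(4)] k_nonzero(2) D1 D2]) (auto simp: step_potential_def)
  then obtain A2 B2 where l: "AE x in lborel. x < 0 \<longrightarrow> rep_l2 d x = A2 * exp (km * of_real x) + B2 * exp (- km * of_real x)"
    by (auto simp: lessThan_iff)
  have A1: "A1 = 0" by (rule exponential_growth_not_square_integrable(1)[OF square_integrable_rep kp r])
  have B2: "B2 = 0" by (rule exponential_growth_not_square_integrable(2)[OF square_integrable_rep km l])
  have Ur: "U x = B1 * psi x" if "x \<in> {0<..}" for x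
  proof (rule continuous_AE_eq[OF open_greaterThan cU _ _ that])
    show "continuous_on {0<..} (\<lambda>x. B1 * psi x)" by (intro continuous_intros psi_continuous)
    show "AE x in lborel. x \<in> {0<..} \<longrightarrow> U x = B1 * psi x"
      using U(2) r by eventually_elim (auto simp: A1 psi_pos)
  qed
  have Ul: "U x = A2 * psi x" if "x \<in> {..<0}" for x
  proof (rule continuous_AE_eq[OF open_lessThan cU _ _ that])
    show "continuous_on {..<0} (\<lambda>x. A2 * psi x)" by (intro continuous_intros psi_continuous)
    show "AE x in lborel. x \<in> {..<0} \<longrightarrow> U x = A2 * psi x"
      using U(2) l by eventually_elim (auto simp: B2 psi_neg)
  qed
  have lim: "(F \<longlongrightarrow> F 0) (at 0)" if "continuous_on UNIV F" for F :: "real \<Rightarrow> complex"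
    using that by (simp add: continuous_on_def)
  have "((\<lambda>x. B1 * psi x) \<longlongrightarrow> U 0) (at_right 0)"
    by (rule Lim_transform_eventually[OF tendsto_mono[OF at_le lim[OF cU]]])
      (auto simp: eventually_at_filter Ur)
  moreover have "((\<lambda>x. B1 * psi x) \<longlongrightarrow> B1 * psi 0) (at_right 0)"
    by (rule tendsto_mono[OF at_le lim]) (auto intro!: continuous_intros psi_continuous)
  ultimately have B1: "U 0 = B1"
    using tendsto_unique[OF trivial_limit_at_right_real] by (auto simp: psi_pos)
  have "((\<lambda>x. A2 * psi x) \<longlongrightarrow> U 0) (at_left 0)"
    by (rule Lim_transform_eventually[OF tendsto_mono[OF at_le lim[OF cU]]])
      (auto simp: eventually_at_filter Ul)
  moreover have "((\<lambda>x. A2 * psi x) \<longlongrightarrow> A2 * psi 0) (at_left 0)"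
    by (rule tendsto_mono[OF at_le lim]) (auto intro!: continuous_intros psi_continuous)
  ultimately have A2: "U 0 = A2"
    using tendsto_unique[OF trivial_limit_at_left_real] by (auto simp: psi_pos)
  have d_eq: "AE x in lborel. rep_l2 d x = U 0 * psi x"
    using U(2) AE_lborel_singleton[of 0]
  proof eventually_elim
    case (elim x)
    then show ?case using Ur[of x] Ul[of x] A2 B1 by (cases "0 < x") auto
  qed
  have "AE x in lborel. x \<in> UNIV \<longrightarrow> rep_l2 d1 x - U 0 * psi_deriv x = 0"
  proof (rule fundamental_lemma[OF _ open_UNIV])
    have lp: "locally_integrable (\<lambda>x. U 0 * psi_deriv x)"
      by (intro locally_integrable_square_integrable square_integrable_cmult psi_deriv_square_integrable)
    then show "locally_integrable (\<lambda>x. rep_l2 d1 x - U 0 * psi_deriv x)"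
      by (intro locally_integrable_diff locally_integrable_rep)
    fix \<phi> assume \<phi>: "\<phi> \<in> test_functions UNIV"
    have "pairing (rep_l2 d1) \<phi> = - pairing (rep_l2 d) (deriv \<phi>)"
      using D1[OF \<phi>] by simp
    also have "pairing (rep_l2 d) (deriv \<phi>) = pairing (\<lambda>x. U 0 * psi x) (deriv \<phi>)"
    proof (rule integral_mult_cong_AE)
      show "AE x in lborel. rep_l2 d x * of_real (deriv \<phi> x) = U 0 * psi x * of_real (deriv \<phi> x)"
        using d_eq by eventually_elim simp
    qed (use test_function_measurable[OF test_function_deriv[OF \<phi>]] in measurable)
    also have "\<dots> = - pairing (\<lambda>x. U 0 * psi_deriv x) \<phi>"
      using psi_integration_by_parts[OF \<phi>] by (simp add: mult.assoc)
    finally show "pairing (\<lambda>x. rep_l2 d1 x - U 0 * psi_deriv x) \<phi> = 0"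
      using integrable_mult_test_function[OF lp \<phi>] integrable_mult_test_function[OF locally_integrable_rep \<phi>]
      by (simp add: left_diff_distrib)
  qed
  then show ?thesis using d_eq by (intro exI[of _ "U 0"]) (auto elim!: AE_mp)
qed

text \<open>
  With \<open>f\<close> the image of \<open>u\<close>, the difference \<open>u - res f\<close> solves the homogeneous equation and hence equals
  \<open>B psi\<close> for some \<open>B\<close>. The boundary values of \<open>u\<close> can now be read off, and the jump conditions satisfied
  by \<open>u\<close> and by \<open>res f\<close> leave \<open>B w = 0\<close>.
\<close>

lemma res_op:
  assumes u: "u \<in> dom_L \<alpha>"
  shows "res (op_L Vp Vm u - z *\<^sub>C u) = u"
proof -
  define f where "f = op_L Vp Vm u - z *\<^sub>C u"
  obtain v1 where v1: "has_weak_derivative 1 UNIV u v1" using u by (auto simp: dom_L_def sobolev_def)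
  obtain v2 where v2: "has_weak_derivative 2 (UNIV - {0}) u v2" using u by (auto simp: dom_L_def sobolev_def)
  have v1': "has_weak_derivative 1 (UNIV - {0}) u v1" by (rule has_weak_derivative_mono[OF v1]) simp
  have v12: "has_weak_derivative 1 (UNIV - {0}) v1 v2"
    using has_weak_derivative_Suc[OF v1', of 1] v2 by (simp add: numeral_2_eq_2)
  have wd1: "weak_derivative 1 (UNIV - {0}) u = v1" by (rule weak_derivative_eq[OF open_punctured v1'])
  have wd2: "weak_derivative 2 (UNIV - {0}) u = v2" by (rule weak_derivative_eq[OF open_punctured v2])
  have f_eq: "AE x in lborel. rep_l2 f x = - rep_l2 v2 x + step_potential Vp Vm x * rep_l2 u x - z * rep_l2 u x"
    unfolding f_def op_L_def wd2
    using rep_minus[of "- v2 + mult_step_potential Vp Vm u" "z *\<^sub>C u"]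
      rep_plus[of "- v2" "mult_step_potential Vp Vm u"] rep_uminus[of v2]
      rep_mult_step_potential[of Vp Vm u] rep_scaleC[of z u]
    by eventually_elim simp
  have "AE x in lborel. rep_l2 (v2 - res_second_deriv f) x = k_squared x * rep_l2 (u - res f) x"
    using f_eq rep_res_second_deriv[of f] rep_res[of f] rep_minus[of v2 "res_second_deriv f"] rep_minus[of u "res f"]
  proof eventually_elim
    case (elim x)
    have v2: "rep_l2 v2 x = step_potential Vp Vm x * rep_l2 u x - z * rep_l2 u x - rep_l2 f x"
      using elim(1) by (simp add: algebra_simps)
    show ?case unfolding elim(2-5) v2 step_shift by (simp add: algebra_simps)
  qed
  from homogeneous_weak_solution[OF has_weak_derivative_diff[OF v1 res_weak_derivative]
      has_weak_derivative_diff[OF v12 res_deriv_weak_derivative] this]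
  obtain B where B: "AE x in lborel. rep_l2 (u - res f) x = B * psi x"
    "AE x in lborel. rep_l2 (v1 - res_deriv f) x = B * psi_deriv x" by blast
  have lim: "(F \<longlongrightarrow> F 0) (at 0)" if "continuous_on UNIV F" for F :: "real \<Rightarrow> complex"
    using that by (simp add: continuous_on_def)
  have pv: "point_value u 0 = kernel_op green (rep_l2 f) 0 + B * psi 0"
  proof (rule point_value_eq)
    show "continuous_on UNIV (\<lambda>x. kernel_op green (rep_l2 f) x + B * psi x)"
      by (intro continuous_intros kernel_op_green_continuous psi_continuous)
    show "AE x in lborel. kernel_op green (rep_l2 f) x + B * psi x = rep_l2 u x"
      using B(1) rep_minus[of u "res f"] rep_res[of f] by eventually_elim (simp add: algebra_simps)
  qed
  have v1_eq: "AE x in lborel. rep_l2 v1 x = kernel_op green_deriv (rep_l2 f) x + B * psi_deriv x"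
    using B(2) rep_minus[of v1 "res_deriv f"] rep_res_deriv[of f] by eventually_elim (simp add: algebra_simps)
  have rv: "right_value v1 0 = right_trace f + B * (- kp * psi 0)"
  proof (rule right_value_eq)
    show "continuous_on {0<..} (\<lambda>x. kernel_op green_deriv (rep_l2 f) x + B * (- kp * psi x))"
      by (intro continuous_intros kernel_op_green_deriv_continuous psi_continuous) auto
    show "AE x in lborel. 0 < x \<longrightarrow> kernel_op green_deriv (rep_l2 f) x + B * (- kp * psi x) = rep_l2 v1 x"
      using v1_eq by eventually_elim (simp add: psi_deriv_def)
    show "((\<lambda>x. kernel_op green_deriv (rep_l2 f) x + B * (- kp * psi x)) \<longlongrightarrow> right_trace f + B * (- kp * psi 0)) (at_right 0)"
      by (intro tendsto_add tendsto_mult tendsto_const right_trace tendsto_mono[OF at_le lim[OF psi_continuous]]) simp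
  qed
  have lv: "left_value v1 0 = left_trace f + B * (km * psi 0)"
  proof (rule left_value_eq)
    show "continuous_on {..<0} (\<lambda>x. kernel_op green_deriv (rep_l2 f) x + B * (km * psi x))"
      by (intro continuous_intros kernel_op_green_deriv_continuous psi_continuous) auto
    show "AE x in lborel. x < 0 \<longrightarrow> kernel_op green_deriv (rep_l2 f) x + B * (km * psi x) = rep_l2 v1 x"
      using v1_eq by eventually_elim (simp add: psi_deriv_def)
    show "((\<lambda>x. kernel_op green_deriv (rep_l2 f) x + B * (km * psi x)) \<longlongrightarrow> left_trace f + B * (km * psi 0)) (at_left 0)"
      by (intro tendsto_add tendsto_mult tendsto_const left_trace tendsto_mono[OF at_le lim[OF psi_continuous]]) simp
  qed
  have "right_value v1 0 - left_value v1 0 = \<alpha> * point_value u 0"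
    using u by (simp add: dom_L_def wd1 del: One_nat_def)
  then have "B * (\<alpha> + kp + km) = 0"
    unfolding pv rv lv using trace_jump[of f] by (simp add: psi_pos algebra_simps)
  then have "B * w = 0" by (subst w_eq)
  then have "B = 0" using w by simp
  then have "AE x in lborel. rep_l2 (res f) x = rep_l2 u x"
    using B(1) rep_minus[of u "res f"] by (auto elim!: AE_mp)
  then show ?thesis using l2_eqI f_def by blast
qed

lemma norm_res: "norm (res f) = l2_norm (kernel_op green (rep_l2 f))"
  unfolding norm_l2_rep by (rule l2_norm_cong_AE) (simp add: l2_rel_def square_integrable_rep sq_green rep_res)

lemma bounded_linear_res: "bounded_linear res"
proof (rule bounded_linear_intro)
  note i = kernel_op_integrable[OF rate_pos exp_kernel_green square_integrable_rep]
  show "res (f + g) = res f + res g" for f g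
  proof (rule l2_eqI)
    have "kernel_op green (rep_l2 (f + g)) = kernel_op green (\<lambda>y. rep_l2 f y + rep_l2 g y)"
      by (rule kernel_op_cong_AE[OF exp_kernel_green _ _ rep_plus]) measurable
    then have k: "kernel_op green (rep_l2 (f + g)) x = kernel_op green (rep_l2 f) x + kernel_op green (rep_l2 g) x" for x
      using i[of x f] i[of x g] by (simp add: kernel_op_def distrib_left)
    show "AE x in lborel. rep_l2 (res (f + g)) x = rep_l2 (res f + res g) x"
      using rep_res[of "f + g"] rep_res[of f] rep_res[of g] rep_plus[of "res f" "res g"]
      by eventually_elim (simp add: k)
  qed
  show "res (r *\<^sub>R f) = r *\<^sub>R res f" for r f
  proof (rule l2_eqI)
    have "kernel_op green (rep_l2 (r *\<^sub>R f)) = kernel_op green (\<lambda>y. of_real r * rep_l2 f y)"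
      by (rule kernel_op_cong_AE[OF exp_kernel_green _ _ rep_scaleR]) measurable
    then have k: "kernel_op green (rep_l2 (r *\<^sub>R f)) x = of_real r * kernel_op green (rep_l2 f) x" for x
      by (simp add: kernel_op_def mult.left_commute)
    show "AE x in lborel. rep_l2 (res (r *\<^sub>R f)) x = rep_l2 (r *\<^sub>R res f) x"
      using rep_res[of "r *\<^sub>R f"] rep_res[of f] rep_scaleR[of r "res f"]
      by eventually_elim (simp add: k)
  qed
  show "norm (res f) \<le> norm f * (2 * (1 / min (cmod kp) (cmod km) + 1 / cmod w) / rate)" for f
    unfolding norm_res norm_l2_rep[of f]
    by (subst mult.commute) (rule Schur_bound(2)[OF rate_pos exp_kernel_green square_integrable_rep])
qed

lemma resolvent_eq: "resolvent (dom_L \<alpha>) (op_L Vp Vm) z = res"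
proof
  fix f
  have inj: "inj_on (\<lambda>u. op_L Vp Vm u - z *\<^sub>C u) (dom_L \<alpha>)"
    by (rule inj_on_inverseI[of _ res]) (rule res_op)
  show "resolvent (dom_L \<alpha>) (op_L Vp Vm) z f = res f"
    unfolding resolvent_def by (rule inv_into_f_eq[OF inj res_in_dom op_res])
qed

lemma in_resolvent_set: "z \<in> resolvent_set (dom_L \<alpha>) (op_L Vp Vm)"
proof -
  have "bij_betw (\<lambda>u. op_L Vp Vm u - z *\<^sub>C u) (dom_L \<alpha>) UNIV"
    by (rule bij_betw_byWitness[of _ res]) (auto simp: res_op op_res res_in_dom)
  then show ?thesis by (simp add: resolvent_set_def resolvent_eq bounded_linear_res)
qed

lemma psi_pairing_bound:
  assumes f: "square_integrable f"
  shows "cmod (LINT y|lborel. psi y * f y) \<le> l2_norm psi * l2_norm f"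
proof -
  have i: "integrable lborel (\<lambda>y. (cmod (psi y))\<^sup>2)" "integrable lborel (\<lambda>y. (cmod (f y))\<^sup>2)"
    "integrable lborel (\<lambda>y. cmod (psi y) * cmod (f y))"
    using psi_square_integrable f integrable_norm[OF psi_mult_integrable[OF f]]
    by (auto simp: square_integrable_def norm_mult)
  have "cmod (LINT y|lborel. psi y * f y) \<le> (LINT y|lborel. cmod (psi y) * cmod (f y))"
    using integral_norm_bound[of lborel "\<lambda>y. psi y * f y"] by (simp add: norm_mult)
  moreover have "(LINT y|lborel. cmod (psi y) * cmod (f y))\<^sup>2 \<le> (l2_norm psi * l2_norm f)\<^sup>2"
    using Cauchy_Schwarz_integral[OF i] by (simp add: l2_norm_power2 power_mult_distrib)
  then have "(LINT y|lborel. cmod (psi y) * cmod (f y)) \<le> l2_norm psi * l2_norm f"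
    by (rule power2_le_imp_le) (simp add: l2_norm_nonneg)
  ultimately show ?thesis by linarith
qed

lemma green_split:
  assumes f: "square_integrable f"
  shows "kernel_op green f x = kernel_op dirichlet_kernel f x + (LINT y|lborel. psi y * f y) / w * psi x"
proof -
  have "kernel_op green f x = (LINT y|lborel. dirichlet_kernel x y * f y + psi x * (psi y / w) * f y)"
    by (simp add: kernel_op_def green_def distrib_right)
  also have "\<dots> = kernel_op dirichlet_kernel f x + (LINT y|lborel. psi x * (psi y / w) * f y)"
    unfolding kernel_op_def
    using kernel_op_integrable[OF rate_pos exp_kernel_dirichlet f] kernel_op_integrable[OF rate_pos exp_kernel_psi f] by simp
  also have "(\<lambda>y. psi x * (psi y / w) * f y) = (\<lambda>y. (psi x / w) * (psi y * f y))" by auto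
  finally show ?thesis by (simp add: mult.commute)
qed

lemma l2_norm_psi: "(l2_norm psi)\<^sup>2 = 1 / (2 * Re kp) + 1 / (2 * Re km)"
  unfolding l2_norm_power2 using psi_square_integral by (simp add: has_bochner_integral_iff)

text \<open>
  The resolvent is the Dirichlet part, bounded by Schur's test, plus the rank-one operator
  \<open>f \<mapsto> (\<integral>psi f / w) psi\<close>, whose norm \<open>\<parallel>psi\<parallel>\<^sup>2 / |w|\<close> is attained at the complex conjugate of \<open>psi\<close>.
\<close>

lemma onorm_res_bound:
  "\<bar>onorm res - (1 / (2 * Re kp) + 1 / (2 * Re km)) / cmod w\<bar> \<le> 2 / (min (cmod kp) (cmod km) * rate)"
proof -
  define E where "E = 2 / (min (cmod kp) (cmod km) * rate)"
  define N where "N = (l2_norm psi)\<^sup>2 / cmod w"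
  have D: "square_integrable (kernel_op dirichlet_kernel f)"
    "l2_norm (kernel_op dirichlet_kernel f) \<le> E * l2_norm f" if "square_integrable f" for f
    using Schur_bound[OF rate_pos exp_kernel_dirichlet that] by (simp_all add: E_def)
  have P: "square_integrable (\<lambda>x. c * psi x)" "l2_norm (\<lambda>x. c * psi x) = cmod c * l2_norm psi" for c
    using psi_square_integrable by (auto intro: square_integrable_cmult simp: l2_norm_cmult)
  have upper: "norm (res f) \<le> (N + E) * norm f" for f
  proof -
    let ?f = "rep_l2 f" and ?c = "(LINT y|lborel. psi y * rep_l2 f y) / w"
    have "norm (res f) = l2_norm (\<lambda>x. kernel_op dirichlet_kernel ?f x + ?c * psi x)"
      unfolding norm_res by (rule arg_cong[of _ _ l2_norm]) (auto simp: green_split[OF square_integrable_rep])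
    also have "\<dots> \<le> l2_norm (kernel_op dirichlet_kernel ?f) + cmod ?c * l2_norm psi"
      using l2_norm_triangle[OF D(1)[OF square_integrable_rep] P(1)] by (simp only: P(2))
    also have "\<dots> \<le> E * l2_norm ?f + (l2_norm psi * l2_norm ?f) / cmod w * l2_norm psi"
      unfolding norm_divide
      by (intro add_mono D square_integrable_rep mult_right_mono divide_right_mono psi_pairing_bound l2_norm_nonneg norm_ge_zero)
    also have "\<dots> = (N + E) * norm f"
      by (simp add: N_def norm_l2_rep power2_eq_square algebra_simps)
    finally show ?thesis .
  qed
  have "0 \<le> N + E" using rate_pos by (simp add: N_def E_def)
  then have le: "onorm res \<le> N + E" by (rule onorm_bound) (rule upper)
  have psi_norm_pos: "0 < l2_norm psi"
  proof -
    have "0 < (l2_norm psi)\<^sup>2" unfolding l2_norm_psi using kp km by (simp add: add_pos_pos)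
    then show ?thesis using l2_norm_nonneg[of psi] by (simp add: order_less_le)
  qed
  have ge: "N \<le> onorm res + E"
  proof -
    have csq: "square_integrable (\<lambda>x. cnj (psi x))"
    proof -
      have "(\<lambda>x. cnj (psi x)) \<in> borel_measurable borel"
        by (intro borel_measurable_continuous_onI continuous_intros psi_continuous)
      then show ?thesis using psi_square_integrable by (simp add: square_integrable_def)
    qed
    define f where "f = abs_l2 (\<lambda>x. cnj (psi x))"
    have f: "AE x in lborel. rep_l2 f x = cnj (psi x)" unfolding f_def by (rule rep_abs_l2[OF csq])
    have nf: "norm f = l2_norm psi"
    proof -
      have "norm f = l2_norm (\<lambda>x. cnj (psi x))"
        unfolding norm_l2_rep by (rule l2_norm_cong_AE) (simp add: l2_rel_def square_integrable_rep csq f)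
      then show ?thesis by (simp add: l2_norm_def)
    qed
    have pair: "(LINT y|lborel. psi y * rep_l2 f y) = of_real ((l2_norm psi)\<^sup>2)"
    proof -
      have "(LINT y|lborel. psi y * rep_l2 f y) = (LINT y|lborel. complex_of_real ((cmod (psi y))\<^sup>2))"
      proof (rule integral_cong_AE)
        show "AE y in lborel. psi y * rep_l2 f y = complex_of_real ((cmod (psi y))\<^sup>2)"
          using f by eventually_elim (simp add: complex_norm_square[symmetric])
      qed measurable
      then show ?thesis by (simp only: integral_complex_of_real l2_norm_power2)
    qed
    let ?c = "of_real ((l2_norm psi)\<^sup>2) / w"
    have "N * l2_norm psi = l2_norm (\<lambda>x. ?c * psi x)"
      by (simp only: P(2)) (simp add: N_def norm_divide norm_power l2_norm_nonneg)
    also have "(\<lambda>x. ?c * psi x) = (\<lambda>x. kernel_op green (rep_l2 f) x + (- 1) * kernel_op dirichlet_kernel (rep_l2 f) x)"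
      by (simp add: green_split[OF square_integrable_rep] pair)
    also have "l2_norm \<dots> \<le> l2_norm (kernel_op green (rep_l2 f)) + l2_norm (\<lambda>x. (- 1) * kernel_op dirichlet_kernel (rep_l2 f) x)"
      by (intro l2_norm_triangle sq_green square_integrable_cmult D square_integrable_rep)
    also have "\<dots> = norm (res f) + l2_norm (kernel_op dirichlet_kernel (rep_l2 f))"
      by (simp only: norm_res l2_norm_cmult) simp
    also have "\<dots> \<le> onorm res * norm f + E * l2_norm (rep_l2 f)"
      by (intro add_mono onorm[OF bounded_linear_res] D square_integrable_rep)
    also have "\<dots> = (onorm res + E) * l2_norm psi"
      using nf by (simp add: norm_l2_rep[symmetric] algebra_simps)
    finally show ?thesis using psi_norm_pos by simp
  qed
  show ?thesis
    using le ge unfolding E_def[symmetric] l2_norm_psi[symmetric] N_def by linarith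
qed

end

section \<open>Asymptotics for large real part\<close>

text \<open>
  Comparing real and imaginary parts of \<open>k\<^sup>2 = V - z\<close>: the product \<open>2 Re k Im k\<close> stays bounded while
  \<open>(Im k)\<^sup>2 - (Re k)\<^sup>2\<close> is \<open>L\<^sup>2\<close> up to a bounded term. So \<open>|Im k|\<close> is close to \<open>L\<close> and \<open>Re k\<close> is of order \<open>1 / L\<close>.
\<close>

lemma csqrt_boundary_layer:
  fixes V z :: complex and L r \<Delta> :: real
  assumes L: "1 \<le> L" "Re z = L\<^sup>2" and r: "\<bar>Re V\<bar> \<le> r" "4 * r \<le> L\<^sup>2"
    and \<delta>: "Im V \<noteq> Im z" "\<bar>Im V - Im z\<bar> \<le> \<Delta>"
  defines "k \<equiv> csqrt (V - z)"
  shows "k\<^sup>2 = V - z" "0 < Re k" "2 * Re k * Im k = Im V - Im z" "L / 2 \<le> \<bar>Im k\<bar>"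
    "\<bar>\<bar>Im k\<bar> - L\<bar> \<le> (\<Delta>\<^sup>2 + r) / L" "Re k \<le> \<Delta> / L"
proof -
  show sq: "k\<^sup>2 = V - z" by (simp add: k_def)
  have re: "(Re k)\<^sup>2 - (Im k)\<^sup>2 = Re V - L\<^sup>2"
    using arg_cong[OF sq, of Re] L(2) by (simp add: power2_eq_square)
  show im: "2 * Re k * Im k = Im V - Im z"
    using arg_cong[OF sq, of Im] by (simp add: power2_eq_square mult_ac)
  have "0 \<le> Re k" unfolding k_def using csqrt_principal[of "V - z"] by auto
  moreover have "Re k \<noteq> 0" using im \<delta>(1) by auto
  ultimately show a: "0 < Re k" by simp
  let ?b = "\<bar>Im k\<bar>"
  have b2: "?b\<^sup>2 = L\<^sup>2 - Re V + (Re k)\<^sup>2" using re by simp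
  have "(L / 2)\<^sup>2 \<le> ?b\<^sup>2"
  proof -
    have "(L / 2)\<^sup>2 = L\<^sup>2 / 4" by (simp add: power_divide)
    moreover have "0 \<le> (Re k)\<^sup>2" "0 \<le> L\<^sup>2" by simp_all
    ultimately show ?thesis using b2 r by linarith
  qed
  then show b: "L / 2 \<le> ?b" by (rule power2_le_imp_le) simp
  have "2 * Re k * ?b = \<bar>Im V - Im z\<bar>"
    using im a by (metis abs_mult abs_of_pos mult_pos_pos zero_less_numeral)
  then have ab: "2 * Re k * ?b \<le> \<Delta>" using \<delta>(2) by simp
  have "2 * Re k * (L / 2) \<le> 2 * Re k * ?b" using a b by (intro mult_left_mono) auto
  then have "Re k * L \<le> \<Delta>" using ab by simp
  then show aL: "Re k \<le> \<Delta> / L" using L by (simp add: pos_le_divide_eq)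
  have "0 \<le> \<Delta>" using \<delta>(2) by linarith
  then have "\<Delta> / L \<le> \<Delta>" using divide_left_mono[of 1 L \<Delta>] L(1) by simp
  then have "(Re k)\<^sup>2 \<le> \<Delta>\<^sup>2" using aL a by (intro power_mono) auto
  have "\<bar>?b - L\<bar> * L \<le> \<bar>?b - L\<bar> * (?b + L)" by (intro mult_left_mono) auto
  also have "\<dots> = \<bar>(?b - L) * (?b + L)\<bar>" using L by (simp add: abs_mult)
  also have "(?b - L) * (?b + L) = (Re k)\<^sup>2 - Re V" using b2 by (simp add: algebra_simps power2_eq_square)
  also have "\<bar>(Re k)\<^sup>2 - Re V\<bar> \<le> \<Delta>\<^sup>2 + r" using \<open>(Re k)\<^sup>2 \<le> \<Delta>\<^sup>2\<close> r(1) zero_le_power2[of "Re k"] by linarith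
  finally show "\<bar>?b - L\<bar> \<le> (\<Delta>\<^sup>2 + r) / L" using L by (simp add: pos_le_divide_eq)
qed

text \<open>
  The quotient of \<open>n\<close> by the leading term \<open>T / A\<close> differs from \<open>1\<close> by three errors: that of \<open>n\<close> as an
  approximation of \<open>S / W\<close>, that of \<open>S\<close> relative to \<open>T\<close>, and that of \<open>W\<close> relative to \<open>A\<close>.
\<close>

lemma relative_error_bound:
  fixes n S T W A L c c2 E :: real
  assumes L: "1 \<le> L" and T: "0 < T" and A: "0 < A" and c: "0 \<le> c"
    and S: "\<bar>S - T\<bar> \<le> c / L * T" and W: "\<bar>W - A\<bar> \<le> c2 / L" "c2 / L \<le> A / 2"
    and n: "\<bar>n - S / W\<bar> \<le> E" and E: "E \<le> 16 * T / L"
  shows "\<bar>n / (T / A) - 1\<bar> \<le> (16 * A + 2 * c + 2 * c2 / A) / L"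
proof -
  have Wh: "A / 2 \<le> W" using W by linarith
  then have Wp: "0 < W" using A by linarith
  have split: "n / (T / A) - 1 = (n - S / W) * (A / T) + ((S - T) / T) * (A / W) + (A - W) / W"
    using T A Wp by (simp add: field_simps)
  have "\<bar>(n - S / W) * (A / T)\<bar> \<le> (16 * T / L) * (A / T)"
    using n E T A by (simp only: abs_mult, intro mult_mono) auto
  also have "\<dots> = 16 * A / L" using T by simp
  finally have 1: "\<bar>(n - S / W) * (A / T)\<bar> \<le> 16 * A / L" .
  have "\<bar>(S - T) / T\<bar> \<le> c / L" using S T by (simp add: abs_divide pos_divide_le_eq)
  moreover have "\<bar>A / W\<bar> \<le> 2" using Wh Wp A by (simp add: abs_divide pos_divide_le_eq)
  ultimately have "\<bar>((S - T) / T) * (A / W)\<bar> \<le> (c / L) * 2"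
    unfolding abs_mult using c L by (intro mult_mono) auto
  then have 2: "\<bar>((S - T) / T) * (A / W)\<bar> \<le> 2 * c / L" by (simp add: mult.commute)
  have "0 \<le> c2 / L" using order_trans[OF abs_ge_zero W(1)] .
  then have "\<bar>(A - W) / W\<bar> \<le> (c2 / L) / (A / 2)"
    unfolding abs_divide using W(1) Wh Wp A by (intro frac_le) auto
  also have "\<dots> = 2 * c2 / A / L" by (simp add: mult.commute)
  finally have 3: "\<bar>(A - W) / W\<bar> \<le> 2 * c2 / A / L" .
  show ?thesis unfolding split unfolding add_divide_distrib using 1 2 3 by linarith
qed

text \<open>
  Since \<open>Im z\<close> lies between \<open>Im Vp\<close> and \<open>Im Vm\<close>, the square roots have imaginary parts of opposite sign
  and nearly equal modulus, so that \<open>kp + km\<close> is of order \<open>1 / L\<close> and \<open>w\<close> is close to \<open>\<alpha>\<close>. The identity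
  \<open>1 / (2 Re k) = |Im k| / |Im V - Im z|\<close> turns the exact value of \<open>\<parallel>psi\<parallel>\<^sup>2\<close> into the leading factor.
\<close>

lemma resolvent_asymptotics_bound:
  fixes Vp Vm \<alpha> z :: complex and L r \<Delta> c c2 :: real
  assumes L: "1 \<le> L" "Re z = L\<^sup>2" and r: "\<bar>Re Vp\<bar> \<le> r" "\<bar>Re Vm\<bar> \<le> r" "4 * r \<le> L\<^sup>2"
    and opp: "(Im Vp - Im z) * (Im Vm - Im z) < 0"
    and \<Delta>: "\<Delta> = \<bar>Im Vp - Im z\<bar> + \<bar>Im Vm - Im z\<bar>"
    and c: "c = \<Delta>\<^sup>2 + r" "c \<le> L\<^sup>2" and c2: "c2 = 2 * \<Delta> + 2 * c" "c2 / L \<le> cmod \<alpha> / 2" and \<alpha>: "\<alpha> \<noteq> 0"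
  shows "z \<in> resolvent_set (dom_L \<alpha>) (op_L Vp Vm)"
    and "\<bar>onorm (resolvent (dom_L \<alpha>) (op_L Vp Vm) z) /
       (\<Delta> * L / (cmod \<alpha> * \<bar>Im Vp - Im z\<bar> * \<bar>Im Vm - Im z\<bar>)) - 1\<bar>
       \<le> (16 * cmod \<alpha> + 2 * c + 2 * c2 / cmod \<alpha>) / L"
proof -
  define kp km where "kp = csqrt (Vp - z)" and "km = csqrt (Vm - z)"
  define w where "w = \<alpha> + kp + km"
  define dp dm where "dp = \<bar>Im Vp - Im z\<bar>" and "dm = \<bar>Im Vm - Im z\<bar>"
  have ne: "Im Vp \<noteq> Im z" "Im Vm \<noteq> Im z" using opp by auto
  have d: "0 < dp" "0 < dm" "dp \<le> \<Delta>" "dm \<le> \<Delta>" "\<Delta> = dp + dm"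
    using ne \<Delta> by (auto simp: dp_def dm_def)
  note p = csqrt_boundary_layer[OF L r(1,3) ne(1) d(3)[unfolded dp_def], folded kp_def c(1)]
  note m = csqrt_boundary_layer[OF L r(2,3) ne(2) d(4)[unfolded dm_def], folded km_def c(1)]
  have sum_small: "cmod (kp + km) \<le> c2 / L"
  proof -
    have "(2 * Re kp * Im kp) * (2 * Re km * Im km) < 0" using opp by (simp only: p(3) m(3))
    then have "(4 * (Re kp * Re km)) * (Im kp * Im km) < 0" by (simp add: mult_ac)
    moreover have "0 < 4 * (Re kp * Re km)" using p(2) m(2) by simp
    moreover have "Y < 0" if "X * Y < 0" "0 < X" for X Y :: real
      using that by (simp add: mult_less_0_iff)
    ultimately have "Im kp * Im km < 0" by blast
    then have "\<bar>Im kp + Im km\<bar> = \<bar>\<bar>Im kp\<bar> - \<bar>Im km\<bar>\<bar>" by (auto simp: mult_less_0_iff)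
    also have "\<dots> \<le> 2 * c / L" using p(5) m(5) by simp
    finally have "\<bar>Im (kp + km)\<bar> \<le> 2 * c / L" by simp
    moreover have "\<bar>Re (kp + km)\<bar> \<le> 2 * \<Delta> / L" using p(2,6) m(2,6) by simp
    moreover have "2 * \<Delta> / L + 2 * c / L = c2 / L" by (simp add: c2(1) add_divide_distrib)
    ultimately show ?thesis using cmod_le[of "kp + km"] by linarith
  qed
  have W: "\<bar>cmod w - cmod \<alpha>\<bar> \<le> c2 / L"
    using norm_triangle_ineq3[of w \<alpha>] sum_small by (simp add: w_def add.assoc)
  have \<alpha>0: "0 < cmod \<alpha>" using \<alpha> by simp
  have w0: "w \<noteq> 0" 
  proof
    assume "w = 0"
    then have "cmod \<alpha> \<le> c2 / L" using W by simp
    then show False using c2(2) \<alpha>0 by linarith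
  qed
  interpret step_resolvent kp km w Vp Vm \<alpha> z
    by unfold_locales (use p m w0 in \<open>simp_all add: w_def\<close>)
  show "z \<in> resolvent_set (dom_L \<alpha>) (op_L Vp Vm)" by (rule in_resolvent_set)
  \<comment> \<open>\<open>S\<close> is the squared norm of \<open>psi\<close>, and \<open>T\<close> its leading part.\<close>
  define S where "S = \<bar>Im kp\<bar> / dp + \<bar>Im km\<bar> / dm"
  define T where "T = L / dp + L / dm"
  have ab: "2 * Re kp * \<bar>Im kp\<bar> = dp" "2 * Re km * \<bar>Im km\<bar> = dm"
    unfolding dp_def dm_def p(3)[symmetric] m(3)[symmetric] using p(2) m(2) by (simp_all add: abs_mult)
  have b0: "0 < \<bar>Im kp\<bar>" "0 < \<bar>Im km\<bar>" using p(4) m(4) L(1) by linarith+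
  have Sinv: "1 / (2 * Re kp) = \<bar>Im kp\<bar> / dp" "1 / (2 * Re km) = \<bar>Im km\<bar> / dm"
    unfolding ab[symmetric] using b0 p(2) m(2) by simp_all
  have n: "\<bar>onorm res - S / cmod w\<bar> \<le> 2 / (min (cmod kp) (cmod km) * rate)"
    using onorm_res_bound by (simp only: Sinv S_def)
  have T0: "0 < T" using L d by (simp add: T_def add_pos_pos)
  have ST: "\<bar>S - T\<bar> \<le> c / L * T"
  proof -
    have "S - T = (\<bar>Im kp\<bar> - L) / dp + (\<bar>Im km\<bar> - L) / dm" by (simp add: S_def T_def diff_divide_distrib)
    also have "\<bar>\<dots>\<bar> \<le> \<bar>(\<bar>Im kp\<bar> - L) / dp\<bar> + \<bar>(\<bar>Im km\<bar> - L) / dm\<bar>" by (rule abs_triangle_ineq)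
    also have "\<dots> = \<bar>\<bar>Im kp\<bar> - L\<bar> / dp + \<bar>\<bar>Im km\<bar> - L\<bar> / dm" using d by (simp add: abs_divide)
    also have "\<dots> \<le> (c / L) / dp + (c / L) / dm" using d p(5) m(5) by (intro add_mono divide_right_mono) auto
    also have "\<dots> \<le> ((c / L) / dp + (c / L) / dm) * L"
    proof -
      have "0 \<le> c" using r c(1) by (meson abs_ge_zero add_nonneg_nonneg order_trans zero_le_power2)
      then have "0 \<le> (c / L) / dp + (c / L) / dm" using d L by simp
      then show ?thesis using L by (simp add: mult_le_cancel_left1)
    qed
    also have "\<dots> = c / L * T" by (simp add: T_def algebra_simps)
    finally show ?thesis .
  qed
  have E: "2 / (min (cmod kp) (cmod km) * rate) \<le> 16 * T / L"
  proof -
    have b_le: "\<bar>Im kp\<bar> \<le> 2 * L" "\<bar>Im km\<bar> \<le> 2 * L"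
    proof -
      have "c / L \<le> L" using c(2) L by (simp add: pos_divide_le_eq power2_eq_square)
      then show "\<bar>Im kp\<bar> \<le> 2 * L" "\<bar>Im km\<bar> \<le> 2 * L" using p(5) m(5) by linarith+
    qed
    have a_ge: "min dp dm / (4 * L) \<le> x" if "2 * x * b = y" "0 < x" "b \<le> 2 * L" "min dp dm \<le> y" for x b y
    proof -
      have "min dp dm \<le> 2 * x * b" using that by simp
      also have "\<dots> \<le> 2 * x * (2 * L)" using that by (intro mult_left_mono) auto
      finally show ?thesis using L by (simp add: pos_divide_le_eq mult_ac)
    qed
    \<comment> \<open>Neither factor of the denominator is controlled alone: \<open>rate\<close> may be as small as \<open>1 / L\<close> times
      the distance of \<open>Im z\<close> to the boundary, but the other factor is of order \<open>L\<close>.\<close>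
    have "min dp dm / (4 * L) \<le> rate"
      unfolding rate_def using a_ge[OF ab(1) p(2) b_le(1)] a_ge[OF ab(2) m(2) b_le(2)] by simp
    moreover have "L / 2 \<le> min (cmod kp) (cmod km)"
      using p(4) m(4) abs_Im_le_cmod[of kp] abs_Im_le_cmod[of km] by simp
    ultimately have "(L / 2) * (min dp dm / (4 * L)) \<le> min (cmod kp) (cmod km) * rate"
      using L d by (intro mult_mono) auto
    moreover have "(L / 2) * (min dp dm / (4 * L)) = min dp dm / 8" using L by simp
    ultimately have "min dp dm / 8 \<le> min (cmod kp) (cmod km) * rate" by simp
    then have "2 / (min (cmod kp) (cmod km) * rate) \<le> 2 / (min dp dm / 8)"
      using d by (intro divide_left_mono) (auto simp: mult_pos_pos rate_pos k_nonzero)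
    also have "\<dots> = 16 * (1 / min dp dm)" by simp
    also have "1 / min dp dm \<le> 1 / dp + 1 / dm" using d by (cases "dp \<le> dm") (simp_all add: min_def)
    also have "16 * (1 / dp + 1 / dm) = 16 * T / L" using L by (simp add: T_def field_simps)
    finally show ?thesis by simp
  qed
  have TA: "\<Delta> * L / (cmod \<alpha> * dp * dm) = T / cmod \<alpha>"
    using d \<alpha>0 by (simp add: T_def field_simps)
  have "0 \<le> c" using r c(1) by (meson abs_ge_zero add_nonneg_nonneg order_trans zero_le_power2)
  from relative_error_bound[OF L(1) T0 \<alpha>0 this ST W c2(2) n E]
  show "\<bar>onorm (resolvent (dom_L \<alpha>) (op_L Vp Vm) z) /
       (\<Delta> * L / (cmod \<alpha> * \<bar>Im Vp - Im z\<bar> * \<bar>Im Vm - Im z\<bar>)) - 1\<bar>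
       \<le> (16 * cmod \<alpha> + 2 * c + 2 * c2 / cmod \<alpha>) / L"
    unfolding resolvent_eq dp_def[symmetric] dm_def[symmetric] TA .
qed

theorem theorem2p14:
  fixes Vp Vm \<alpha> :: complex
  assumes "Im Vp \<noteq> Im Vm" and "\<alpha> \<noteq> 0"
  shows "\<exists>M>0. \<exists>C>0. \<forall>z::complex.
    Re z \<ge> M \<and> Im z \<in> {min (Im Vp) (Im Vm)<..<max (Im Vp) (Im Vm)} \<longrightarrow>
      z \<in> resolvent_set (dom_L \<alpha>) (op_L Vp Vm) \<and>
      \<bar>onorm (resolvent (dom_L \<alpha>) (op_L Vp Vm) z) /
         (\<bar>Im Vp - Im Vm\<bar> * sqrt (Re z) /
           (cmod \<alpha> * \<bar>Im Vp - Im z\<bar> * \<bar>Im Vm - Im z\<bar>)) - 1\<bar>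
       \<le> C / \<bar>Re z\<bar> powr (1/2)"
proof -
  define r \<Delta> where "r = \<bar>Re Vp\<bar> + \<bar>Re Vm\<bar>" and "\<Delta> = \<bar>Im Vp - Im Vm\<bar>"
  define c c2 where "c = \<Delta>\<^sup>2 + r" and "c2 = 2 * \<Delta> + 2 * c"
  define q where "q = 2 * c2 / cmod \<alpha>"
  \<comment> \<open>The four summands ensure \<open>1 \<le> L\<close>, \<open>|Im k| \<ge> L / 2\<close>, \<open>|Im k| \<le> 2 L\<close> and \<open>|w| \<ge> |\<alpha>| / 2\<close>.\<close>
  define M where "M = 1 + 4 * r + c + q\<^sup>2"
  define C where "C = 16 * cmod \<alpha> + 2 * c + 2 * c2 / cmod \<alpha>"
  have pos: "0 \<le> r" "0 \<le> \<Delta>" "0 \<le> c" "0 \<le> c2" "0 < cmod \<alpha>" "0 \<le> q"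
    using assms(2) by (auto simp: r_def \<Delta>_def c_def c2_def q_def)
  have "0 < M" unfolding M_def using pos by (simp add: add_pos_nonneg)
  moreover have "0 < C" unfolding C_def using pos by (simp add: add_pos_nonneg)
  moreover have "z \<in> resolvent_set (dom_L \<alpha>) (op_L Vp Vm) \<and>
      \<bar>onorm (resolvent (dom_L \<alpha>) (op_L Vp Vm) z) /
         (\<bar>Im Vp - Im Vm\<bar> * sqrt (Re z) /
           (cmod \<alpha> * \<bar>Im Vp - Im z\<bar> * \<bar>Im Vm - Im z\<bar>)) - 1\<bar>
       \<le> C / \<bar>Re z\<bar> powr (1/2)"
    if z: "M \<le> Re z" "Im z \<in> {min (Im Vp) (Im Vm)<..<max (Im Vp) (Im Vm)}" for z
  proof -
    define L where "L = sqrt (Re z)"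
    have rz: "1 \<le> Re z" "4 * r \<le> Re z" "c \<le> Re z" "q\<^sup>2 \<le> Re z"
      using z(1) pos unfolding M_def by (simp_all add: add_increasing add_increasing2)
        (smt (verit) zero_le_power2)+
    have L2: "Re z = L\<^sup>2" using rz(1) by (simp add: L_def)
    have L1: "1 \<le> L" using rz(1) by (simp add: L_def)
    have "q \<le> L" unfolding L_def by (rule real_le_rsqrt[OF rz(4)])
    then have small: "c2 / L \<le> cmod \<alpha> / 2"
      using pos L1 by (simp add: q_def field_simps)
    have opp: "(Im Vp - Im z) * (Im Vm - Im z) < 0"
      using z(2) by (auto simp: mult_less_0_iff min_def max_def split: if_splits)
    have \<Delta>: "\<Delta> = \<bar>Im Vp - Im z\<bar> + \<bar>Im Vm - Im z\<bar>"
      using z(2) by (auto simp: \<Delta>_def min_def max_def split: if_splits)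
    have pw: "\<bar>Re z\<bar> powr (1 / 2) = L" using rz(1) by (simp add: L_def powr_half_sqrt)
    have "\<bar>Re Vp\<bar> \<le> r" "\<bar>Re Vm\<bar> \<le> r" by (simp_all add: r_def)
    note * = resolvent_asymptotics_bound[OF L1 L2 this rz(2)[unfolded L2] opp \<Delta> c_def rz(3)[unfolded L2] c2_def small assms(2)]
    show ?thesis
      unfolding pw L_def[symmetric] \<Delta>_def[symmetric] C_def by (intro conjI *)
  qed
  ultimately show ?thesis by blast
qed

end
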